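(* Let $G$ be a finite simple graph with treewidth at most $6$. Then $\tau(G)\leq 2\,\nu(G)$.
   Context: A triangle transversal of a graph $G$ is a set of edges of $G$ whose removal leaves a triangle-free graph; a triangle packing of $G$ is a set of pairwise edge-disjoint triangles of $G$. $\tau(G)$ denotes the minimum size of a triangle transversal of $G$, and $\nu(G)$ the maximum size of a triangle packing of $G$. *)

theory Defs
  imports Main
begin

text \<open>A finite simple graph: finite vertex set V, edges are 2-element subsets of V.\<close>
definition simple_graph :: "'a set \<Rightarrow> 'a set set \<Rightarrow> bool" where
  "simple_graph V E \<longleftrightarrow> finite V \<and> (\<forall>e\<in>E. e \<subseteq> V \<and> card e = 2)"

text \<open>A subset S of vertices induces a connected subgraph of (V,E).\<close>
definition connected_in :: "'b set set \<Rightarrow> 'b set \<Rightarrow> bool" where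
  "connected_in E S \<longleftrightarrow> S \<noteq> {} \<and>
     (\<forall>x\<in>S. \<forall>y\<in>S. (x, y) \<in> ({(u, v). u \<in> S \<and> v \<in> S \<and> {u, v} \<in> E})\<^sup>*)"

text \<open>A (finite) tree: a nonempty connected simple graph with |V|-1 edges.\<close>
definition is_tree :: "'b set \<Rightarrow> 'b set set \<Rightarrow> bool" where
  "is_tree I TE \<longleftrightarrow> simple_graph I TE \<and> connected_in TE I \<and> card TE + 1 = card I"

text \<open>Tree decomposition of (V,E) over tree (I,TE) with bags B.\<close>
definition tree_decomposition ::
  "'a set \<Rightarrow> 'a set set \<Rightarrow> nat set \<Rightarrow> nat set set \<Rightarrow> (nat \<Rightarrow> 'a set) \<Rightarrow> bool" where
  "tree_decomposition V E I TE B \<longleftrightarrow>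
     is_tree I TE \<and> (\<forall>i\<in>I. B i \<subseteq> V) \<and>
     (\<forall>v\<in>V. \<exists>i\<in>I. v \<in> B i) \<and>
     (\<forall>e\<in>E. \<exists>i\<in>I. e \<subseteq> B i) \<and>
     (\<forall>v\<in>V. connected_in TE {i\<in>I. v \<in> B i})"

text \<open>Treewidth at most k: a tree decomposition with all bags of size at most k+1.\<close>
definition treewidth_le :: "'a set \<Rightarrow> 'a set set \<Rightarrow> nat \<Rightarrow> bool" where
  "treewidth_le V E k \<longleftrightarrow> (\<exists>I TE B. tree_decomposition V E I TE B \<and> (\<forall>i\<in>I. card (B i) \<le> k + 1))"

text \<open>Triangles, as 3-element vertex sets, and their edges.\<close>
definition triangles :: "'a set \<Rightarrow> 'a set set \<Rightarrow> 'a set set" where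
  "triangles V E = {{a, b, c} | a b c. a \<in> V \<and> b \<in> V \<and> c \<in> V \<and>
      a \<noteq> b \<and> b \<noteq> c \<and> a \<noteq> c \<and> {a, b} \<in> E \<and> {b, c} \<in> E \<and> {a, c} \<in> E}"

definition tri_edges :: "'a set \<Rightarrow> 'a set set" where
  "tri_edges t = {e. e \<subseteq> t \<and> card e = 2}"

definition triangle_transversal :: "'a set \<Rightarrow> 'a set set \<Rightarrow> 'a set set \<Rightarrow> bool" where
  "triangle_transversal V E F \<longleftrightarrow> F \<subseteq> E \<and> triangles V (E - F) = {}"

definition triangle_packing :: "'a set \<Rightarrow> 'a set set \<Rightarrow> 'a set set \<Rightarrow> bool" where
  "triangle_packing V E P \<longleftrightarrow> P \<subseteq> triangles V E \<and>
     (\<forall>s\<in>P. \<forall>t\<in>P. s \<noteq> t \<longrightarrow> tri_edges s \<inter> tri_edges t = {})"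

definition tau :: "'a set \<Rightarrow> 'a set set \<Rightarrow> nat" where
  "tau V E = Min (card ` {F. triangle_transversal V E F})"

definition nu :: "'a set \<Rightarrow> 'a set set \<Rightarrow> nat" where
  "nu V E = Max (card ` {P. triangle_packing V E P})"

end

theory Submission
  imports Defs "HOL-Library.List_Lexorder"
begin

text \<open>Suppose \<open>Y\<close> is a packing and \<open>S\<close>, \<open>X\<close> are sets of edges such that \<open>|X| \<le> 2|Y|\<close>, all edges of \<open>Y\<close> lie in
\<open>S \<union> X\<close>, and every triangle meeting \<open>S\<close> meets \<open>X\<close>. Deleting \<open>S \<union> X\<close> lowers \<open>\<nu>\<close> by at least \<open>|Y|\<close> and \<open>\<tau>\<close>
by at most \<open>|X|\<close>, so a minimal counterexample is irreducible, that is, it admits no such triple.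

In an irreducible graph a non-isolated vertex has degree at least 5, and if its degree is at most 6, the
non-edges of its link form a matching. Prune the leaves of a tree decomposition of width 6 one by
one, keeping the invariant that each forgotten vertex is a pendant: it has degree at most 6 and its neighbourhood
lies in one of the remaining bags. When the leaf bag \<open>B\<close> is pruned, a vertex \<open>w\<close> that occurs only in \<open>B\<close>
has all its neighbours in \<open>B\<close> or among the pendants at \<open>B\<close>. If \<open>w\<close> is adjacent to one or two pendants,
or to another vertex private to \<open>B\<close>, there is a reduction. Three pendants adjacent to \<open>w\<close>
are reducible by themselves unless the sets of vertices of \<open>B\<close> they miss are three disjoint pairs; so there are
at most three of them, and then they are reducible together with \<open>w\<close>. Hence \<open>w\<close> becomes a pendant at
the neighbouring bag, and in the end no edge is left.

These local claims are finite case distinctions; they are verified by evaluating a checker on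
decision trees whose leaves are reductions.\<close>

section \<open>Reductions\<close>

definition nbrs :: "'a set set \<Rightarrow> 'a \<Rightarrow> 'a set" where
  "nbrs E v = {u. {v, u} \<in> E}"

text \<open>\<open>S\<close> and \<open>X\<close> may overlap, and \<open>Y\<close> may be empty: an
  edge in no triangle gives a reduction with \<open>X = {}\<close> and \<open>Y = {}\<close>.
  Nonemptiness of \<open>S \<union> X\<close> makes the deletion strict, which drives the induction
  on the number of edges.\<close>

definition reduction :: "'a set set \<Rightarrow> 'a set set \<Rightarrow> 'a set set \<Rightarrow> 'a set set \<Rightarrow> bool" where
  "reduction E S X Y \<longleftrightarrow> S \<subseteq> E \<and> X \<subseteq> E \<and> S \<union> X \<noteq> {} \<and> finite Y \<and>
     (\<forall>t\<in>Y. card t = 3 \<and> tri_edges t \<subseteq> S \<union> X) \<and>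
     (\<forall>s\<in>Y. \<forall>t\<in>Y. s \<noteq> t \<longrightarrow> tri_edges s \<inter> tri_edges t = {}) \<and>
     card X \<le> 2 * card Y \<and>
     (\<forall>t. card t = 3 \<and> tri_edges t \<subseteq> E \<and> tri_edges t \<inter> S \<noteq> {} \<longrightarrow> tri_edges t \<inter> X \<noteq> {})"

section \<open>Triangles, transversals and packings in a finite graph\<close>

lemma tri_edges_triple:
  assumes "a \<noteq> b" "a \<noteq> c" "b \<noteq> c"
  shows "tri_edges {a, b, c} = {{a, b}, {a, c}, {b, c}}"
proof -
  have "e \<in> {{a, b}, {a, c}, {b, c}}" if "e \<subseteq> {a, b, c}" "card e = 2" for e
  proof -
    obtain x y where "e = {x, y}" "x \<noteq> y" using \<open>card e = 2\<close> by (meson card_2_iff)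
    with that(1) show ?thesis by (auto simp: insert_commute)
  qed
  then have "tri_edges {a, b, c} \<subseteq> {{a, b}, {a, c}, {b, c}}" unfolding tri_edges_def by blast
  moreover have "{{a, b}, {a, c}, {b, c}} \<subseteq> tri_edges {a, b, c}"
    using assms by (simp add: tri_edges_def)
  ultimately show ?thesis by blast
qed

lemma simple_graph_finite: "simple_graph V E \<Longrightarrow> finite E"
  unfolding simple_graph_def by (meson Pow_iff finite_Pow_iff finite_subset subsetI)

lemma simple_graph_subset: "simple_graph V E \<Longrightarrow> E' \<subseteq> E \<Longrightarrow> simple_graph V E'"
  by (auto simp: simple_graph_def)

lemma tri_edges_nonempty:
  assumes "card t = 3" shows "tri_edges t \<noteq> {}"
proof -
  obtain a b c where "t = {a, b, c}" "a \<noteq> b" "a \<noteq> c" "b \<noteq> c"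
    using assms by (metis card_3_iff)
  then show ?thesis by (simp add: tri_edges_triple)
qed

text \<open>Every edge lies inside \<open>V\<close>, so the vertex condition in
  \<open>triangles\<close> is automatic. In this form triangles of a graph and of a subgraph are
  compared through their edges alone.\<close>

lemma triangles_eq:
  assumes "simple_graph V E"
  shows "triangles V E = {t. card t = 3 \<and> tri_edges t \<subseteq> E}"
proof (intro equalityI subsetI)
  fix t assume "t \<in> triangles V E"
  then obtain a b c where t: "t = {a, b, c}" "a \<noteq> b" "b \<noteq> c" "a \<noteq> c"
    and E: "{a, b} \<in> E" "{b, c} \<in> E" "{a, c} \<in> E"
    unfolding triangles_def by blast
  have "card t = 3" using t by simp
  moreover have "tri_edges t \<subseteq> E" using t E by (simp add: tri_edges_triple)
  ultimately show "t \<in> {t. card t = 3 \<and> tri_edges t \<subseteq> E}" by simp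
next
  fix t assume "t \<in> {t. card t = 3 \<and> tri_edges t \<subseteq> E}"
  then have t3: "card t = 3" and tE: "tri_edges t \<subseteq> E" by auto
  obtain a b c where t: "t = {a, b, c}" "a \<noteq> b" "a \<noteq> c" "b \<noteq> c"
    using t3 by (metis card_3_iff)
  then have E: "{a, b} \<in> E" "{a, c} \<in> E" "{b, c} \<in> E" using tE by (simp_all add: tri_edges_triple)
  then have "{a, b} \<subseteq> V" "{b, c} \<subseteq> V" using assms by (auto simp: simple_graph_def)
  then have "a \<in> V" "b \<in> V" "c \<in> V" by auto
  then show "t \<in> triangles V E" unfolding triangles_def using t E by blast
qed

context
  fixes V :: "'a set" and E :: "'a set set"
  assumes simple: "simple_graph V E"
begin

lemma finite_transversals: "finite {F. triangle_transversal V E F}"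
  by (rule finite_subset[of _ "Pow E"])
    (use simple_graph_finite[OF simple] in \<open>auto simp: triangle_transversal_def\<close>)

lemma finite_packings: "finite {P. triangle_packing V E P}"
proof (rule finite_subset)
  show "{P. triangle_packing V E P} \<subseteq> Pow (Pow V)"
    by (auto simp: triangle_packing_def triangles_def)
  show "finite (Pow (Pow V))" using simple by (simp add: simple_graph_def)
qed

lemma tau_le: "triangle_transversal V E F \<Longrightarrow> tau V E \<le> card F"
  unfolding tau_def using finite_transversals by (intro Min_le) auto

lemma le_nu: "triangle_packing V E P \<Longrightarrow> card P \<le> nu V E"
  unfolding nu_def using finite_packings by (intro Max_ge) auto

text \<open>\<open>Min\<close> and \<open>Max\<close> are meaningful over finite nonempty sets only;
  here \<open>E\<close> is a transversal, and below \<open>{}\<close> is a packing.\<close>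

lemma tau_attained:
  obtains F where "triangle_transversal V E F" "card F = tau V E"
proof -
  have "triangle_transversal V E E" by (auto simp: triangle_transversal_def triangles_def)
  then have "tau V E \<in> card ` {F. triangle_transversal V E F}"
    unfolding tau_def using finite_transversals by (intro Min_in) auto
  then show thesis using that by auto
qed

lemma nu_attained:
  obtains P where "triangle_packing V E P" "card P = nu V E"
proof -
  have "triangle_packing V E {}" by (simp add: triangle_packing_def)
  then have "nu V E \<in> card ` {P. triangle_packing V E P}"
    unfolding nu_def using finite_packings by (intro Max_in) auto
  then show thesis using that by auto
qed

end

text \<open>An optimal transversal and an optimal packing of the remaining graph are extended by
  \<open>X\<close> and \<open>Y\<close>. The new packing is edge-disjoint because \<open>Y\<close>
  uses deleted edges only.\<close>

lemma reduction_tau_nu: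
  assumes simple: "simple_graph V E" and red: "reduction E S X Y"
    and le: "tau V (E - (S \<union> X)) \<le> 2 * nu V (E - (S \<union> X))"
  shows "tau V E \<le> 2 * nu V E"
proof -
  let ?E = "E - (S \<union> X)"
  have simple': "simple_graph V ?E" using simple by (rule simple_graph_subset) blast
  have XE: "X \<subseteq> E" and SE: "S \<subseteq> E" and finY: "finite Y" and cardXY: "card X \<le> 2 * card Y"
    and Y: "\<And>t. t \<in> Y \<Longrightarrow> card t = 3 \<and> tri_edges t \<subseteq> S \<union> X"
    and Ydisj: "\<And>s t. s \<in> Y \<Longrightarrow> t \<in> Y \<Longrightarrow> s \<noteq> t \<Longrightarrow> tri_edges s \<inter> tri_edges t = {}"
    and hit: "\<And>t. card t = 3 \<Longrightarrow> tri_edges t \<subseteq> E \<Longrightarrow> tri_edges t \<inter> S \<noteq> {} \<Longrightarrow> tri_edges t \<inter> X \<noteq> {}"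
    using red unfolding reduction_def by auto
  obtain F where F: "triangle_transversal V ?E F" "card F = tau V ?E"
    using tau_attained[OF simple'] .
  obtain P where P: "triangle_packing V ?E P" "card P = nu V ?E"
    using nu_attained[OF simple'] .
  have "triangle_transversal V E (F \<union> X)"
  proof -
    have "F \<subseteq> ?E" "triangles V (?E - F) = {}" using F by (auto simp: triangle_transversal_def)
    have "t \<notin> triangles V (E - (F \<union> X))" for t
    proof
      assume "t \<in> triangles V (E - (F \<union> X))"
      then have t: "card t = 3" "tri_edges t \<subseteq> E - (F \<union> X)"
        using triangles_eq[OF simple_graph_subset[OF simple]] by auto
      \<comment> \<open>A triangle that avoids \<open>X\<close> cannot meet \<open>S\<close>; it
        survives the deletion, where \<open>F\<close> would have hit it.\<close>
      then have "tri_edges t \<inter> S = {}" using hit[of t] by blast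
      then have "tri_edges t \<subseteq> ?E - F" using t by blast
      then have "t \<in> triangles V (?E - F)"
        using t triangles_eq[OF simple_graph_subset[OF simple], of "?E - F"] by auto
      then show False using \<open>triangles V (?E - F) = {}\<close> by blast
    qed
    then show ?thesis using \<open>F \<subseteq> ?E\<close> XE unfolding triangle_transversal_def by blast
  qed
  then have "tau V E \<le> card (F \<union> X)" by (rule tau_le[OF simple])
  also have "\<dots> \<le> card F + card X" by (rule card_Un_le)
  finally have tau: "tau V E \<le> 2 * nu V ?E + 2 * card Y" using F le cardXY by simp
  have Pt: "card t = 3 \<and> tri_edges t \<subseteq> ?E" if "t \<in> P" for t
    using that P triangles_eq[OF simple'] by (auto simp: triangle_packing_def)
  have cross: "tri_edges s \<inter> tri_edges t = {}" if "s \<in> P" "t \<in> Y" for s t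
    using Pt[OF that(1)] Y[OF that(2)] by blast
  have "triangle_packing V E (P \<union> Y)"
    unfolding triangle_packing_def triangles_eq[OF simple]
  proof (intro conjI ballI impI)
    show "P \<union> Y \<subseteq> {t. card t = 3 \<and> tri_edges t \<subseteq> E}" using Pt Y XE SE by blast
    fix s t assume "s \<in> P \<union> Y" "t \<in> P \<union> Y" "s \<noteq> t"
    moreover have "tri_edges s \<inter> tri_edges t = {}" if "s \<in> P" "t \<in> P" "s \<noteq> t" for s t
      using that P by (simp add: triangle_packing_def)
    ultimately show "tri_edges s \<inter> tri_edges t = {}" using cross Ydisj by blast
  qed
  then have "card (P \<union> Y) \<le> nu V E" by (rule le_nu[OF simple])
  \<comment> \<open>A common triangle would have all its edges both inside and outside
    \<open>S \<union> X\<close>, yet it has at least one edge.\<close>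
  moreover have "P \<inter> Y = {}" using cross Pt tri_edges_nonempty by blast
  moreover have "finite P"
  proof (rule finite_subset)
    show "P \<subseteq> Pow V" using P by (auto simp: triangle_packing_def triangles_def)
    show "finite (Pow V)" using simple by (simp add: simple_graph_def)
  qed
  ultimately have "nu V ?E + card Y \<le> nu V E" using P finY by (simp add: card_Un_disjoint)
  then show ?thesis using tau by simp
qed

section \<open>Refutations of graph fragments\<close>

text \<open>A graph fragment is described by labelling its vertices with numbers. In a frame, a \<^emph>\<open>closed\<close>
label has all its neighbours among the labelled vertices, a \<^emph>\<open>small\<close> one has degree at most 6, and the
labels from \<open>base\<close> on are sorted by which of the key vertices they are adjacent to. The pairs in
\<open>excl\<close> are not all absent, and \<open>linked\<close> permits the use of what is known about the links of
vertices of degree at most 6.\<close>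

datatype frame = Frame (labels: nat) (closed: "nat list") (small: "nat list")
  (keys: "nat list") (base: nat) (excl: "(nat \<times> nat) list") (linked: bool)

text \<open>A decision tree over the pairs of labels. \<open>Split i j\<close> continues with the pair absent in the first
and present in the second subtree. \<open>Cert U Y X\<close> deletes all edges at the vertices \<open>U\<close>, packs the
triangles \<open>Y\<close>, and covers with \<open>X\<close> and the edges of \<open>Y\<close> that avoid \<open>U\<close>; \<open>Bare\<close> deletes an edge that
lies in no triangle. The other leaves point out a contradiction to the frame.\<close>

datatype refutation =
    is_Split: Split nat nat refutation refutation
  | Cert "nat list" "(nat \<times> nat \<times> nat) list" "(nat \<times> nat) list"
  | Bare nat nat
  | Low nat nat
  | Full nat
  | Fork nat nat nat nat
  | Unsorted nat nat
  | Excl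

section \<open>Checking a decision tree\<close>

definition mem :: "(nat \<times> nat) list \<Rightarrow> nat \<Rightarrow> nat \<Rightarrow> bool" where
  "mem xs i j \<longleftrightarrow> (if i < j then (i, j) \<in> set xs else (j, i) \<in> set xs)"

text \<open>Counting over the labels instead of over the list keeps a repeated pair from counting
  twice.\<close>

definition degree_in :: "nat \<Rightarrow> (nat \<times> nat) list \<Rightarrow> nat \<Rightarrow> nat" where
  "degree_in n xs i = length (filter (\<lambda>j. j \<noteq> i \<and> mem xs i j) [0..<n])"

definition tri_pairs :: "nat \<times> nat \<times> nat \<Rightarrow> (nat \<times> nat) list" where
  "tri_pairs = (\<lambda>(a, b, c). [(a, b), (a, c), (b, c)])"

text \<open>The edges of the packed triangles have to lie in \<open>S \<union> X\<close>. Those with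
  an end in \<open>U\<close> are in \<open>S\<close> already; the others join the cover and count
  against its size.\<close>

definition cover_pairs ::
  "nat list \<Rightarrow> (nat \<times> nat \<times> nat) list \<Rightarrow> (nat \<times> nat) list \<Rightarrow> (nat \<times> nat) list" where
  "cover_pairs U Y X = X @ filter (\<lambda>(i, j). i \<notin> set U \<and> j \<notin> set U) (concat (map tri_pairs Y))"

text \<open>A triangle at \<open>u\<close> that the cover misses has its other two corners in
  \<open>ns\<close>, the labels that may still be neighbours of \<open>u\<close> along uncovered
  edges. So it is enough that every pair in \<open>ns\<close> is absent or covered.\<close>

definition covers :: "nat \<Rightarrow> (nat \<times> nat) list \<Rightarrow> (nat \<times> nat) list \<Rightarrow> nat \<Rightarrow> bool" where
  "covers n Q X u \<longleftrightarrow>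
     (let ns = filter (\<lambda>j. j \<noteq> u \<and> \<not> mem Q u j \<and> \<not> mem X u j) [0..<n]
      in list_all (\<lambda>j. list_all (\<lambda>k. j < k \<longrightarrow> mem Q j k \<or> mem X j k) ns) ns)"

text \<open>\<open>P\<close> collects the pairs known to be present, \<open>Q\<close> those known to
  be absent. A closed label with \<open>q\<close> absent pairs has at most
  \<open>labels F - 1 - q\<close> neighbours, so the summand 5 in \<open>Low\<close> expresses
  degree at most 4, and the summand 7 in \<open>Fork\<close> degree at most 6. Ordering the triples
  in \<open>Cert\<close> makes their pairs match the stored form, smaller label first.
  \<open>Excl\<close> insists on a nonempty list because an empty one imposes no condition on the
  graph.\<close>

fun refutes :: "frame \<Rightarrow> (nat \<times> nat) list \<Rightarrow> (nat \<times> nat) list \<Rightarrow> refutation \<Rightarrow> bool" where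
  "refutes F P Q (Split i j t u) \<longleftrightarrow> refutes F P ((i, j) # Q) t \<and> refutes F ((i, j) # P) Q u"
| "refutes F P Q (Cert U Y X) \<longleftrightarrow>
     list_all (\<lambda>u. u \<in> set (closed F)) U \<and> Y \<noteq> [] \<and>
     list_all (\<lambda>(a, b, c). a < b \<and> b < c) Y \<and>
     list_all (\<lambda>e. e \<in> set P) (concat (map tri_pairs Y)) \<and>
     distinct (concat (map tri_pairs Y)) \<and>
     length (cover_pairs U Y X) \<le> 2 * length Y \<and>
     list_all (covers (labels F) Q (cover_pairs U Y X)) U"
| "refutes F P Q (Bare i j) \<longleftrightarrow> i \<in> set (closed F) \<and> i \<noteq> j \<and> mem P i j \<and>
     list_all (\<lambda>k. k = i \<or> k = j \<or> mem Q i k \<or> mem Q j k) [0..<labels F]"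
| "refutes F P Q (Low i j) \<longleftrightarrow> linked F \<and> i \<in> set (closed F) \<and> mem P i j \<and>
     labels F \<le> degree_in (labels F) Q i + 5"
| "refutes F P Q (Full i) \<longleftrightarrow> i \<in> set (small F) \<and> 7 \<le> degree_in (labels F) P i"
| "refutes F P Q (Fork i a b c) \<longleftrightarrow> linked F \<and>
     (i \<in> set (small F) \<or> i \<in> set (closed F) \<and> labels F \<le> degree_in (labels F) Q i + 7) \<and>
     a \<noteq> b \<and> a \<noteq> c \<and> b \<noteq> c \<and> mem P i a \<and> mem P i b \<and> mem P i c \<and> mem Q a b \<and> mem Q a c"
| "refutes F P Q (Unsorted k i) \<longleftrightarrow> k < length (keys F) \<and> base F \<le> i \<and> Suc i < labels F \<and>
     mem Q (keys F ! k) i \<and> mem P (keys F ! k) (Suc i) \<and>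
     list_all (\<lambda>d. mem P d i \<and> mem P d (Suc i) \<or> mem Q d i \<and> mem Q d (Suc i)) (take k (keys F))"
| "refutes F P Q Excl \<longleftrightarrow> excl F \<noteq> [] \<and> list_all (\<lambda>e. e \<in> set Q) (excl F)"

text \<open>The non-edges of the link form a matching exactly if no vertex of the link misses two
  others.\<close>

definition link_matched :: "'a set set \<Rightarrow> 'a \<Rightarrow> bool" where
  "link_matched E v \<longleftrightarrow> (\<forall>a\<in>nbrs E v. \<forall>b\<in>nbrs E v. \<forall>c\<in>nbrs E v.
     a \<noteq> b \<and> a \<noteq> c \<and> b \<noteq> c \<and> {a, b} \<notin> E \<longrightarrow> {a, c} \<in> E)"

section \<open>Irreducible graphs and the soundness of the checker\<close>

locale irreducible_graph =
  fixes V :: "'a set" and E :: "'a set set"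
  assumes simple: "simple_graph V E"
    and irreducible: "\<not> reduction E S X Y"
begin

lemma edge_card: "e \<in> E \<Longrightarrow> card e = 2"
  using simple by (auto simp: simple_graph_def)

lemma no_loop: "{v} \<notin> E"
  using edge_card[of "{v}"] by auto

lemma nbrs_subset: "nbrs E v \<subseteq> V"
  using simple by (auto simp: simple_graph_def nbrs_def)

lemma finite_nbrs: "finite (nbrs E v)"
  using nbrs_subset simple by (auto simp: simple_graph_def intro: finite_subset)

lemma nbrs_irrefl: "v \<notin> nbrs E v"
  using no_loop by (simp add: nbrs_def)

lemma nbrs_sym: "u \<in> nbrs E v \<longleftrightarrow> v \<in> nbrs E u"
  by (simp add: nbrs_def insert_commute)

text \<open>Labels beyond the end of the list stand for no vertex, so that one frame also covers smaller
fragments.\<close>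

definition adj :: "'a list \<Rightarrow> nat \<Rightarrow> nat \<Rightarrow> bool" where
  "adj vs i j \<longleftrightarrow> i < length vs \<and> j < length vs \<and> {vs ! i, vs ! j} \<in> E"

lemma adj_sym: "adj vs i j \<longleftrightarrow> adj vs j i"
  by (auto simp: adj_def insert_commute)

lemma adj_neq: "adj vs i j \<Longrightarrow> i \<noteq> j"
  using no_loop by (auto simp: adj_def)

text \<open>The sorting clause compares consecutive labels: if they agree on the earlier keys,
  adjacency to the next key can be lost but not gained. The adjacency vectors thus descend
  lexicographically, and labels that stand for no vertex, being adjacent to nothing, fit in at the
  end. The \<open>linked\<close> clause speaks of all vertices of the graph, not only of the
  labelled ones.\<close>

definition labelling :: "frame \<Rightarrow> 'a list \<Rightarrow> bool" where
  "labelling F vs \<longleftrightarrow> distinct vs \<and> length vs \<le> labels F \<and>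
     (\<forall>i\<in>set (closed F). i < length vs \<longrightarrow> nbrs E (vs ! i) \<subseteq> set vs) \<and>
     (\<forall>i\<in>set (small F). i < length vs \<longrightarrow> card (nbrs E (vs ! i)) \<le> 6) \<and>
     (\<forall>i k. base F \<le> i \<and> k < length (keys F) \<and>
        (\<forall>q<k. adj vs (keys F ! q) i \<longleftrightarrow> adj vs (keys F ! q) (Suc i)) \<and>
        adj vs (keys F ! k) (Suc i) \<longrightarrow> adj vs (keys F ! k) i) \<and>
     (excl F \<noteq> [] \<longrightarrow> (\<exists>(i, j)\<in>set (excl F). adj vs i j)) \<and>
     (linked F \<longrightarrow> (\<forall>v. nbrs E v \<noteq> {} \<longrightarrow> 5 \<le> card (nbrs E v)) \<and>
        (\<forall>v. card (nbrs E v) \<le> 6 \<longrightarrow> link_matched E v))"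

context
  fixes F vs P Q
  assumes lab: "labelling F vs"
    and present: "\<forall>(i, j)\<in>set P. adj vs i j"
    and absent: "\<forall>(i, j)\<in>set Q. \<not> adj vs i j"
begin

lemma dist: "distinct vs" and len: "length vs \<le> labels F"
  using lab by (auto simp: labelling_def)

lemma memP: "mem P i j \<Longrightarrow> adj vs i j"
  using present by (auto simp: mem_def adj_sym[of vs i j] split: if_splits)

lemma memQ: "mem Q i j \<Longrightarrow> \<not> adj vs i j"
  using absent by (auto simp: mem_def adj_sym[of vs i j] split: if_splits)

lemma closed_nbr:
  assumes "i \<in> set (closed F)" "i < length vs" "x \<in> nbrs E (vs ! i)"
  obtains j where "adj vs i j" "x = vs ! j"
proof -
  have "x \<in> set vs" using assms lab by (auto simp: labelling_def)
  then obtain j where "j < length vs" "x = vs ! j" by (metis in_set_conv_nth)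
  with assms that show thesis by (auto simp: adj_def nbrs_def)
qed

text \<open>All neighbours of a closed vertex carry labels that are not marked absent; the summand 1
  accounts for the label \<open>i\<close> itself.\<close>

lemma degree_le:
  assumes i: "i \<in> set (closed F)" "i < length vs"
  shows "card (nbrs E (vs ! i)) + degree_in (labels F) Q i + 1 \<le> labels F"
proof -
  let ?n = "labels F"
  let ?A = "{j. j < ?n \<and> j \<noteq> i \<and> \<not> mem Q i j}"
  let ?B = "{j. j < ?n \<and> j \<noteq> i \<and> mem Q i j}"
  have "nbrs E (vs ! i) \<subseteq> (!) vs ` ?A"
  proof
    fix x assume "x \<in> nbrs E (vs ! i)"
    then obtain j where j: "adj vs i j" "x = vs ! j" using closed_nbr i by metis
    then have "j < ?n" "j \<noteq> i" "\<not> mem Q i j"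
      using len memQ[of i j] adj_neq[OF j(1)] by (auto simp: adj_def)
    with j show "x \<in> (!) vs ` ?A" by auto
  qed
  then have "card (nbrs E (vs ! i)) \<le> card ?A"
    by (rule surj_card_le[rotated]) auto
  moreover have "degree_in ?n Q i = card ?B"
  proof -
    have "degree_in ?n Q i = card (set (filter (\<lambda>j. j \<noteq> i \<and> mem Q i j) [0..<?n]))"
      unfolding degree_in_def by (subst distinct_card) auto
    also have "set (filter (\<lambda>j. j \<noteq> i \<and> mem Q i j) [0..<?n]) = ?B" by auto
    finally show ?thesis .
  qed
  moreover have "card ?A + card ?B = card (?A \<union> ?B)"
    by (rule card_Un_disjoint[symmetric]) auto
  moreover have "?A \<union> ?B = {..<?n} - {i}" by auto
  moreover have "card ({..<?n} - {i}) = ?n - 1" using i len by simp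
  ultimately show ?thesis using i len by simp
qed

lemma degree_ge:
  assumes i: "i < length vs"
  shows "degree_in (labels F) P i \<le> card (nbrs E (vs ! i))"
proof -
  let ?l = "filter (\<lambda>j. j \<noteq> i \<and> mem P i j) [0..<labels F]"
  have l: "j < length vs" "vs ! j \<in> nbrs E (vs ! i)" if "j \<in> set ?l" for j
    using that memP by (auto simp: adj_def nbrs_def)
  have "degree_in (labels F) P i = card (set ?l)"
    unfolding degree_in_def by (subst distinct_card) auto
  also have "\<dots> = card ((!) vs ` set ?l)"
    by (rule card_image[symmetric]) (use l dist in \<open>auto simp: inj_on_def nth_eq_iff_index_eq\<close>)
  also have "\<dots> \<le> card (nbrs E (vs ! i))"
    by (rule card_mono[OF finite_nbrs]) (use l in blast)
  finally show ?thesis .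
qed

text \<open>The third corner of a triangle on this edge would be a neighbour of a closed vertex,
  hence labelled, and a common neighbour of both ends, which the check rules out. So deleting the
  edge is a reduction with nothing packed and nothing covered.\<close>

lemma refutes_Bare: "\<not> refutes F P Q (Bare i j)"
proof
  assume "refutes F P Q (Bare i j)"
  then have i: "i \<in> set (closed F)" and ij: "adj vs i j"
    and k: "\<And>k. k < labels F \<Longrightarrow> k = i \<or> k = j \<or> \<not> adj vs i k \<or> \<not> adj vs j k"
    using memP memQ by (auto simp: list_all_iff)
  let ?e = "{vs ! i, vs ! j}"
  have "reduction E {?e} {} {}"
  proof -
    have False if t: "card t = 3" "tri_edges t \<subseteq> E" "?e \<in> tri_edges t" for t
    proof -
      have e: "?e \<subseteq> t" "card ?e = 2" using t(3) by (auto simp: tri_edges_def)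
      have "card (t - ?e) = 1" using e t(1) by (simp add: card_Diff_subset)
      then obtain x where x: "t - ?e = {x}" by (metis card_1_singletonE)
      then have "x \<in> t" "x \<noteq> vs ! i" "x \<noteq> vs ! j" by blast+
      then have "{vs ! i, x} \<in> tri_edges t" "{vs ! j, x} \<in> tri_edges t"
        using e(1) by (simp_all add: tri_edges_def)
      then have xE: "{vs ! i, x} \<in> E" "{vs ! j, x} \<in> E" using t(2) by auto
      then obtain k' where k': "adj vs i k'" "x = vs ! k'"
        using closed_nbr[OF i, of x] ij by (auto simp: adj_def nbrs_def)
      then have "adj vs j k'" using xE ij by (auto simp: adj_def)
      moreover have "k' \<noteq> i" "k' \<noteq> j" using \<open>x \<noteq> vs ! i\<close> \<open>x \<noteq> vs ! j\<close> k'(2) by auto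
      moreover have "k' < labels F" using k'(1) len by (simp add: adj_def)
      ultimately show False using k[of k'] k'(1) by blast
    qed
    moreover have "?e \<in> E" using ij by (simp add: adj_def)
    ultimately show ?thesis unfolding reduction_def by fastforce
  qed
  then show False using irreducible by blast
qed

text \<open>The certificate is translated into a reduction: \<open>g\<close> and \<open>h\<close>
  turn label pairs and triples into edges and vertex sets, \<open>S\<close> consists of all edges at
  \<open>U\<close>, \<open>X'\<close> of the covering edges, and the packing is the image of
  \<open>Y\<close> under \<open>h\<close>.\<close>

lemma refutes_Cert: "\<not> refutes F P Q (Cert U Y X)"
proof
  assume "refutes F P Q (Cert U Y X)"
  define Z where "Z = cover_pairs U Y X"
  from \<open>refutes F P Q (Cert U Y X)\<close> have U: "set U \<subseteq> set (closed F)" and Y: "Y \<noteq> []"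
    and ord: "\<And>a b c. (a, b, c) \<in> set Y \<Longrightarrow> a < b \<and> b < c"
    and YP: "\<And>y e. y \<in> set Y \<Longrightarrow> e \<in> set (tri_pairs y) \<Longrightarrow> e \<in> set P"
    and dY: "distinct (concat (map tri_pairs Y))"
    and lenZ: "length Z \<le> 2 * length Y"
    and cov: "\<And>u. u \<in> set U \<Longrightarrow> covers (labels F) Q Z u"
    by (auto simp: list_all_iff Z_def)
  define g where "g = (\<lambda>(i, j). {vs ! i, vs ! j})"
  define h where "h = (\<lambda>(a, b, c). {vs ! a, vs ! b, vs ! c})"
  define S where "S = {e \<in> E. \<exists>u\<in>set U. u < length vs \<and> vs ! u \<in> e}"
  \<comment> \<open>A covering pair may be a non-edge or involve a label without a vertex. Keeping
    only the actual edges can only lower the size of the cover.\<close>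
  define X' where "X' = {g (i, j) | i j. (i, j) \<in> set Z \<and> adj vs i j}"
  have pres: "adj vs i j" "i < j" if "y \<in> set Y" "(i, j) \<in> set (tri_pairs y)" for y i j
    using that YP[OF that] present ord[of "fst y" "fst (snd y)" "snd (snd y)"]
    by (cases y; auto simp: tri_pairs_def)+
  have tri: "card (h y) = 3 \<and> tri_edges (h y) = g ` set (tri_pairs y)" if "y \<in> set Y" for y
  proof -
    obtain a b c where y: "y = (a, b, c)" by (cases y)
    have "a < b" "b < c" using ord that y by auto
    moreover have "c < length vs" using pres[OF that, of b c] y by (auto simp: tri_pairs_def adj_def)
    ultimately have "vs ! a \<noteq> vs ! b" "vs ! a \<noteq> vs ! c" "vs ! b \<noteq> vs ! c"
      using dist by (auto simp: nth_eq_iff_index_eq)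
    then show ?thesis by (simp add: y h_def g_def tri_pairs_def tri_edges_triple)
  qed
  have tri_ne: "tri_pairs y \<noteq> []" for y by (cases y) (simp add: tri_pairs_def)
  have inj_tp: "inj tri_pairs" by (auto simp: inj_on_def tri_pairs_def)
  \<comment> \<open>On ordered present pairs an edge determines its labels, so the disjointness
    checked for lists of pairs carries over to the triangles in the graph.\<close>
  have g_inj: "(i, j) = (k, l)"
    if "g (i, j) = g (k, l)" "adj vs i j" "i < j" "adj vs k l" "k < l" for i j k l
    using that dist by (auto simp: g_def adj_def doubleton_eq_iff nth_eq_iff_index_eq)
  have disj: "tri_edges (h y) \<inter> tri_edges (h z) = {}" if yz: "y \<in> set Y" "z \<in> set Y" "y \<noteq> z" for y z
  proof -
    have "tri_pairs y \<noteq> tri_pairs z" using inj_tp yz by (auto dest: injD)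
    then have *: "set (tri_pairs y) \<inter> set (tri_pairs z) = {}"
      using dY imageI[OF yz(1), of tri_pairs] imageI[OF yz(2), of tri_pairs]
      unfolding distinct_concat_iff set_map by blast
    show ?thesis
    proof (rule ccontr)
      assume "tri_edges (h y) \<inter> tri_edges (h z) \<noteq> {}"
      then obtain e where "e \<in> g ` set (tri_pairs y)" "e \<in> g ` set (tri_pairs z)"
        using tri[OF yz(1)] tri[OF yz(2)] by (metis Int_emptyI)
      then obtain i j k l where e: "g (i, j) = g (k, l)"
        and ij: "(i, j) \<in> set (tri_pairs y)" and kl: "(k, l) \<in> set (tri_pairs z)" by auto
      have "(i, j) = (k, l)"
        using g_inj[OF e] pres[OF yz(1) ij] pres[OF yz(2) kl] by blast
      then show False using * ij kl by blast
    qed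
  qed
  have h_inj: "inj_on h (set Y)"
  proof (rule inj_onI, rule ccontr)
    fix y z assume "y \<in> set Y" "z \<in> set Y" "h y = h z" "y \<noteq> z"
    then have "tri_edges (h y) = {}" using disj[of y z] by simp
    then show False using tri[OF \<open>y \<in> set Y\<close>] tri_ne by auto
  qed
  have "distinct (map tri_pairs Y)"
  proof -
    \<comment> \<open>\<open>distinct_concat_iff\<close> yields distinctness only after empty
      members are removed; no triple produces one.\<close>
    have "[] \<notin> set (map tri_pairs Y)" by (auto simp: tri_pairs_def)
    then have "removeAll [] (map tri_pairs Y) = map tri_pairs Y" by (rule removeAll_id)
    then show ?thesis using dY by (simp add: distinct_concat_iff)
  qed
  then have "distinct Y" by (simp add: distinct_map)
  then have cardY: "card (h ` set Y) = length Y" using h_inj by (simp add: card_image distinct_card)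
  have "X' \<subseteq> g ` set Z" by (auto simp: X'_def)
  then have "card X' \<le> card (set Z)" by (rule surj_card_le[rotated]) simp
  also have "\<dots> \<le> length Z" by (rule card_length)
  finally have cardX: "card X' \<le> 2 * card (h ` set Y)" using lenZ cardY by simp
  have edges: "tri_edges (h y) \<subseteq> S \<union> X'" if y: "y \<in> set Y" for y
  proof
    fix e assume "e \<in> tri_edges (h y)"
    then obtain i j where e: "e = g (i, j)" "(i, j) \<in> set (tri_pairs y)" using tri y by auto
    have a: "adj vs i j" using pres y e by blast
    show "e \<in> S \<union> X'"
    proof (cases "i \<in> set U \<or> j \<in> set U")
      case True
      then show ?thesis using a e by (auto simp: S_def g_def adj_def)
    next
      case False
      then have "(i, j) \<in> set Z" using y e by (auto simp: Z_def cover_pairs_def)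
      then show ?thesis using a e by (auto simp: X'_def)
    qed
  qed
  have memZ: "{vs ! i, vs ! j} \<in> X'" if "mem Z i j" "adj vs i j" for i j
  proof (cases "i < j")
    case True
    then show ?thesis using that by (auto simp: mem_def X'_def g_def)
  next
    case False
    then have "(j, i) \<in> set Z" "adj vs j i" using that adj_sym by (auto simp: mem_def)
    then show ?thesis unfolding X'_def g_def by (auto simp: insert_commute)
  qed
  have hit: "tri_edges t \<inter> X' \<noteq> {}"
    if t: "card t = 3" "tri_edges t \<subseteq> E" "tri_edges t \<inter> S \<noteq> {}" for t
  proof -
    \<comment> \<open>A triangle meeting \<open>S\<close> has a corner in \<open>U\<close>. That
      corner is closed, so the other two are labelled as well and \<open>covers\<close> applies to
      them.\<close>
    obtain e u where e: "e \<in> tri_edges t" and u: "u \<in> set U" "u < length vs" "vs ! u \<in> e"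
      using t(3) by (auto simp: S_def)
    then have ut: "vs ! u \<in> t" by (auto simp: tri_edges_def)
    then have "card (t - {vs ! u}) = 2" using t(1) by (simp add: card_Diff_singleton)
    then obtain x y where xy: "t - {vs ! u} = {x, y}" "x \<noteq> y" by (meson card_2_iff)
    then have neq: "x \<noteq> vs ! u" "y \<noteq> vs ! u" and t_eq: "t = {vs ! u, x, y}" using ut by auto
    then have T: "tri_edges t = {{vs ! u, x}, {vs ! u, y}, {x, y}}"
      using tri_edges_triple[of "vs ! u" x y] xy by auto
    have uc: "u \<in> set (closed F)" using u U by auto
    obtain j where j: "adj vs u j" "x = vs ! j"
      using closed_nbr[OF uc u(2), of x] T t(2) by (auto simp: nbrs_def)
    obtain k where k: "adj vs u k" "y = vs ! k"
      using closed_nbr[OF uc u(2), of y] T t(2) by (auto simp: nbrs_def)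
    have jk: "adj vs j k" using j k T t(2) by (auto simp: adj_def)
    have "mem Z u j \<or> mem Z u k \<or> mem Z j k"
    proof (rule ccontr)
      assume *: "\<not> (mem Z u j \<or> mem Z u k \<or> mem Z j k)"
      define ns where "ns = filter (\<lambda>j. j \<noteq> u \<and> \<not> mem Q u j \<and> \<not> mem Z u j) [0..<labels F]"
      have "j \<in> set ns" "k \<in> set ns"
        using * memQ[of u j] memQ[of u k] j(1) k(1) adj_neq[OF j(1)] adj_neq[OF k(1)] len
        by (auto simp: ns_def adj_def)
      moreover have "\<forall>j\<in>set ns. \<forall>k\<in>set ns. j < k \<longrightarrow> mem Q j k \<or> mem Z j k"
        using cov[OF u(1)] by (auto simp: covers_def Let_def list_all_iff ns_def)
      moreover have "j < k \<or> k < j" using adj_neq[OF jk] by auto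
      moreover have "mem Z k j = mem Z j k" using adj_neq[OF jk] by (auto simp: mem_def)
      ultimately show False using * memQ jk adj_sym by metis
    qed
    then show ?thesis using memZ j k jk T by auto
  qed
  have "S \<union> X' \<noteq> {}"
  proof -
    obtain y where y: "y \<in> set Y" using Y by (cases Y) auto
    then have "tri_edges (h y) \<noteq> {}" using tri tri_ne by auto
    then show ?thesis using edges[OF y] by auto
  qed
  moreover have "S \<subseteq> E" "X' \<subseteq> E" by (auto simp: S_def X'_def adj_def g_def)
  moreover have "\<forall>s\<in>h ` set Y. \<forall>t\<in>h ` set Y. s \<noteq> t \<longrightarrow> tri_edges s \<inter> tri_edges t = {}"
  proof (intro ballI impI)
    fix s t assume "s \<in> h ` set Y" "t \<in> h ` set Y" "s \<noteq> t"
    then obtain y z where "y \<in> set Y" "z \<in> set Y" "s = h y" "t = h z" "y \<noteq> z" by blast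
    then show "tri_edges s \<inter> tri_edges t = {}" using disj by simp
  qed
  moreover have "\<forall>t\<in>h ` set Y. card t = 3 \<and> tri_edges t \<subseteq> S \<union> X'" using tri edges by simp
  ultimately have "reduction E S X' (h ` set Y)"
    unfolding reduction_def using cardX hit by simp
  then show False using irreducible by blast
qed

text \<open>No leaf can refute a fragment that really occurs. Concluding \<open>is_Split\<close>
  treats all kinds of leaves at once, so that the leaf cases of the induction on trees close
  uniformly.\<close>

lemma refutes_local:
  assumes "refutes F P Q t"
  shows "is_Split t"
proof (cases t)
  case (Low i j)
  then have i: "i \<in> set (closed F)" "adj vs i j" "linked F" "labels F \<le> degree_in (labels F) Q i + 5"
    using assms memP by auto
  then have "vs ! j \<in> nbrs E (vs ! i)" "i < length vs" by (auto simp: adj_def nbrs_def)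
  then have "5 \<le> card (nbrs E (vs ! i))" using i lab by (auto simp: labelling_def)
  \<comment> \<open>The check leaves at most 4 possible neighbours, while \<open>linked\<close>
    guarantees 5.\<close>
  then show ?thesis using degree_le[of i] i \<open>i < length vs\<close> by auto
next
  case (Full i)
  then have i: "i \<in> set (small F)" "7 \<le> degree_in (labels F) P i" using assms by auto
  \<comment> \<open>A label without a vertex belongs to no present pair, but seven are
    counted.\<close>
  have "i < length vs"
  proof (rule ccontr)
    assume "\<not> i < length vs"
    then have "\<not> mem P i j" for j using memP[of i j] by (auto simp: adj_def)
    then show False using i by (simp add: degree_in_def)
  qed
  then show ?thesis using degree_ge[of i] i lab by (fastforce simp: labelling_def)
next
  case (Fork i a b c)
  then have r: "linked F" "i \<in> set (small F) \<or> i \<in> set (closed F) \<and> labels F \<le> degree_in (labels F) Q i + 7"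
    "a \<noteq> b" "a \<noteq> c" "b \<noteq> c" "adj vs i a" "adj vs i b" "adj vs i c" "\<not> adj vs a b" "\<not> adj vs a c"
    using assms memP memQ by auto
  have "i < length vs" using r by (simp add: adj_def)
  then have "card (nbrs E (vs ! i)) \<le> 6"
    using r(2) degree_le[of i] lab by (fastforce simp: labelling_def)
  then have "link_matched E (vs ! i)" using lab r(1) by (simp add: labelling_def)
  moreover have "vs ! a \<noteq> vs ! b" "vs ! a \<noteq> vs ! c" "vs ! b \<noteq> vs ! c"
    using r dist by (auto simp: adj_def nth_eq_iff_index_eq)
  ultimately show ?thesis
    using r(6-10) unfolding link_matched_def nbrs_def adj_def by blast
next
  case (Unsorted k i)
  let ?d = "keys F ! k"
  from Unsorted have r: "k < length (keys F)" "base F \<le> i" "\<not> adj vs ?d i" "adj vs ?d (Suc i)"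
    and *: "\<forall>d\<in>set (take k (keys F)). mem P d i \<and> mem P d (Suc i) \<or> mem Q d i \<and> mem Q d (Suc i)"
    using assms memP memQ by (auto simp: list_all_iff)
  have "adj vs (keys F ! q) i \<longleftrightarrow> adj vs (keys F ! q) (Suc i)" if "q < k" for q
  proof -
    have "keys F ! q \<in> set (take k (keys F))" using that r(1) by (auto simp: in_set_conv_nth)
    then show ?thesis using * memP memQ by metis
  qed
  then show ?thesis using r lab unfolding labelling_def by blast
next
  case Excl
  then show ?thesis using assms lab absent by (fastforce simp: labelling_def list_all_iff)
next
  case (Cert U Y X)
  then show ?thesis using assms refutes_Cert[of U Y X] by metis
next
  case (Bare i j)
  then show ?thesis using assms refutes_Bare[of i j] by metis
qed simp

end

text \<open>The graph itself decides each \<open>Split\<close>. Following its answers keeps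
  \<open>P\<close> and \<open>Q\<close> truthful down to a leaf, where \<open>refutes_local\<close>
  gives the contradiction.\<close>

theorem refutes_sound:
  assumes "labelling F vs" and "refutes F P Q t"
    and "\<forall>(i, j)\<in>set P. adj vs i j" "\<forall>(i, j)\<in>set Q. \<not> adj vs i j"
  shows False
  using assms(2-4)
proof (induction t arbitrary: P Q)
  case (Split i j t u)
  show ?case
  proof (cases "adj vs i j")
    case True
    then show False using Split.IH(2)[of "(i, j) # P" Q] Split.prems by auto
  next
    case False
    then show False using Split.IH(1)[of P "(i, j) # Q"] Split.prems by auto
  qed
qed (drule refutes_local[OF assms(1), rotated 2], assumption, assumption, simp)+

end

section \<open>Pendants at a bag\<close>

text \<open>The decision trees below were found by computer search.\<close>

definition degree_refutation :: refutation where
  "degree_refutation =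
Split 0 2 (Split 0 3 (Split 0 4 (Bare 0 1) (Split 1 4 (Bare 0 1) (Cert [0] [(0,1,4)] []))) (Split
1 3 (Split 0 4 (Bare 0 1) (Split 1 4 (Bare 0 1) (Cert [0] [(0,1,4)] [(0,3)]))) (Cert [0] [(0,1,3)]
[(0,4)]))) (Split 0 3 (Split 1 2 (Split 0 4 (Bare 0 1) (Split 2 4 (Bare 0 2) (Cert [0] [(0,2,4)]
[(0,1)]))) (Cert [0] [(0,1,2)] [(0,4)])) (Split 0 4 (Split 2 3 (Split 1 2 (Bare 0 2) (Cert [0]
[(0,1,2)] [(0,1)])) (Cert [0] [(0,2,3)] [(0,1)])) (Split 1 3 (Split 1 2 (Split 2 3 (Split 2 4
(Bare 0 2) (Cert [0] [(0,2,4)] [(0,4)])) (Cert [0] [(0,2,3)] [(0,4)])) (Split 3 4 (Split 1 4 (Cert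
[0] [(0,1,2)] [(0,2)]) (Cert [0] [(0,1,4)] [(0,2)])) (Cert [0] [(0,3,4),(0,1,2)] [(0,1),(0,2)])))
(Split 2 4 (Split 1 4 (Split 1 2 (Cert [0] [(0,1,3)] [(0,3)]) (Cert [0] [(0,1,2)] [(0,3)])) (Split
2 3 (Split 3 4 (Cert [0] [(0,1,4)] [(0,1)]) (Cert [0] [(0,3,4)] [(0,1)])) (Cert [0]
[(0,2,3),(0,1,4)] [(0,1),(0,3)]))) (Cert [0] [(0,1,3),(0,2,4)] [(0,1),(0,3)])))))"

text \<open>Label 0 is a vertex of degree between 1 and 4, and labels 1 to 4 are for its neighbours.
  \<open>linked\<close> is off, because this tree is what establishes the minimum degree 5; all its
  leaves are reductions.\<close>

lemma degree_refutes:
  "refutes (Frame 5 [0] [] [] 5 [] False)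
     [(0,1)]
     [] degree_refutation"
  by code_simp

definition fork_refutation :: refutation where
  "fork_refutation =
Split 0 4 (Split 0 6 (Split 2 3 (Split 0 5 (Bare 0 1) (Split 1 5 (Bare 0 1) (Cert [0] [(0,1,5)]
[(0,5)]))) (Cert [0] [(0,2,3)] [(0,5)])) (Split 1 6 (Split 0 5 (Bare 0 1) (Split 1 5 (Bare 0 1)
(Split 2 3 (Split 2 6 (Split 3 6 (Cert [0] [(0,1,5)] [(0,5)]) (Cert [0] [(0,3,6)] [(0,5)])) (Cert
[0] [(0,1,5),(0,2,6)] [(0,3),(0,5)])) (Cert [0] [(0,2,3),(0,1,5)] [(0,5),(0,6)])))) (Split 2 3
(Split 0 5 (Cert [0] [(0,1,6)] [(0,6)]) (Split 3 5 (Split 2 5 (Split 1 5 (Cert [0] [(0,1,6)]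
[(0,6)]) (Cert [0] [(0,1,5)] [(0,6)])) (Cert [0] [(0,1,6),(0,2,5)] [(0,1),(0,6)])) (Cert [0]
[(0,3,5),(0,1,6)] [(0,5),(0,6)]))) (Cert [0] [(0,2,3),(0,1,6)] [(0,5),(0,6)])))) (Split 0 5 (Split
1 4 (Split 0 6 (Bare 0 1) (Split 1 6 (Bare 0 1) (Split 2 4 (Split 3 4 (Split 2 3 (Cert [0]
[(0,1,6)] [(0,6)]) (Cert [0] [(0,1,6),(0,2,3)] [(0,2),(0,6)])) (Cert [0] [(0,3,4),(0,1,6)]
[(0,2),(0,6)])) (Cert [0] [(0,1,6),(0,2,4)] [(0,3),(0,6)])))) (Split 2 3 (Split 0 6 (Cert [0]
[(0,1,4)] [(0,4)]) (Split 2 6 (Split 3 6 (Split 1 6 (Cert [0] [(0,1,4)] [(0,4)]) (Cert [0]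
[(0,1,6)] [(0,4)])) (Cert [0] [(0,1,4),(0,3,6)] [(0,1),(0,4)])) (Cert [0] [(0,2,6),(0,1,4)]
[(0,4),(0,6)]))) (Cert [0] [(0,2,3),(0,1,4)] [(0,4),(0,6)]))) (Split 0 6 (Split 1 4 (Split 2 4
(Split 1 5 (Bare 0 1) (Split 2 3 (Split 3 4 (Cert [0] [(0,1,5)] [(0,5)]) (Cert [0]
[(0,1,5),(0,3,4)] [(0,2),(0,5)])) (Cert [0] [(0,1,5),(0,2,3)] [(0,3),(0,5)]))) (Split 1 5 (Bare 0
1) (Cert [0] [(0,2,4),(0,1,5)] [(0,3),(0,5)]))) (Split 2 3 (Split 2 5 (Split 3 5 (Split 1 5 (Cert
[0] [(0,1,4)] [(0,4)]) (Cert [0] [(0,1,5)] [(0,4)])) (Cert [0] [(0,3,5),(0,1,4)] [(0,1),(0,4)]))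
(Cert [0] [(0,1,4),(0,2,5)] [(0,4),(0,5)])) (Cert [0] [(0,1,4),(0,2,3)] [(0,4),(0,5)]))) (Split 1
5 (Split 1 6 (Split 1 4 (Bare 0 1) (Split 2 3 (Split 2 6 (Split 3 6 (Split 5 6 (Split 3 5 (Split 2
5 (Cert [0] [(0,1,4)] [(0,4)]) (Cert [0] [(0,1,4),(0,2,5)] [(0,2),(0,4)])) (Cert [0]
[(0,1,4),(0,3,5)] [(0,2),(0,4)])) (Cert [0] [(0,5,6),(0,1,4)] [(0,4),(0,5)])) (Cert [0]
[(0,1,4),(0,3,6)] [(0,4),(0,5)])) (Split 3 5 (Split 2 5 (Cert [0] [(0,2,6),(0,1,4)] [(0,4),(0,6)])
(Cert [0] [(0,1,4),(0,2,5)] [(0,4),(0,6)])) (Cert [0] [(0,2,6),(0,3,5),(0,1,4)]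
[(0,2),(0,4),(0,6)]))) (Split 5 6 (Split 2 6 (Split 2 5 (Cert [0] [(0,1,4),(0,2,3)] [(0,3),(0,4)])
(Cert [0] [(0,2,5),(0,1,4)] [(0,3),(0,4)])) (Split 3 5 (Split 3 6 (Cert [0] [(0,1,4),(0,2,6)]
[(0,2),(0,4)]) (Cert [0] [(0,3,6),(0,1,4)] [(0,2),(0,4)])) (Cert [0] [(0,3,5),(0,1,4),(0,2,6)]
[(0,2),(0,3),(0,4)]))) (Cert [0] [(0,2,3),(0,5,6),(0,1,4)] [(0,2),(0,3),(0,4)])))) (Split 2 4
(Split 2 3 (Split 2 5 (Split 3 5 (Split 3 4 (Split 4 5 (Split 1 4 (Cert [0] [(0,1,6)] [(0,6)])
(Cert [0] [(0,1,4)] [(0,6)])) (Cert [0] [(0,1,6),(0,4,5)] [(0,1),(0,6)])) (Cert [0]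
[(0,3,4),(0,1,6)] [(0,4),(0,6)])) (Cert [0] [(0,1,6),(0,3,5)] [(0,4),(0,6)])) (Split 3 4 (Split 1
4 (Cert [0] [(0,1,6),(0,2,5)] [(0,5),(0,6)]) (Cert [0] [(0,2,5),(0,1,4)] [(0,5),(0,6)])) (Cert [0]
[(0,3,4),(0,1,6),(0,2,5)] [(0,1),(0,5),(0,6)]))) (Split 4 5 (Split 2 5 (Split 1 4 (Cert [0]
[(0,1,6),(0,2,3)] [(0,3),(0,6)]) (Cert [0] [(0,2,3),(0,1,4)] [(0,3),(0,6)])) (Split 3 4 (Split 1 4
(Cert [0] [(0,2,5),(0,1,6)] [(0,3),(0,6)]) (Cert [0] [(0,1,4),(0,2,5)] [(0,3),(0,6)])) (Cert [0]
[(0,3,4),(0,2,5),(0,1,6)] [(0,1),(0,3),(0,6)]))) (Cert [0] [(0,2,3),(0,1,6),(0,4,5)]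
[(0,4),(0,5),(0,6)]))) (Split 3 5 (Split 2 5 (Split 2 3 (Cert [0] [(0,1,6),(0,2,4)] [(0,4),(0,6)])
(Cert [0] [(0,1,6),(0,2,3)] [(0,4),(0,6)])) (Split 3 4 (Split 2 3 (Cert [0] [(0,1,6),(0,2,5)]
[(0,4),(0,6)]) (Split 4 5 (Split 1 4 (Cert [0] [(0,2,5),(0,1,6)] [(0,2),(0,6)]) (Cert [0]
[(0,2,3),(0,1,4)] [(0,2),(0,6)])) (Cert [0] [(0,1,6),(0,4,5),(0,2,3)] [(0,1),(0,2),(0,6)]))) (Cert
[0] [(0,1,6),(0,2,5),(0,3,4)] [(0,2),(0,4),(0,6)]))) (Cert [0] [(0,2,4),(0,3,5),(0,1,6)]
[(0,2),(0,4),(0,6)])))) (Split 2 3 (Split 2 4 (Split 2 6 (Split 1 6 (Split 3 6 (Split 4 6 (Split 3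
4 (Split 1 4 (Cert [0] [(0,1,5)] [(0,5)]) (Cert [0] [(0,1,4)] [(0,5)])) (Cert [0]
[(0,1,5),(0,3,4)] [(0,1),(0,5)])) (Cert [0] [(0,4,6),(0,1,5)] [(0,4),(0,5)])) (Cert [0]
[(0,1,5),(0,3,6)] [(0,4),(0,5)])) (Split 2 5 (Bare 0 2) (Split 3 4 (Split 1 4 (Cert [0]
[(0,2,5),(0,1,6)] [(0,5),(0,6)]) (Cert [0] [(0,1,4),(0,2,5)] [(0,5),(0,6)])) (Cert [0]
[(0,3,4),(0,2,5),(0,1,6)] [(0,1),(0,5),(0,6)])))) (Split 3 4 (Split 1 4 (Cert [0]
[(0,2,6),(0,1,5)] [(0,5),(0,6)]) (Cert [0] [(0,2,6),(0,1,4)] [(0,5),(0,6)])) (Cert [0]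
[(0,1,5),(0,2,6),(0,3,4)] [(0,1),(0,5),(0,6)]))) (Split 3 6 (Split 2 6 (Split 1 6 (Cert [0]
[(0,1,5),(0,2,4)] [(0,4),(0,5)]) (Cert [0] [(0,1,6),(0,2,4)] [(0,4),(0,5)])) (Split 3 4 (Split 1 6
(Cert [0] [(0,2,6),(0,1,5)] [(0,4),(0,5)]) (Split 3 5 (Bare 0 3) (Cert [0]
[(0,2,4),(0,3,5),(0,1,6)] [(0,1),(0,5),(0,6)]))) (Cert [0] [(0,2,6),(0,3,4),(0,1,5)]
[(0,1),(0,4),(0,5)]))) (Cert [0] [(0,1,5),(0,3,6),(0,2,4)] [(0,4),(0,5),(0,6)]))) (Split 4 6
(Split 1 6 (Split 2 6 (Split 2 4 (Split 1 4 (Cert [0] [(0,2,3),(0,1,5)] [(0,3),(0,5)]) (Cert [0]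
[(0,2,3),(0,1,4)] [(0,3),(0,5)])) (Split 3 6 (Cert [0] [(0,1,5),(0,2,3)] [(0,4),(0,5)]) (Cert [0]
[(0,2,4),(0,3,6),(0,1,5)] [(0,1),(0,3),(0,5)]))) (Split 3 4 (Split 1 4 (Split 3 6 (Cert [0]
[(0,2,6),(0,1,5)] [(0,2),(0,5)]) (Cert [0] [(0,1,5),(0,3,6)] [(0,2),(0,5)])) (Split 5 6 (Split 3 5
(Split 3 6 (Cert [0] [(0,1,5),(0,2,3)] [(0,2),(0,4)]) (Cert [0] [(0,1,4),(0,3,6)] [(0,2),(0,5)]))
(Cert [0] [(0,3,5),(0,2,6),(0,1,4)] [(0,2),(0,3),(0,5)])) (Cert [0] [(0,5,6),(0,1,4),(0,2,3)]
[(0,2),(0,3),(0,5)]))) (Cert [0] [(0,3,4),(0,2,6),(0,1,5)] [(0,3),(0,4),(0,5)]))) (Split 4 5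
(Split 1 4 (Split 2 6 (Split 2 4 (Cert [0] [(0,2,3),(0,1,6)] [(0,3),(0,5)]) (Cert [0]
[(0,2,4),(0,1,6)] [(0,3),(0,5)])) (Split 3 4 (Split 2 4 (Bare 0 4) (Split 3 6 (Cert [0]
[(0,1,6),(0,2,4)] [(0,2),(0,5)]) (Cert [0] [(0,2,4),(0,1,5),(0,3,6)] [(0,1),(0,2),(0,5)]))) (Cert
[0] [(0,3,4),(0,1,5),(0,2,6)] [(0,2),(0,3),(0,6)]))) (Split 5 6 (Split 2 6 (Split 2 5 (Split 2 4
(Cert [0] [(0,1,5),(0,2,3)] [(0,1),(0,3)]) (Cert [0] [(0,2,4),(0,1,5)] [(0,1),(0,3)])) (Split 3 6
(Cert [0] [(0,2,3),(0,1,6)] [(0,4),(0,5)]) (Cert [0] [(0,1,4),(0,3,6),(0,2,5)]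
[(0,1),(0,2),(0,3)]))) (Split 3 4 (Split 3 5 (Split 3 6 (Cert [0] [(0,2,3),(0,1,5)] [(0,1),(0,2)])
(Cert [0] [(0,1,5),(0,3,6)] [(0,1),(0,2)])) (Cert [0] [(0,1,4),(0,2,6),(0,3,5)]
[(0,1),(0,2),(0,3)])) (Cert [0] [(0,2,6),(0,3,4),(0,1,5)] [(0,1),(0,2),(0,3)]))) (Cert [0]
[(0,2,3),(0,1,4),(0,5,6)] [(0,1),(0,2),(0,3)]))) (Cert [0] [(0,2,3),(0,1,6),(0,4,5)]
[(0,4),(0,5),(0,6)]))) (Cert [0] [(0,1,5),(0,2,3),(0,4,6)] [(0,4),(0,5),(0,6)]))))))"

text \<open>Label 0 has degree at most 6, its neighbour 1 misses the neighbours 2 and 3, and labels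
  4 to 6 are for the remaining neighbours. Again \<open>linked\<close> is off, since the statement
  about links is being established.\<close>

lemma fork_refutes:
  "refutes (Frame 7 [0] [] [] 7 [] False)
     [(0,1),(0,2),(0,3)]
     [(1,2),(1,3)] fork_refutation"
  by code_simp

definition pendant1_refutation :: refutation where
  "pendant1_refutation =
Split 1 7 (Split 1 6 (Split 1 5 (Low 1 0) (Split 1 4 (Unsorted 0 4) (Split 1 3 (Unsorted 0 3)
(Split 1 2 (Unsorted 0 2) (Split 0 7 (Split 0 6 (Split 0 5 (Low 0 1) (Split 0 4 (Unsorted 1 4)
(Split 0 3 (Unsorted 1 3) (Split 0 2 (Unsorted 1 2) (Split 2 4 (Split 4 5 (Fork 0 4 2 5) (Split 2
5 (Fork 0 2 4 5) (Cert [0,1] [(0,1,3),(0,2,5),(1,4,5)] [(0,1),(0,2),(0,3),(1,3)]))) (Split 2 3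
(Split 3 4 (Fork 0 3 2 4) (Cert [0,1] [(0,1,5),(0,2,4),(1,3,4)] [(0,1),(0,2),(0,5),(1,5)])) (Cert
[0,1] [(1,2,4),(0,1,5),(0,2,3)] [(0,1),(0,5),(1,5),(3,4)]))))))) (Split 0 5 (Split 0 4 (Low 0 1)
(Split 0 3 (Unsorted 1 3) (Split 0 2 (Unsorted 1 2) (Split 3 6 (Fork 0 6 1 3) (Split 2 5 (Fork 1 5
0 2) (Cert [0,1] [(0,1,4),(1,2,5),(0,3,6)] [(0,2),(0,4),(1,3),(1,4)])))))) (Split 0 4 (Unsorted 1
4) (Split 0 3 (Unsorted 1 3) (Split 0 2 (Unsorted 1 2) (Split 3 4 (Split 4 5 (Fork 0 4 3 5) (Split
2 6 (Fork 0 6 1 2) (Split 2 4 (Fork 0 4 2 3) (Cert [0,1] [(0,1,3),(1,2,4),(0,2,6),(0,4,5)]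
[(0,1),(0,2),(0,6),(1,2),(3,5)])))) (Split 3 5 (Split 4 6 (Fork 0 6 1 4) (Split 2 3 (Fork 0 3 2 5)
(Cert [0,1] [(0,1,5),(1,3,4),(0,4,6),(0,2,3)] [(0,1),(0,2),(0,6),(1,2),(4,5)]))) (Split 4 6 (Fork
0 6 1 4) (Cert [0,1] [(1,3,4),(0,3,5),(0,1,2),(0,4,6)] [(0,1),(0,2),(0,6),(1,2),(4,5)])))))))))
(Split 0 6 (Unsorted 1 6) (Split 0 5 (Fork 0 1 6 7) (Split 0 4 (Unsorted 1 4) (Split 0 3 (Unsorted
1 3) (Split 0 2 (Unsorted 1 2) (Split 2 3 (Split 3 5 (Fork 1 3 2 5) (Split 3 4 (Fork 1 3 2 4)
(Split 2 5 (Fork 1 2 3 5) (Split 2 4 (Fork 1 2 3 4) (Cert [0,1] [(0,2,4),(1,2,5),(0,3,5),(1,3,4)]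
[(0,1),(0,6),(0,7),(4,5)]))))) (Split 2 5 (Split 4 5 (Fork 1 5 2 4) (Split 3 5 (Fork 1 5 2 3)
(Split 2 4 (Fork 1 2 4 5) (Cert [0,1] [(0,2,3),(0,4,5),(1,2,4),(1,3,5)]
[(0,1),(0,6),(0,7),(3,4)])))) (Split 3 4 (Split 4 5 (Fork 1 4 3 5) (Split 3 5 (Fork 1 3 4 5)
(Split 2 4 (Fork 1 4 2 3) (Cert [0,1] [(1,2,3),(0,3,5),(0,2,4),(1,4,5)]
[(0,1),(0,6),(0,7),(2,5)])))) (Split 4 5 (Split 3 5 (Fork 1 5 3 4) (Split 2 4 (Fork 1 4 2 5) (Cert
[0,1] [(1,3,4),(1,2,5),(0,2,4),(0,3,5)] [(0,1),(0,6),(0,7),(2,3)]))) (Split 6 7 (Split 2 4 (Cert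
[0,1] [(1,4,5),(0,2,5),(0,3,4),(1,2,3)] [(0,1),(0,6),(0,7),(3,5)]) (Split 4 7 (Split 4 6 (Split 5
7 (Split 3 7 (Split 3 6 (Cert [0,1] [(1,2,3),(1,4,5),(0,2,5),(0,3,4)] [(0,2),(0,5),(1,3),(1,4)])
(Cert [0,1] [(0,4,5),(0,3,6),(1,3,4),(0,1,2)] [(0,1),(0,2),(0,5),(1,2),(1,3)])) (Cert [0,1]
[(1,3,4),(0,3,7),(0,4,5),(0,1,2)] [(0,1),(0,2),(0,6),(1,2),(3,5)])) (Cert [0,1]
[(0,2,3),(0,1,4),(0,5,7),(1,2,5)] [(0,2),(0,3),(0,5),(1,3),(1,4)])) (Cert [0,1]
[(1,2,4),(0,1,5),(0,4,6),(0,2,3)] [(0,2),(0,3),(0,5),(1,4),(1,5)])) (Cert [0,1]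
[(0,4,7),(0,1,5),(0,2,3),(1,3,4),(2,4,5)] [(0,1),(0,6),(0,7),(3,5)]))) (Cert [0,1]
[(0,6,7),(0,2,5),(1,2,3),(1,4,5),(0,3,4)] [(0,1),(0,6),(0,7),(2,4),(3,5)])))))))))))))))) (Split 1
5 (Unsorted 0 5) (Split 1 4 (Unsorted 0 4) (Split 1 3 (Unsorted 0 3) (Split 1 2 (Unsorted 0 2)
(Split 0 7 (Split 0 6 (Split 0 5 (Low 0 1) (Split 0 4 (Unsorted 1 4) (Split 0 3 (Unsorted 1 3)
(Split 0 2 (Unsorted 1 2) (Split 2 3 (Split 3 4 (Fork 0 3 2 4) (Split 2 4 (Fork 0 2 3 4) (Cert
[0,1] [(0,1,5),(0,2,4),(1,3,4)] [(0,1),(0,5),(1,5),(1,6)]))) (Split 3 5 (Split 4 6 (Fork 1 6 0 4)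
(Split 4 5 (Fork 0 5 3 4) (Split 2 5 (Fork 0 5 2 3) (Cert [0,1] [(0,1,3),(1,2,5),(1,4,6),(0,4,5)]
[(0,1),(0,2),(1,2),(1,6),(3,4)])))) (Split 2 6 (Fork 1 6 0 2) (Cert [0,1]
[(1,3,5),(0,1,4),(0,2,3),(1,2,6)] [(0,1),(0,4),(1,4),(1,6),(2,5)])))))))) (Split 0 5 (Unsorted 1
5) (Split 0 4 (Unsorted 1 4) (Split 0 3 (Unsorted 1 3) (Split 0 2 (Unsorted 1 2) (Split 3 4 (Split
3 6 (Fork 0 3 4 6) (Split 2 4 (Fork 0 4 2 3) (Split 2 3 (Fork 0 3 2 4) (Cert [0,1]
[(0,1,5),(0,2,4),(1,2,3),(0,3,6)] [(0,1),(0,5),(0,6),(1,5),(1,6)])))) (Split 3 5 (Split 5 6 (Fork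
0 5 3 6) (Split 4 5 (Fork 0 5 3 4) (Cert [0,1] [(0,1,2),(1,3,4),(1,5,6),(0,4,5)]
[(0,1),(0,2),(0,6),(1,2),(1,6)]))) (Split 4 6 (Split 5 6 (Fork 0 6 4 5) (Cert [0,1]
[(1,3,4),(0,3,5),(0,1,2),(1,5,6)] [(0,1),(0,2),(1,2),(3,6),(4,5)])) (Split 5 6 (Split 4 5 (Fork 0
5 4 6) (Split 2 5 (Fork 0 5 2 6) (Cert [0,1] [(0,1,3),(0,4,6),(0,2,5),(1,4,5)]
[(0,1),(0,2),(0,3),(1,2),(1,3)]))) (Cert [0,1] [(1,5,6),(0,1,2),(0,3,5),(1,3,4),(0,4,6)]
[(0,1),(0,2),(0,3),(1,2),(1,3),(4,5)])))))))))) (Split 0 6 (Split 0 5 (Fork 1 0 5 6) (Split 0 4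
(Unsorted 1 4) (Split 0 3 (Unsorted 1 3) (Split 0 2 (Unsorted 1 2) (Split 2 3 (Split 5 6 (Fork 1 6
0 5) (Split 4 7 (Fork 0 7 1 4) (Split 2 5 (Fork 0 2 3 5) (Split 2 4 (Fork 0 2 3 4) (Cert [0,1]
[(0,1,3),(0,4,7),(1,2,4),(0,2,5),(1,5,6)] [(0,1),(0,3),(0,7),(1,3),(1,6),(4,5)]))))) (Split 3 5
(Split 5 6 (Fork 1 5 3 6) (Split 4 5 (Fork 0 5 3 4) (Split 3 7 (Fork 0 3 5 7) (Split 3 4 (Fork 0 3
4 5) (Cert [0,1] [(0,1,2),(1,3,4),(0,3,7),(1,5,6),(0,4,5)]
[(0,1),(0,2),(0,4),(0,5),(1,2),(1,6)]))))) (Split 5 7 (Fork 0 7 1 5) (Split 2 6 (Fork 1 6 0 2)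
(Cert [0,1] [(0,1,4),(0,2,3),(1,3,5),(0,5,7),(1,2,6)]
[(0,1),(0,4),(0,7),(1,4),(1,6),(2,5)]))))))))) (Split 0 5 (Unsorted 1 5) (Split 0 4 (Unsorted 1 4)
(Split 0 3 (Unsorted 1 3) (Split 0 2 (Unsorted 1 2) (Split 2 5 (Split 5 6 (Fork 1 5 2 6) (Split 3
5 (Fork 1 5 2 3) (Split 2 6 (Fork 1 2 5 6) (Split 2 3 (Fork 1 2 3 5) (Cert [0,1]
[(0,1,4),(1,5,6),(1,2,3),(0,3,5),(0,2,6)] [(0,1),(0,2),(0,4),(0,7),(1,4),(3,6)]))))) (Split 2 6
(Split 5 6 (Fork 1 6 2 5) (Split 3 6 (Fork 1 6 2 3) (Split 2 3 (Fork 1 2 3 6) (Cert [0,1]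
[(0,1,4),(1,2,5),(1,3,6),(0,5,6),(0,2,3)] [(0,1),(0,2),(0,4),(0,7),(1,4),(3,5)])))) (Split 4 5
(Split 5 6 (Fork 1 5 4 6) (Split 4 6 (Fork 1 4 5 6) (Split 3 5 (Fork 1 5 3 4) (Split 3 4 (Fork 1 4
3 5) (Cert [0,1] [(0,1,2),(0,3,5),(0,4,6),(1,5,6),(1,3,4)]
[(0,1),(0,2),(0,3),(0,7),(1,2),(1,3)]))))) (Split 4 6 (Split 5 6 (Fork 1 6 4 5) (Split 3 6 (Fork 1
6 3 4) (Split 3 4 (Fork 1 4 3 6) (Cert [0,1] [(0,1,2),(1,4,5),(1,3,6),(0,5,6),(0,3,4)]
[(0,1),(0,2),(0,3),(0,7),(1,2),(1,3)])))) (Cert [0,1] [(1,4,6),(0,1,3),(0,4,5),(1,2,5),(0,2,6)]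
[(0,1),(0,3),(0,7),(1,3),(2,4),(5,6)])))))))))))))))) (Split 1 6 (Unsorted 0 6) (Split 1 5
(Unsorted 0 5) (Split 1 4 (Unsorted 0 4) (Split 1 3 (Unsorted 0 3) (Split 1 2 (Split 0 2 (Split 0
3 (Split 0 4 (Split 0 5 (Split 0 6 (Split 0 7 (Bare 0 1) (Unsorted 0 2)) (Unsorted 0 2)) (Unsorted
0 2)) (Unsorted 0 2)) (Unsorted 0 2)) (Unsorted 0 2)) (Full 1))))))"

text \<open>Label 0 is \<open>w\<close>, label 1 its neighbour of degree at most 6, and labels 2 to
  7 are the other vertices around them, sorted by adjacency to label 1 first and to \<open>w\<close>
  second. Sorting breaks the symmetry among these vertices and keeps the tree small.\<close>

lemma pendant1_refutes:
  "refutes (Frame 8 [0,1] [1] [1,0] 2 [] True)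
     [(0,1)]
     [] pendant1_refutation"
  by code_simp

definition pendant2_refutation :: refutation where
  "pendant2_refutation =
Split 0 8 (Split 0 7 (Split 0 6 (Low 0 2) (Split 0 5 (Unsorted 0 5) (Split 0 4 (Unsorted 0 4)
(Split 0 3 (Unsorted 0 3) (Split 1 8 (Split 1 7 (Split 1 6 (Low 1 2) (Split 1 5 (Unsorted 1 5)
(Split 1 4 (Unsorted 1 4) (Split 1 3 (Unsorted 1 3) (Split 2 3 (Split 3 6 (Fork 0 3 2 6) (Split 3
4 (Fork 0 3 2 4) (Split 2 5 (Fork 0 2 3 5) (Split 2 4 (Fork 0 2 3 4) (Cert [0,1]
[(1,2,5),(0,2,4),(0,3,6),(1,3,4)] [(0,5),(0,6),(1,5),(1,6)]))))) (Split 2 5 (Split 5 6 (Fork 0 5 2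
6) (Split 4 5 (Fork 0 5 2 4) (Split 2 4 (Fork 0 2 4 5) (Cert [0,1]
[(1,2,3),(0,2,4),(0,5,6),(1,4,5)] [(0,3),(0,6),(1,3),(1,6)])))) (Split 3 4 (Split 4 6 (Fork 0 4 3
6) (Split 4 5 (Fork 0 4 3 5) (Cert [0,1] [(1,2,3),(0,2,5),(0,4,6),(1,4,5)]
[(0,6),(1,6),(2,4),(3,5)]))) (Split 4 5 (Split 4 6 (Fork 0 4 5 6) (Cert [0,1]
[(0,2,3),(1,2,5),(1,3,4),(0,4,6)] [(0,6),(1,6),(2,4),(3,5)])) (Cert [0,1]
[(0,3,4),(1,2,3),(1,4,5),(0,2,5)] [(0,6),(1,6),(2,4),(3,5)]))))))))) (Split 1 6 (Split 1 5 (Low 1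
2) (Split 1 4 (Unsorted 1 4) (Split 1 3 (Unsorted 1 3) (Split 2 3 (Split 3 5 (Fork 0 3 2 5) (Split
3 4 (Fork 0 3 2 4) (Split 2 6 (Fork 0 2 3 6) (Split 2 4 (Fork 0 2 3 4) (Cert [0,1]
[(0,2,6),(1,3,5),(0,3,4),(1,2,4)] [(0,5),(0,6),(1,5),(1,7)]))))) (Split 2 4 (Split 4 5 (Fork 0 4 2
5) (Split 3 4 (Fork 0 4 2 3) (Split 2 5 (Fork 0 2 4 5) (Cert [0,1]
[(1,2,3),(1,4,5),(0,2,5),(0,3,4)] [(0,2),(0,6),(1,7),(3,5)])))) (Split 3 5 (Split 4 5 (Fork 0 5 3
4) (Split 3 7 (Fork 1 3 5 7) (Cert [0,1] [(0,2,3),(1,2,4),(1,3,7),(0,4,5)]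
[(0,6),(1,7),(2,5),(3,4)]))) (Split 4 5 (Split 4 6 (Fork 0 4 5 6) (Cert [0,1]
[(1,2,4),(0,2,3),(1,3,5),(0,4,6)] [(0,6),(1,7),(2,5),(3,4)])) (Cert [0,1]
[(1,2,4),(0,4,5),(1,3,5),(0,2,3)] [(0,6),(1,7),(2,5),(3,4)])))))))) (Split 1 5 (Unsorted 1 5)
(Split 1 4 (Unsorted 1 4) (Split 1 3 (Unsorted 1 3) (Split 2 3 (Split 3 6 (Fork 0 3 2 6) (Split 3
5 (Fork 0 3 2 5) (Split 2 6 (Fork 0 2 3 6) (Split 2 5 (Fork 0 2 3 5) (Cert [0,1]
[(0,3,5),(1,3,6),(0,2,6),(1,2,5)] [(0,4),(1,4),(1,7),(5,6)]))))) (Split 2 5 (Split 5 6 (Fork 0 5 2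
6) (Split 3 5 (Fork 0 5 2 3) (Split 2 6 (Fork 0 2 5 6) (Cert [0,1]
[(1,2,3),(1,5,6),(0,3,5),(0,2,6)] [(0,4),(1,4),(1,7),(3,6)])))) (Split 3 6 (Split 5 6 (Fork 0 6 3
5) (Split 4 6 (Fork 0 6 3 4) (Split 3 7 (Fork 1 3 6 7) (Cert [0,1]
[(1,2,5),(0,2,3),(1,3,7),(1,4,6),(0,5,6)] [(0,4),(1,4),(1,7),(2,6),(3,5)])))) (Split 4 7 (Split 6
7 (Fork 1 7 4 6) (Split 5 7 (Fork 1 7 4 5) (Split 4 5 (Fork 1 4 5 7) (Split 2 7 (Fork 1 7 2 4)
(Split 2 4 (Fork 1 4 2 7) (Cert [0,1,2] [(1,2,3),(0,3,6),(1,6,7),(1,4,5),(0,2,4),(2,5,7)]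
[(0,2),(0,3),(1,2),(1,3),(2,3),(2,8),(4,6),(5,6)])))))) (Split 5 6 (Split 3 5 (Fork 0 5 3 6)
(Split 2 6 (Fork 0 6 2 5) (Cert [0,1,2] [(1,3,6),(1,4,7),(1,2,5),(0,2,6),(0,3,5)]
[(0,4),(1,4),(1,7),(2,3),(2,5),(2,6),(2,8)]))) (Cert [0,1]
[(1,5,6),(1,2,3),(0,3,6),(1,4,7),(0,2,5)] [(0,4),(1,4),(1,7),(2,6),(3,5)]))))))))))) (Split 1 7
(Unsorted 1 7) (Split 1 6 (Split 1 5 (Split 1 4 (Low 1 2) (Split 1 3 (Unsorted 1 3) (Split 2 3
(Split 3 5 (Fork 0 3 2 5) (Split 3 4 (Fork 0 3 2 4) (Split 2 7 (Fork 1 2 3 7) (Split 2 4 (Fork 0 2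
3 4) (Cert [0,1] [(0,3,5),(1,3,4),(0,2,4),(1,2,7)] [(0,5),(0,6),(1,7),(1,8)]))))) (Split 2 4
(Split 4 7 (Fork 1 4 2 7) (Split 3 4 (Fork 0 4 2 3) (Split 2 6 (Fork 0 2 4 6) (Cert [0,1]
[(1,2,3),(0,2,6),(1,4,7),(0,3,4)] [(0,5),(0,6),(1,7),(1,8)])))) (Split 2 5 (Split 3 4 (Split 5 6
(Fork 0 5 2 6) (Split 3 7 (Fork 1 3 4 7) (Cert [0,1] [(1,2,4),(0,2,3),(0,5,6),(1,3,7)]
[(0,5),(0,6),(1,7),(1,8)]))) (Split 7 8 (Split 4 8 (Fork 1 8 4 7) (Split 4 7 (Fork 1 7 4 8) (Split
2 8 (Fork 1 8 2 7) (Split 2 6 (Fork 0 2 5 6) (Cert [0,1,2]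
[(1,2,3),(0,3,4),(1,4,7),(0,2,6),(2,4,8)] [(0,2),(0,5),(0,6),(1,2),(1,3),(2,3),(2,6)]))))) (Split
5 6 (Fork 0 5 2 6) (Split 4 5 (Fork 0 5 2 4) (Split 3 5 (Fork 0 5 2 3) (Cert [0,1]
[(0,2,3),(1,2,4),(1,7,8),(0,5,6),(3,4,5)] [(0,6),(1,7),(1,8)])))))) (Split 2 6 (Split 3 7 (Split 7
8 (Fork 1 7 3 8) (Split 4 6 (Fork 0 6 2 4) (Split 3 8 (Fork 1 3 7 8) (Split 2 8 (Fork 2 1 0 5)
(Split 2 7 (Fork 1 7 2 3) (Cert [0,1,2] [(1,2,4),(0,2,3),(1,3,8),(0,4,6),(2,7,8)]
[(0,2),(0,3),(0,5),(1,2),(1,4),(2,4),(2,5)])))))) (Split 5 8 (Split 3 6 (Fork 0 6 2 3) (Split 2 8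
(Fork 2 1 0 5) (Split 2 7 (Fork 2 1 0 5) (Cert [0,2] [(0,2,5),(0,3,6),(1,2,8),(2,3,7)]
[(0,4),(0,5),(2,3),(2,4),(2,7)])))) (Split 4 6 (Fork 0 6 2 4) (Split 2 8 (Fork 2 1 0 5) (Cert
[0,1,2] [(0,2,3),(1,2,4),(1,3,7),(2,5,8),(0,4,6)] [(0,3),(0,5),(1,4),(1,8),(2,3),(2,4),(2,7)])))))
(Split 2 7 (Split 4 5 (Split 7 8 (Fork 1 7 2 8) (Split 5 6 (Fork 0 5 4 6) (Split 4 6 (Fork 0 4 5
6) (Cert [0,1,2] [(1,2,4),(0,2,3),(2,5,6),(0,4,6),(1,7,8)]
[(0,2),(0,3),(1,2),(1,3),(1,4),(2,3),(2,8)])))) (Split 5 6 (Split 3 7 (Fork 1 7 2 3) (Split 3 5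
(Fork 0 5 3 6) (Cert [0,1,2] [(1,2,4),(0,4,5),(0,2,6),(1,3,7),(2,3,5)]
[(0,2),(0,3),(1,4),(1,8),(2,3),(2,8),(4,6)]))) (Split 7 8 (Fork 1 7 2 8) (Cert [0,1,2]
[(0,2,3),(0,4,5),(2,5,6),(1,2,4),(1,7,8)] [(0,2),(0,3),(1,3),(1,4),(2,3),(2,8),(4,6)])))) (Split 2
8 (Split 3 5 (Split 7 8 (Fork 1 8 2 7) (Split 4 5 (Fork 0 5 3 4) (Split 3 4 (Fork 0 3 4 5) (Cert
[0,1,2] [(1,2,3),(0,2,6),(0,3,4),(1,7,8),(2,4,5)] [(0,2),(0,3),(0,6),(1,3),(1,4),(2,6),(2,7)]))))
(Split 4 5 (Split 7 8 (Fork 1 8 2 7) (Split 5 6 (Fork 0 5 4 6) (Cert [0,1,2]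
[(1,2,3),(0,2,4),(0,3,5),(1,7,8),(2,5,6)] [(0,2),(0,3),(1,3),(1,4),(2,3),(2,7),(4,6)]))) (Split 7
8 (Fork 1 8 2 7) (Cert [0,1,2] [(1,2,3),(0,2,6),(0,3,5),(2,4,5),(1,7,8)]
[(0,2),(0,6),(1,3),(1,4),(2,6),(2,7),(3,4)])))) (Split 4 7 (Split 7 8 (Fork 1 7 4 8) (Split 4 8
(Fork 1 4 7 8) (Cert [1,2] [(1,2,3),(0,2,4),(2,7,8),(1,4,8)] [(1,2),(1,3),(2,3),(2,5),(2,6)])))
(Split 5 6 (Split 3 6 (Fork 0 6 3 5) (Split 3 5 (Fork 0 5 3 6) (Cert [0,1,2]
[(0,2,4),(1,2,8),(1,4,7),(0,3,6),(2,3,5)] [(0,2),(0,4),(1,3),(1,8),(2,4),(2,7),(2,8)]))) (Split 7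
8 (Split 4 8 (Fork 1 8 4 7) (Split 3 8 (Fork 1 8 3 7) (Split 3 7 (Fork 1 7 3 8) (Cert [1,2]
[(0,2,6),(1,4,7),(2,3,7),(1,3,8),(2,4,8)] [(0,2),(1,2),(2,5),(2,6),(3,4)])))) (Cert [1,2]
[(2,7,8),(0,2,4),(1,4,7),(1,2,3),(2,5,6)] [(1,2),(1,3),(2,3),(2,5),(2,6),(4,8)])))))))))))) (Split
1 4 (Unsorted 1 4) (Split 1 3 (Unsorted 1 3) (Split 2 3 (Split 3 5 (Fork 0 3 2 5) (Split 3 4 (Fork
0 3 2 4) (Split 2 5 (Fork 0 2 3 5) (Split 2 4 (Fork 0 2 3 4) (Cert [0,1]
[(0,2,4),(0,3,5),(1,2,5),(1,3,4)] [(0,6),(1,7),(1,8),(4,5)]))))) (Split 2 5 (Split 4 5 (Fork 0 5 2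
4) (Split 3 5 (Fork 0 5 2 3) (Split 2 4 (Fork 0 2 4 5) (Cert [0,1]
[(1,2,3),(0,3,5),(0,2,4),(1,4,5)] [(0,6),(1,7),(1,8),(3,4)])))) (Split 3 4 (Split 4 7 (Fork 1 4 3
7) (Split 4 5 (Fork 0 4 3 5) (Split 3 8 (Fork 1 3 4 8) (Cert [0,1]
[(0,2,3),(1,2,5),(1,3,8),(0,4,5),(1,4,7)] [(0,6),(1,7),(1,8),(2,4),(3,5)])))) (Split 4 5 (Split 3
5 (Fork 0 5 3 4) (Split 2 4 (Fork 0 4 2 5) (Cert [0,1] [(1,3,4),(1,2,5),(0,2,4),(0,3,5)]
[(0,6),(1,7),(1,8),(2,3)]))) (Split 7 8 (Split 2 4 (Split 5 8 (Fork 1 8 5 7) (Split 2 7 (Fork 1 2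
4 7) (Cert [0,1,2] [(1,3,4),(0,2,3),(0,4,5),(1,2,7),(1,5,8)]
[(0,6),(1,7),(1,8),(2,3),(2,5),(2,6),(3,5)]))) (Split 5 7 (Fork 1 7 5 8) (Split 4 7 (Fork 1 7 4 8)
(Split 2 8 (Fork 1 8 2 7) (Split 2 7 (Fork 1 7 2 8) (Cert [0,1,2]
[(0,4,5),(0,2,3),(1,3,4),(1,5,7),(1,2,8),(2,4,7)]
[(0,2),(0,6),(1,2),(1,8),(2,6),(2,8),(3,5),(3,7)])))))) (Cert [0,1]
[(0,2,3),(1,3,4),(1,2,5),(0,4,5),(1,7,8)] [(0,6),(1,7),(1,8),(2,4),(3,5)]))))))))) (Split 1 5
(Unsorted 1 5) (Split 1 4 (Unsorted 1 4) (Split 1 3 (Split 2 3 (Split 2 4 (Split 2 5 (Split 2 6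
(Bare 0 2) (Unsorted 1 3)) (Unsorted 1 3)) (Unsorted 1 3)) (Unsorted 1 3)) (Full 1)))))))))))
(Split 0 6 (Unsorted 0 6) (Split 0 5 (Unsorted 0 5) (Split 0 4 (Unsorted 0 4) (Split 0 3 (Unsorted
0 3) (Split 1 8 (Split 1 7 (Split 1 6 (Low 1 2) (Split 1 5 (Unsorted 1 5) (Split 1 4 (Unsorted 1
4) (Split 1 3 (Unsorted 1 3) (Split 2 4 (Split 4 6 (Fork 0 4 2 6) (Split 4 5 (Fork 0 4 2 5) (Split
2 6 (Fork 0 2 4 6) (Split 2 5 (Fork 0 2 4 5) (Cert [0,1] [(0,2,5),(1,2,6),(1,4,5),(0,4,6)]
[(0,3),(0,7),(1,3),(5,6)]))))) (Split 2 6 (Split 5 6 (Fork 0 6 2 5) (Split 4 6 (Fork 0 6 2 4)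
(Split 2 5 (Fork 0 2 5 6) (Cert [0,1] [(1,2,4),(0,2,5),(0,4,6),(1,5,6)]
[(0,3),(0,7),(1,3),(4,5)])))) (Split 3 7 (Split 5 7 (Fork 0 7 3 5) (Split 3 6 (Fork 0 3 6 7)
(Split 3 4 (Fork 0 3 4 7) (Cert [0,1] [(0,2,4),(1,2,6),(0,3,6),(1,3,4),(0,5,7)]
[(0,5),(0,7),(1,5),(2,3),(4,6)])))) (Split 4 5 (Split 5 6 (Fork 0 5 4 6) (Split 4 6 (Fork 0 4 5 6)
(Split 2 5 (Fork 0 5 2 4) (Cert [0,1,2] [(0,3,7),(1,2,4),(1,5,6),(0,4,6),(0,2,5)]
[(0,3),(0,7),(1,3),(2,4),(2,5),(2,6),(2,8)])))) (Split 5 6 (Split 4 6 (Fork 0 6 4 5) (Split 2 5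
(Fork 0 5 2 6) (Cert [0,1,2] [(1,4,5),(0,3,7),(1,2,6),(0,4,6),(0,2,5)]
[(0,3),(0,7),(1,3),(2,4),(2,5),(2,6),(2,8)]))) (Cert [0,1]
[(0,3,7),(0,4,5),(1,5,6),(0,2,6),(1,2,4)] [(0,3),(0,7),(1,3),(2,5),(4,6)])))))))))) (Split 1 6
(Unsorted 1 6) (Split 1 5 (Unsorted 1 5) (Split 1 4 (Unsorted 1 4) (Split 1 3 (Unsorted 1 3)
(Split 2 3 (Split 5 6 (Split 5 7 (Fork 0 5 6 7) (Split 4 5 (Fork 0 5 4 6) (Split 3 7 (Fork 0 3 2
7) (Split 3 6 (Fork 0 3 2 6) (Split 2 6 (Fork 0 2 3 6) (Split 2 4 (Fork 0 2 3 4) (Cert [0,1,2]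
[(1,2,6),(0,2,4),(1,4,5),(0,3,6),(1,3,7),(0,5,7)]
[(0,2),(0,3),(1,2),(1,3),(2,8),(4,6),(4,7),(6,7)]))))))) (Split 3 7 (Fork 0 3 2 7) (Split 3 4
(Fork 0 3 2 4) (Split 2 7 (Fork 0 2 3 7) (Split 2 4 (Fork 0 2 3 4) (Cert [0,1]
[(0,5,6),(1,3,7),(0,3,4),(1,2,4),(0,2,7)] [(0,5),(0,6),(1,5),(1,6),(4,7)])))))) (Split 2 5 (Split
4 6 (Split 5 6 (Fork 0 5 2 6) (Split 4 7 (Fork 0 4 6 7) (Split 4 5 (Fork 0 4 5 6) (Split 3 6 (Fork
0 6 3 4) (Split 2 7 (Fork 0 2 5 7) (Cert [0,1,2] [(0,2,3),(1,4,5),(1,2,7),(1,3,6),(0,4,7),(0,5,6)]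
[(0,2),(0,3),(1,2),(1,3),(2,3),(2,8),(5,7),(6,7)])))))) (Split 5 7 (Fork 0 5 2 7) (Split 3 5 (Fork
0 5 2 3) (Split 2 7 (Fork 0 2 5 7) (Cert [0,1] [(1,4,6),(1,2,3),(0,2,7),(0,3,5),(1,5,7)]
[(0,4),(0,6),(1,4),(1,6),(3,7)]))))) (Split 2 4 (Split 6 7 (Split 5 6 (Fork 0 6 5 7) (Split 4 7
(Fork 0 4 2 7) (Split 4 6 (Fork 0 4 2 6) (Split 3 7 (Fork 0 7 3 6) (Cert [0,1,2]
[(1,2,3),(0,2,5),(0,3,7),(1,5,6),(0,4,6),(1,4,7)]
[(0,2),(0,3),(1,2),(1,3),(2,3),(2,8),(4,5),(5,7)]))))) (Split 4 5 (Fork 0 4 2 5) (Split 3 4 (Fork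
0 4 2 3) (Cert [0,1] [(1,6,7),(0,2,3),(1,2,5),(0,4,5),(1,3,4)] [(0,6),(0,7),(1,6),(1,7),(3,5)]))))
(Split 2 7 (Split 4 6 (Split 5 6 (Fork 0 6 4 5) (Split 4 7 (Fork 0 4 6 7) (Split 3 7 (Fork 0 7 2
3) (Split 3 6 (Fork 0 6 3 4) (Cert [0,1,2] [(1,2,5),(0,2,4),(1,3,6),(0,3,7),(1,4,7),(0,5,6)]
[(0,2),(0,5),(1,2),(1,5),(2,5),(2,8),(3,4),(6,7)]))))) (Split 5 7 (Fork 0 7 2 5) (Split 3 7 (Fork
0 7 2 3) (Cert [0,1] [(1,4,6),(0,2,3),(1,2,5),(1,3,7),(0,5,7)] [(0,4),(0,6),(1,4),(1,6),(3,5)]))))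
(Split 3 6 (Split 6 7 (Fork 0 6 3 7) (Split 5 6 (Fork 0 6 3 5) (Split 4 6 (Fork 0 6 3 4) (Split 3
7 (Fork 0 3 6 7) (Split 2 6 (Fork 0 6 2 3) (Cert [0,1,2]
[(0,2,3),(1,2,4),(1,3,7),(0,4,6),(1,5,6),(2,6,7)]
[(0,2),(0,4),(1,2),(1,4),(2,4),(2,8),(3,5),(5,7)])))))) (Split 3 4 (Split 4 6 (Fork 0 4 3 6)
(Split 4 5 (Fork 0 4 3 5) (Split 3 7 (Fork 0 3 4 7) (Cert [0,1,2]
[(0,3,6),(1,2,5),(0,2,7),(1,3,7),(1,4,6),(0,4,5)]
[(0,2),(0,5),(1,2),(1,5),(2,5),(2,8),(4,7),(6,7)])))) (Split 3 5 (Split 5 6 (Fork 0 5 3 6) (Split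
4 5 (Fork 0 5 3 4) (Split 3 7 (Fork 0 3 5 7) (Cert [0,1,2]
[(0,2,4),(1,3,6),(1,2,7),(0,5,6),(0,3,7),(1,4,5)]
[(0,2),(0,4),(1,2),(1,4),(2,4),(2,8),(5,7),(6,7)])))) (Split 5 6 (Split 6 7 (Fork 0 6 5 7) (Split
4 6 (Fork 0 6 4 5) (Split 4 5 (Fork 0 5 4 6) (Split 2 6 (Fork 0 6 2 5) (Cert [0,1,2]
[(1,2,5),(0,2,3),(1,3,4),(0,4,5),(0,6,7),(2,4,6)]
[(0,2),(0,3),(1,2),(1,3),(2,3),(2,8),(4,7),(5,7)]))))) (Cert [0,1,2]
[(1,5,6),(0,3,6),(0,2,4),(1,3,4),(1,2,7),(2,3,5)]
[(0,2),(0,7),(1,2),(1,7),(2,7),(2,8),(4,5),(4,6)])))))))))))))) (Split 1 7 (Split 1 6 (Split 1 5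
(Low 1 2) (Split 1 4 (Unsorted 1 4) (Split 1 3 (Unsorted 1 3) (Split 2 3 (Split 3 5 (Fork 0 3 2 5)
(Split 3 4 (Fork 0 3 2 4) (Split 2 5 (Fork 0 2 3 5) (Split 2 4 (Fork 0 2 3 4) (Cert [0,1]
[(0,2,5),(1,3,5),(0,3,4),(1,2,4)] [(0,6),(0,7),(1,8),(4,5)]))))) (Split 2 4 (Split 4 5 (Fork 0 4 2
5) (Split 3 4 (Fork 0 4 2 3) (Split 2 5 (Fork 0 2 4 5) (Cert [0,1]
[(0,2,3),(1,3,4),(1,2,5),(0,4,5)] [(0,6),(0,7),(1,8),(3,5)])))) (Split 3 5 (Split 4 5 (Fork 0 5 3
4) (Split 3 4 (Fork 0 3 4 5) (Split 2 5 (Fork 0 5 2 3) (Cert [0,1]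
[(0,2,3),(0,4,5),(1,3,4),(1,2,5)] [(0,6),(0,7),(1,8),(2,4)])))) (Split 4 5 (Split 5 7 (Fork 0 5 4
7) (Split 4 6 (Fork 0 4 5 6) (Cert [0,1] [(0,2,3),(1,3,5),(1,2,4),(0,5,7),(0,4,6)]
[(0,6),(0,7),(1,8),(2,5),(3,4)]))) (Split 6 7 (Split 4 8 (Split 5 6 (Fork 0 6 5 7) (Split 4 6
(Fork 0 6 4 7) (Split 3 4 (Fork 1 4 3 8) (Split 2 7 (Fork 0 7 2 6) (Split 2 6 (Fork 0 6 2 7) (Cert
[0,1,2] [(1,2,3),(1,4,5),(0,2,7),(0,3,4),(0,5,6),(2,4,6)]
[(0,2),(0,7),(1,2),(1,8),(2,7),(2,8),(3,5),(3,6)])))))) (Split 5 6 (Fork 0 6 5 7) (Split 3 7 (Fork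
0 7 3 6) (Split 3 6 (Fork 0 6 3 7) (Split 2 6 (Fork 0 6 2 7) (Cert [0,1,2]
[(0,2,4),(1,3,5),(1,4,8),(0,3,7),(0,5,6),(2,3,6)]
[(0,2),(0,4),(1,3),(1,5),(2,4),(2,8),(5,7)])))))) (Cert [0,1]
[(0,4,5),(0,2,3),(0,6,7),(1,3,5),(1,2,4)] [(0,6),(0,7),(1,8),(2,5),(3,4)]))))))))) (Split 1 5
(Unsorted 1 5) (Split 1 4 (Unsorted 1 4) (Split 1 3 (Unsorted 1 3) (Split 2 7 (Split 3 4 (Split 6
7 (Fork 0 7 2 6) (Split 4 6 (Fork 0 4 3 6) (Split 4 5 (Fork 0 4 3 5) (Split 3 8 (Fork 1 3 4 8)
(Split 2 5 (Fork 0 2 5 7) (Split 2 3 (Fork 0 2 3 7) (Cert [0,1,2]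
[(0,4,5),(1,3,8),(1,2,5),(1,4,6),(0,6,7),(0,2,3)]
[(0,2),(0,7),(1,2),(1,8),(2,8),(3,5),(3,6),(5,6)]))))))) (Split 3 6 (Split 6 8 (Fork 1 6 3 8)
(Split 5 7 (Fork 0 7 2 5) (Split 4 6 (Fork 0 6 3 4) (Split 2 5 (Fork 0 2 5 7) (Split 2 3 (Fork 0 2
3 7) (Cert [0,1,2] [(1,3,4),(1,2,5),(0,4,6),(0,5,7),(1,6,8),(0,2,3)]
[(0,2),(0,5),(0,7),(1,2),(1,5),(1,8),(2,5),(2,8)])))))) (Split 5 8 (Split 5 6 (Fork 1 5 6 8)
(Split 4 7 (Fork 0 7 2 4) (Split 2 8 (Fork 1 8 2 5) (Split 2 5 (Fork 0 2 5 7) (Cert [0,1,2]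
[(1,3,4),(0,3,6),(0,2,5),(1,5,6),(1,2,8),(0,4,7)]
[(0,2),(0,7),(1,2),(1,8),(2,8),(3,5),(4,5),(4,6)]))))) (Split 6 7 (Fork 0 7 2 6) (Split 2 5 (Fork
0 2 5 7) (Split 2 4 (Fork 0 2 4 7) (Cert [0,1,2] [(1,5,8),(1,3,6),(0,3,4),(1,2,4),(0,6,7),(0,2,5)]
[(0,5),(0,7),(1,5),(1,8),(2,3),(2,4),(2,6),(4,6)]))))))) (Split 2 8 (Split 3 6 (Split 5 8 (Fork 1
8 2 5) (Split 4 6 (Fork 0 6 3 4) (Split 3 5 (Fork 0 3 5 6) (Split 3 4 (Fork 0 3 4 6) (Split 2 6
(Fork 0 6 2 3) (Cert [0,1,2] [(0,2,7),(1,3,4),(1,5,8),(0,4,6),(1,2,6),(0,3,5)]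
[(0,2),(0,3),(0,7),(1,2),(1,8),(2,7),(4,5),(5,6)])))))) (Split 3 5 (Split 5 8 (Fork 1 5 3 8)
(Split 5 6 (Fork 0 5 3 6) (Split 3 4 (Fork 0 3 4 5) (Split 2 4 (Fork 1 2 4 8) (Cert [0,1,2]
[(0,2,7),(1,3,6),(1,5,8),(1,2,4),(0,3,4),(0,5,6)]
[(0,2),(0,3),(0,7),(1,2),(1,8),(2,7),(4,5),(4,6)]))))) (Split 4 5 (Split 6 8 (Fork 1 8 2 6) (Split
5 6 (Fork 0 5 4 6) (Split 2 6 (Fork 1 2 6 8) (Split 2 5 (Fork 0 5 2 4) (Split 2 4 (Fork 0 4 2 5)
(Cert [0,1,2] [(0,3,6),(1,3,5),(0,2,7),(1,6,8),(1,2,4),(2,5,6)]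
[(0,2),(0,3),(0,7),(1,2),(1,8),(2,7),(3,4),(4,6)])))))) (Split 5 8 (Fork 1 8 2 5) (Split 2 5 (Fork
1 2 5 8) (Split 2 4 (Fork 1 2 4 8) (Split 2 3 (Fork 1 2 3 8) (Cert [0,1,2]
[(0,4,5),(1,3,6),(0,2,7),(1,2,4),(1,5,8),(2,3,5)]
[(0,2),(0,7),(1,2),(1,8),(2,7),(3,4),(4,6),(5,6)])))))))) (Split 3 4 (Split 4 6 (Fork 0 4 3 6)
(Split 4 5 (Fork 0 4 3 5) (Split 3 6 (Fork 0 3 4 6) (Split 3 5 (Fork 0 3 4 5) (Cert [0,1,2]
[(0,2,7),(1,2,8),(1,4,6),(0,4,5),(0,3,6),(1,3,5)]
[(0,2),(0,3),(0,7),(1,2),(1,8),(2,7),(2,8),(5,6)]))))) (Split 3 6 (Split 5 6 (Fork 0 6 3 5) (Split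
4 6 (Fork 0 6 3 4) (Split 3 5 (Fork 0 3 5 6) (Cert [0,1,2]
[(0,3,4),(1,2,8),(0,2,7),(1,4,6),(0,5,6),(1,3,5)]
[(0,2),(0,3),(0,7),(1,2),(1,8),(2,7),(2,8),(4,5)])))) (Split 4 5 (Split 5 8 (Fork 1 5 4 8) (Split
5 6 (Fork 0 5 4 6) (Split 2 4 (Fork 0 4 2 5) (Cert [0,1,2]
[(0,3,4),(1,3,6),(0,2,7),(0,5,6),(1,5,8),(1,2,4)]
[(0,2),(0,7),(1,2),(1,8),(2,7),(2,8),(3,5),(4,6)])))) (Split 5 6 (Split 4 6 (Fork 0 6 4 5) (Split
3 5 (Fork 0 5 3 6) (Cert [0,1,2] [(0,3,6),(0,4,5),(0,2,7),(1,2,8),(1,4,6),(1,3,5)]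
[(0,2),(0,3),(0,7),(1,2),(1,8),(2,7),(2,8),(3,4)]))) (Cert [0,1,2]
[(1,2,8),(0,5,6),(0,3,4),(1,3,6),(0,2,7),(1,4,5)]
[(0,2),(0,7),(1,2),(1,8),(2,7),(2,8),(3,5),(4,6)]))))))))))) (Split 1 6 (Unsorted 1 6) (Split 1 5
(Unsorted 1 5) (Split 1 4 (Unsorted 1 4) (Split 1 3 (Split 2 3 (Split 2 4 (Split 2 5 (Split 2 6
(Split 2 7 (Bare 0 2) (Unsorted 1 3)) (Unsorted 1 3)) (Unsorted 1 3)) (Unsorted 1 3)) (Unsorted 1
3)) (Full 1)))))))))))) (Split 0 7 (Unsorted 0 7) (Split 0 6 (Unsorted 0 6) (Split 0 5 (Unsorted 0
5) (Split 0 4 (Unsorted 0 4) (Split 0 3 (Split 1 3 (Split 1 4 (Split 1 5 (Split 1 6 (Split 1 7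
(Split 1 8 (Bare 1 2) (Unsorted 0 3)) (Unsorted 0 3)) (Unsorted 0 3)) (Unsorted 0 3)) (Unsorted 0
3)) (Unsorted 0 3)) (Full 0))))))"

text \<open>Labels 0 and 1 are the pendants, label 2 is \<open>w\<close>, and labels 3 to 8 are the
  rest of the bag. Label 2 is closed because the two pendants are the only neighbours of
  \<open>w\<close> outside the bag.\<close>

lemma pendant2_refutes:
  "refutes (Frame 9 [0,1,2] [0,1] [0,1] 3 [] True)
     [(0,2),(1,2)]
     [(0,1)] pendant2_refutation"
  by code_simp

definition pendants3_refutation :: refutation where
  "pendants3_refutation =
Split 0 9 (Split 0 8 (Split 0 7 (Low 0 3) (Split 0 6 (Unsorted 0 6) (Split 0 5 (Unsorted 0 5)
(Split 0 4 (Unsorted 0 4) (Split 1 9 (Split 1 8 (Split 1 7 (Low 1 3) (Split 1 6 (Unsorted 1 6)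
(Split 1 5 (Unsorted 1 5) (Split 1 4 (Unsorted 1 4) (Split 3 4 (Split 4 6 (Fork 0 4 3 6) (Split 4
5 (Fork 0 4 3 5) (Split 3 7 (Fork 0 3 4 7) (Split 3 5 (Fork 0 3 4 5) (Cert [0,1]
[(1,3,5),(1,4,6),(0,3,7),(0,4,5)] [(0,6),(0,7),(1,6),(1,7)]))))) (Split 3 7 (Split 6 7 (Fork 0 7 3
6) (Split 5 7 (Fork 0 7 3 5) (Split 3 5 (Fork 0 3 5 7) (Cert [0,1]
[(1,3,4),(0,3,5),(0,6,7),(1,5,7)] [(0,4),(0,6),(1,4),(1,6)])))) (Split 4 5 (Split 5 6 (Fork 0 5 4
6) (Split 4 6 (Fork 0 4 5 6) (Cert [0,1] [(0,3,4),(1,3,7),(0,5,6),(1,4,6)]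
[(0,3),(0,7),(1,3),(1,7)]))) (Split 5 7 (Split 6 7 (Fork 0 7 5 6) (Cert [0,1]
[(0,3,4),(1,3,7),(1,4,5),(0,6,7)] [(0,6),(1,6),(3,5),(4,7)])) (Cert [0,1]
[(1,3,4),(0,4,5),(1,5,7),(0,3,7)] [(0,6),(1,6),(3,5),(4,7)]))))))))) (Split 1 7 (Split 1 6 (Low 1
3) (Split 1 5 (Unsorted 1 5) (Split 1 4 (Unsorted 1 4) (Split 3 4 (Split 4 6 (Fork 0 4 3 6) (Split
4 5 (Fork 0 4 3 5) (Split 3 7 (Fork 0 3 4 7) (Split 3 5 (Fork 0 3 4 5) (Cert [0,1]
[(0,4,5),(0,3,7),(1,4,6),(1,3,5)] [(0,6),(0,7),(1,6),(1,8)]))))) (Split 3 5 (Split 5 7 (Fork 0 5 3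
7) (Split 4 5 (Fork 0 5 3 4) (Split 3 8 (Fork 1 3 5 8) (Cert [0,1]
[(0,3,4),(1,3,8),(0,5,7),(1,4,5)] [(0,6),(0,7),(1,6),(1,8)])))) (Split 4 6 (Split 6 7 (Fork 0 6 4
7) (Split 5 6 (Fork 0 6 4 5) (Cert [0,1] [(0,3,5),(1,3,4),(1,5,6),(0,6,7)]
[(0,7),(1,8),(3,6),(4,5)]))) (Split 5 6 (Split 6 8 (Fork 1 6 5 8) (Cert [0,1]
[(1,3,4),(0,3,5),(0,4,6),(1,6,8)] [(0,7),(1,8),(3,6),(4,5)])) (Cert [0,1]
[(1,3,5),(0,5,6),(0,3,4),(1,4,6)] [(0,7),(1,8),(3,6),(4,5)])))))))) (Split 1 6 (Unsorted 1 6)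
(Split 1 5 (Unsorted 1 5) (Split 1 4 (Unsorted 1 4) (Split 3 8 (Split 4 6 (Split 6 7 (Fork 0 6 4
7) (Split 5 6 (Fork 0 6 4 5) (Split 4 8 (Fork 1 4 6 8) (Split 3 7 (Fork 1 3 7 8) (Split 3 4 (Fork
0 4 3 6) (Cert [0,1] [(1,3,7),(0,3,4),(0,6,7),(1,4,8),(1,5,6)]
[(0,5),(1,5),(1,8),(3,6),(4,7)])))))) (Split 4 5 (Split 5 8 (Fork 1 5 4 8) (Split 5 7 (Fork 0 5 4
7) (Split 3 7 (Fork 1 3 7 8) (Split 3 4 (Fork 0 4 3 5) (Cert [0,1]
[(1,4,6),(1,3,7),(1,5,8),(0,5,7),(0,3,4)] [(0,6),(1,6),(1,8),(3,5),(4,7)]))))) (Split 7 8 (Fork 1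
8 3 7) (Split 3 6 (Fork 1 3 6 8) (Split 3 5 (Fork 1 3 5 8) (Cert [0,1]
[(1,4,6),(0,4,5),(1,3,5),(0,3,6),(1,7,8)] [(0,7),(1,7),(1,8),(3,4),(5,6)])))))) (Split 4 5 (Split
5 7 (Fork 0 5 4 7) (Split 5 6 (Fork 0 5 4 6) (Split 4 6 (Fork 0 4 5 6) (Split 3 4 (Fork 0 4 3 5)
(Cert [0,1] [(1,3,8),(0,5,6),(1,4,6),(0,3,4),(1,5,7)] [(0,3),(0,7),(1,3),(1,7),(1,8)]))))) (Split
4 7 (Split 6 7 (Fork 0 7 4 6) (Split 5 7 (Fork 0 7 4 5) (Split 4 6 (Fork 0 4 6 7) (Cert [0,1]
[(1,3,8),(0,4,5),(1,5,7),(0,6,7),(1,4,6)] [(0,3),(0,5),(1,3),(1,5),(1,8)])))) (Split 5 6 (Split 6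
7 (Fork 0 6 5 7) (Split 3 5 (Fork 0 5 3 6) (Cert [0,1] [(1,3,8),(1,4,5),(0,4,7),(0,3,5),(1,6,7)]
[(0,3),(1,3),(1,8),(4,6),(5,7)]))) (Split 6 7 (Split 3 7 (Fork 0 7 3 6) (Cert [0,1]
[(1,5,6),(1,4,7),(0,4,5),(1,3,8),(0,3,7)] [(0,3),(1,3),(1,8),(4,6),(5,7)])) (Cert [0,1]
[(1,4,5),(0,4,7),(0,5,6),(1,3,8),(1,6,7)] [(0,3),(1,3),(1,8),(4,6),(5,7)]))))))))))) (Split 1 8
(Unsorted 1 8) (Split 1 7 (Split 1 6 (Split 1 5 (Low 1 3) (Split 1 4 (Unsorted 1 4) (Split 2 9
(Split 2 8 (Split 2 7 (Low 2 3) (Split 2 6 (Unsorted 2 6) (Split 2 5 (Low 2 3) (Split 2 4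
(Unsorted 2 4) (Split 3 5 (Split 5 8 (Fork 1 5 3 8) (Split 5 6 (Fork 0 5 3 6) (Split 4 5 (Fork 0 5
3 4) (Split 3 9 (Fork 1 3 5 9) (Split 3 6 (Fork 0 3 5 6) (Split 3 4 (Fork 0 3 4 5) (Cert [0,1,2]
[(1,3,9),(2,5,6),(2,3,4),(1,5,8),(0,3,6),(0,4,5)] [(0,3),(0,7),(1,8),(1,9),(2,7),(4,6)])))))))
(Split 3 6 (Split 5 6 (Fork 0 6 3 5) (Split 4 6 (Fork 0 6 3 4) (Split 3 7 (Fork 0 3 6 7) (Split 3
4 (Fork 0 3 4 6) (Cert [0,1,2] [(0,3,5),(1,3,4),(2,5,6),(2,3,7),(0,4,6)]
[(0,7),(1,8),(1,9),(2,7),(4,5)]))))) (Split 5 7 (Split 4 7 (Fork 0 7 4 5) (Split 4 5 (Fork 0 5 4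
7) (Split 3 7 (Fork 0 7 3 5) (Cert [0,1,2] [(2,3,6),(1,3,5),(0,4,5),(2,4,7),(0,3,7)]
[(0,6),(1,8),(1,9),(2,6),(3,4)])))) (Split 6 7 (Split 5 6 (Fork 0 6 5 7) (Split 3 7 (Fork 0 7 3 6)
(Cert [0,1,2] [(2,5,7),(2,3,6),(1,3,5),(0,5,6),(0,3,7)] [(0,4),(1,4),(1,8),(1,9),(2,4)]))) (Cert
[0,2] [(2,6,7),(0,3,6),(2,3,5),(0,5,7)] [(0,4),(2,4),(3,7),(5,6)]))))))))) (Split 2 7 (Split 2 6
(Low 2 3) (Split 2 5 (Low 2 3) (Split 2 4 (Unsorted 2 4) (Split 3 5 (Split 5 8 (Fork 1 5 3 8)
(Split 5 7 (Fork 0 5 3 7) (Split 4 5 (Fork 0 5 3 4) (Split 3 8 (Fork 1 3 5 8) (Split 3 6 (Fork 0 3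
5 6) (Split 3 4 (Fork 0 3 4 5) (Cert [0,1,2] [(2,5,8),(0,3,6),(1,4,5),(0,5,7),(1,3,8),(2,3,4)]
[(0,3),(0,4),(0,6),(1,9),(2,6),(4,8)]))))))) (Split 3 4 (Split 4 8 (Fork 1 4 3 8) (Split 4 7 (Fork
0 4 3 7) (Split 4 5 (Fork 0 4 3 5) (Split 3 8 (Fork 1 3 4 8) (Split 3 6 (Fork 0 3 4 6) (Cert
[0,1,2] [(1,3,5),(2,4,5),(1,4,8),(0,3,6),(0,4,7),(2,3,8)]
[(0,3),(0,5),(0,6),(1,9),(2,6),(5,8)])))))) (Split 4 8 (Split 6 8 (Fork 2 8 4 6) (Split 5 8 (Fork
1 8 4 5) (Split 4 5 (Fork 1 4 5 8) (Cert [0,1,2] [(1,3,4),(2,3,5),(0,4,5),(2,6,8),(1,5,8)]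
[(0,6),(0,7),(1,9),(2,6),(3,8)])))) (Split 5 8 (Split 8 9 (Fork 1 8 5 9) (Split 4 5 (Fork 1 5 4 8)
(Cert [0,1,2] [(1,3,4),(2,3,5),(2,4,8),(1,8,9),(0,4,5)] [(0,6),(0,7),(1,9),(2,6),(3,8)]))) (Cert
[1,2] [(1,3,5),(2,5,8),(2,3,4),(1,4,8)] [(1,9),(2,6),(3,8),(4,5)])))))))) (Split 2 6 (Unsorted 2
6) (Split 2 5 (Split 2 4 Excl (Split 3 4 (Split 4 7 (Fork 0 4 3 7) (Split 4 6 (Fork 0 4 3 6)
(Split 4 5 (Fork 0 4 3 5) (Split 3 9 (Fork 1 3 4 9) (Split 3 7 (Fork 0 3 4 7) (Split 3 6 (Fork 0 3
4 6) (Cert [0,1,2] [(2,4,6),(1,4,5),(1,3,9),(0,3,6),(0,4,7),(2,3,7)]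
[(0,5),(1,3),(1,8),(1,9),(2,8),(6,7)]))))))) (Split 3 7 (Split 5 7 (Fork 0 7 3 5) (Split 4 7 (Fork
0 7 3 4) (Split 3 6 (Fork 0 3 6 7) (Cert [0,2] [(0,3,4),(0,5,7),(2,3,6),(2,4,7)]
[(0,5),(0,6),(2,6),(2,8)])))) (Split 4 6 (Split 6 8 (Fork 2 6 4 8) (Split 6 7 (Fork 0 6 4 7) (Cert
[0,2] [(2,3,7),(0,3,4),(2,6,8),(0,6,7)] [(0,5),(2,8),(3,6),(4,7)]))) (Split 6 7 (Split 4 7 (Fork 0
7 4 6) (Split 3 6 (Fork 0 6 3 7) (Cert [0,1,2] [(2,4,6),(1,3,4),(2,3,7),(0,4,7),(0,3,6)]
[(0,5),(1,5),(1,8),(1,9),(2,8)]))) (Cert [0,2] [(0,3,7),(2,3,4),(2,6,7),(0,4,6)]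
[(0,5),(2,8),(3,6),(4,7)])))))) (Split 2 4 (Unsorted 2 4) (Split 3 4 (Split 4 7 (Fork 0 4 3 7)
(Split 4 6 (Fork 0 4 3 6) (Split 4 5 (Fork 0 4 3 5) (Split 3 8 (Fork 1 3 4 8) (Split 3 6 (Fork 0 3
4 6) (Split 3 5 (Fork 0 3 4 5) (Cert [0,1,2] [(0,3,5),(2,4,7),(0,4,6),(1,3,8),(2,3,6),(1,4,5)]
[(0,7),(1,8),(1,9),(2,7),(2,8),(5,6)]))))))) (Split 3 8 (Split 5 8 (Fork 1 8 3 5) (Split 4 8 (Fork
1 8 3 4) (Split 3 5 (Fork 1 3 5 8) (Cert [1,2] [(2,3,4),(1,3,5),(2,5,8),(1,4,8)]
[(1,9),(2,6),(2,7),(4,5)])))) (Split 4 5 (Split 5 9 (Fork 1 5 4 9) (Split 5 7 (Fork 0 5 4 7)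
(Split 5 6 (Fork 0 5 4 6) (Split 4 7 (Fork 0 4 5 7) (Split 4 6 (Fork 0 4 5 6) (Cert [0,1,2]
[(1,3,4),(2,3,8),(0,4,6),(0,5,7),(2,5,6),(1,5,9),(2,4,7)]
[(0,3),(1,3),(1,4),(1,8),(2,3),(2,8),(6,7)])))))) (Split 5 8 (Split 7 8 (Fork 2 8 5 7) (Split 5 6
(Fork 2 5 6 8) (Split 3 5 (Fork 1 5 3 8) (Cert [0,1,2]
[(1,4,5),(0,3,4),(1,3,8),(2,7,8),(2,3,5),(0,5,6)] [(0,6),(0,7),(1,9),(2,6),(2,7),(4,8)])))) (Split
6 7 (Split 5 7 (Fork 0 7 5 6) (Split 5 6 (Fork 0 6 5 7) (Split 4 7 (Fork 0 7 4 6) (Split 4 6 (Fork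
0 6 4 7) (Cert [0,1,2] [(2,3,8),(1,4,5),(0,4,6),(2,5,6),(2,4,7),(0,5,7)]
[(0,3),(1,3),(1,8),(1,9),(2,3),(2,8)]))))) (Cert [1,2] [(1,5,8),(2,6,7),(1,3,4),(2,4,5),(2,3,8)]
[(1,9),(2,6),(2,7),(3,5),(4,8)]))))))))))) (Split 2 8 (Unsorted 2 8) (Split 2 7 (Split 2 6 (Split
2 5 (Low 2 3) (Split 2 4 (Unsorted 2 4) (Split 3 4 (Split 4 9 (Fork 1 4 3 9) (Split 4 8 (Fork 1 4
3 8) (Split 4 5 (Fork 0 4 3 5) (Split 3 8 (Fork 1 3 4 8) (Split 3 7 (Fork 0 3 4 7) (Split 3 5
(Fork 0 3 4 5) (Cert [0,1,2] [(1,4,9),(2,4,8),(2,3,5),(0,3,7),(0,4,5),(1,3,8)]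
[(0,3),(0,6),(0,7),(1,9),(2,9),(5,8)]))))))) (Split 3 5 (Split 5 9 (Fork 1 5 3 9) (Split 5 6 (Fork
0 5 3 6) (Split 4 5 (Fork 0 5 3 4) (Split 3 9 (Fork 1 3 5 9) (Split 3 7 (Fork 0 3 5 7) (Cert
[0,1,2] [(1,3,4),(2,4,5),(0,3,7),(0,5,6),(2,3,9),(1,5,9)]
[(0,3),(0,4),(0,7),(1,8),(2,8),(4,9)])))))) (Split 4 9 (Split 8 9 (Fork 1 9 4 8) (Split 5 9 (Fork
1 9 4 5) (Split 4 5 (Fork 1 4 5 9) (Cert [0,1,2] [(1,3,4),(0,3,5),(1,5,9),(2,8,9),(2,4,5)]
[(0,6),(0,7),(1,8),(2,8),(3,9)])))) (Split 5 9 (Split 4 5 (Fork 1 5 4 9) (Split 3 9 (Fork 1 9 3 5)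
(Cert [0,1,2] [(1,3,5),(0,3,4),(1,4,9),(2,4,5),(2,3,9)] [(0,3),(0,6),(0,7),(1,8),(2,8)]))) (Cert
[1,2] [(2,3,4),(1,4,9),(1,3,5),(2,5,9)] [(1,8),(2,8),(3,9),(4,5)]))))))) (Split 2 5 (Split 2 4
Excl (Split 3 4 (Split 4 9 (Fork 1 4 3 9) (Split 4 8 (Fork 1 4 3 8) (Split 4 5 (Fork 0 4 3 5)
(Split 3 8 (Fork 1 3 4 8) (Split 3 7 (Fork 0 3 4 7) (Split 3 5 (Fork 0 3 4 5) (Cert [0,1,2]
[(1,3,5),(0,3,7),(2,4,9),(0,4,5),(1,4,8),(2,3,8)] [(0,6),(0,7),(1,5),(1,9),(2,6),(2,9)])))))))
(Split 3 9 (Split 8 9 (Fork 1 9 3 8) (Split 6 9 (Fork 2 9 3 6) (Split 3 8 (Fork 1 3 8 9) (Cert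
[1,2] [(1,3,4),(2,3,8),(2,6,9),(1,8,9)] [(1,4),(1,5),(2,4),(2,6)])))) (Split 4 8 (Split 8 9 (Fork
1 8 4 9) (Split 4 5 (Fork 1 4 5 8) (Cert [1,2] [(2,3,4),(1,3,9),(1,4,5),(2,8,9)]
[(1,5),(2,6),(3,8),(4,9)]))) (Split 8 9 (Split 4 9 (Fork 1 9 4 8) (Split 3 8 (Fork 1 8 3 9) (Cert
[0,1,2] [(2,3,9),(2,4,8),(0,3,4),(1,4,9),(1,3,8)] [(0,5),(0,6),(0,7),(1,5),(2,6)]))) (Cert [1,2]
[(2,3,9),(1,8,9),(1,3,4),(2,4,8)] [(1,5),(2,6),(3,8),(4,9)])))))) (Split 2 4 (Unsorted 2 4) (Split
3 4 (Split 4 9 (Fork 1 4 3 9) (Split 4 6 (Fork 0 4 3 6) (Split 4 5 (Fork 0 4 3 5) (Split 3 8 (Fork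
1 3 4 8) (Split 3 6 (Fork 0 3 4 6) (Split 3 5 (Fork 0 3 4 5) (Cert [0,1,2]
[(2,4,9),(1,4,5),(2,3,6),(1,3,8),(0,3,5),(0,4,6)] [(0,7),(1,8),(1,9),(2,8),(2,9),(5,6)])))))))
(Split 3 9 (Split 8 9 (Fork 1 9 3 8) (Split 4 9 (Fork 1 9 3 4) (Split 3 8 (Fork 1 3 8 9) (Cert
[1,2] [(1,3,4),(2,3,8),(1,8,9),(2,4,9)] [(1,5),(2,5),(2,6),(4,8)])))) (Split 4 5 (Split 5 8 (Fork
1 5 4 8) (Split 5 6 (Fork 0 5 4 6) (Split 4 6 (Fork 0 4 5 6) (Split 3 5 (Fork 0 5 3 4) (Cert
[0,1,2] [(1,3,9),(2,3,4),(0,3,5),(0,4,6),(2,5,6),(1,5,8)]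
[(0,7),(1,8),(1,9),(2,8),(2,9),(3,6)]))))) (Split 5 9 (Split 6 9 (Fork 2 9 5 6) (Split 5 8 (Fork 1
5 8 9) (Split 4 9 (Fork 1 9 4 5) (Split 3 5 (Fork 1 5 3 9) (Cert [0,1,2]
[(0,4,5),(2,3,4),(2,6,9),(1,3,5),(2,5,8),(1,4,9)] [(0,6),(0,7),(1,8),(2,6),(2,8),(3,9)])))))
(Split 6 8 (Split 5 6 (Fork 2 6 5 8) (Split 4 6 (Fork 2 6 4 8) (Split 3 8 (Fork 2 8 3 6) (Cert
[0,1,2] [(1,4,5),(0,3,4),(2,5,9),(1,3,9),(2,4,6),(0,5,6),(2,3,8)]
[(0,3),(0,7),(1,8),(2,6),(2,8),(3,5),(4,9)])))) (Cert [1,2]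
[(2,3,4),(1,4,5),(1,3,9),(2,5,9),(2,6,8)] [(1,8),(2,6),(2,8),(3,5),(4,9)]))))))))) (Split 2 6
(Unsorted 2 6) (Split 2 5 (Split 2 4 Excl (Split 3 8 (Split 8 9 (Fork 1 8 3 9) (Split 4 8 (Fork 1
8 3 4) (Split 3 9 (Fork 1 3 8 9) (Split 3 4 (Fork 1 3 4 8) (Cert [1,2]
[(1,4,8),(2,3,4),(2,8,9),(1,3,9)] [(1,5),(2,6),(2,7),(4,9)]))))) (Split 3 4 (Split 4 9 (Fork 1 4 3
9) (Split 4 8 (Fork 1 4 3 8) (Split 3 9 (Fork 1 3 4 9) (Cert [1,2]
[(2,3,8),(1,4,8),(1,3,9),(2,4,9)] [(1,5),(2,6),(2,7),(8,9)])))) (Split 4 9 (Split 8 9 (Fork 1 9 4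
8) (Split 7 9 (Fork 2 9 4 7) (Split 4 6 (Fork 2 4 6 9) (Cert [1,2]
[(2,3,8),(1,3,4),(2,4,6),(1,8,9),(2,7,9)] [(1,5),(2,6),(2,7),(3,9),(4,8)])))) (Split 6 7 (Split 6
9 (Fork 2 6 7 9) (Split 5 7 (Fork 0 7 5 6) (Split 4 7 (Fork 0 7 4 6) (Split 4 6 (Fork 0 6 4 7)
(Cert [0,2] [(2,3,8),(2,4,7),(0,5,7),(2,6,9),(0,4,6)] [(0,3),(0,5),(2,3),(2,8),(2,9)]))))) (Split
8 9 (Split 4 8 (Fork 1 8 4 9) (Split 3 9 (Fork 1 9 3 8) (Cert [0,1,2]
[(1,4,9),(0,3,4),(0,6,7),(1,3,8),(2,4,8),(2,3,9)] [(0,3),(0,4),(0,5),(1,5),(2,6),(2,7)]))) (Cert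
[1,2] [(1,3,4),(2,4,9),(2,3,8),(2,6,7),(1,8,9)] [(1,5),(2,6),(2,7),(3,9),(4,8)]))))))) (Split 2 4
(Split 3 4 (Split 3 5 (Split 3 6 (Split 3 7 (Bare 0 3) (Unsorted 2 4)) (Unsorted 2 4)) (Unsorted 2
4)) (Unsorted 2 4)) (Full 2))))))))) (Split 1 5 (Unsorted 1 5) (Split 1 4 (Unsorted 1 4) (Split 3
5 (Split 5 6 (Fork 0 5 3 6) (Split 4 5 (Fork 0 5 3 4) (Split 3 6 (Fork 0 3 5 6) (Split 3 4 (Fork 0
3 4 5) (Cert [0,1] [(1,5,6),(1,3,4),(0,4,5),(0,3,6)] [(0,7),(1,8),(1,9),(4,6)]))))) (Split 3 6
(Split 5 6 (Fork 0 6 3 5) (Split 4 6 (Fork 0 6 3 4) (Split 3 4 (Fork 0 3 4 6) (Cert [0,1]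
[(1,3,5),(1,4,6),(0,5,6),(0,3,4)] [(0,7),(1,8),(1,9),(4,5)])))) (Split 4 5 (Split 5 6 (Fork 0 5 4
6) (Split 4 6 (Fork 0 4 5 6) (Split 3 4 (Fork 0 4 3 5) (Cert [0,1]
[(1,3,5),(0,5,6),(1,4,6),(0,3,4)] [(0,7),(1,8),(1,9),(3,6)])))) (Split 4 6 (Split 5 6 (Fork 0 6 4
5) (Split 3 4 (Fork 0 4 3 6) (Cert [0,1] [(1,4,5),(1,3,6),(0,3,4),(0,5,6)]
[(0,7),(1,8),(1,9),(3,5)]))) (Split 8 9 (Split 2 9 (Split 2 8 (Split 2 7 (Low 2 3) (Split 2 6 (Low
2 3) (Split 2 5 (Unsorted 2 5) (Split 2 4 (Unsorted 2 4) (Split 6 9 (Fork 1 9 6 8) (Split 4 8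
(Fork 1 8 4 9) (Cert [0,1,2] [(1,3,5),(2,4,5),(2,3,6),(0,4,6),(1,6,9),(1,4,8)]
[(0,7),(1,8),(1,9),(2,7),(3,4),(5,6)]))))))) (Split 2 7 (Split 2 6 (Low 2 3) (Split 2 5 (Unsorted
2 5) (Split 2 4 (Unsorted 2 4) (Split 6 8 (Fork 1 8 6 9) (Split 3 9 (Fork 1 9 3 8) (Cert [0,1,2]
[(2,3,5),(1,4,5),(0,3,6),(2,4,6),(1,6,8),(1,3,9)] [(0,7),(1,8),(1,9),(2,8),(3,4),(5,6)]))))))
(Split 2 6 (Split 2 5 (Low 2 3) (Split 2 4 (Unsorted 2 4) (Split 5 9 (Fork 1 9 5 8) (Split 4 8
(Fork 1 8 4 9) (Split 3 8 (Fork 1 8 3 9) (Cert [0,1,2]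
[(2,4,5),(0,3,5),(0,4,6),(1,3,6),(1,5,9),(1,4,8),(2,3,8)]
[(0,5),(0,7),(1,6),(1,9),(2,7),(3,4),(5,8)])))))) (Split 2 5 (Unsorted 2 5) (Split 2 4 (Unsorted 2
4) (Split 6 8 (Fork 1 8 6 9) (Split 5 8 (Fork 1 8 5 9) (Split 4 9 (Fork 1 9 4 8) (Cert [0,1,2]
[(1,3,5),(0,3,6),(2,4,6),(0,4,5),(1,6,8),(2,5,8),(1,4,9)]
[(0,7),(1,8),(1,9),(2,7),(2,8),(3,4),(5,6)]))))))))) (Split 2 8 (Unsorted 2 8) (Split 2 7 (Split 2
6 (Split 2 5 (Low 2 3) (Split 2 4 (Unsorted 2 4) (Split 5 8 (Fork 1 8 5 9) (Split 4 8 (Fork 1 8 4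
9) (Split 3 9 (Fork 1 9 3 8) (Cert [0,1,2]
[(2,3,5),(1,4,6),(0,4,5),(0,3,6),(1,3,9),(2,4,8),(1,5,8)]
[(0,5),(0,7),(1,6),(1,9),(2,9),(3,4),(3,8)])))))) (Split 2 5 (Unsorted 2 5) (Split 2 4 (Unsorted 2
4) (Split 6 9 (Fork 1 9 6 8) (Split 5 9 (Fork 1 9 5 8) (Split 4 8 (Fork 1 8 4 9) (Cert [0,1,2]
[(1,4,6),(0,3,6),(0,4,5),(2,3,5),(1,5,9),(2,6,9),(2,4,8)]
[(0,7),(1,8),(1,9),(2,8),(2,9),(3,4),(5,6)]))))))) (Split 2 6 (Split 2 5 (Split 2 4 (Low 2 3)
(Split 6 8 (Fork 1 8 6 9) (Split 4 9 (Fork 1 9 4 8) (Split 4 8 (Fork 1 8 4 9) (Split 3 9 (Fork 1 9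
3 8) (Cert [0,1,2] [(1,3,5),(0,4,5),(0,3,6),(2,4,8),(1,4,9),(2,3,9),(1,6,8)]
[(0,6),(0,7),(1,5),(1,6),(2,7),(3,4),(3,8)])))))) (Split 2 4 (Unsorted 2 4) (Split 7 8 (Fork 2 8 7
9) (Split 5 8 (Fork 1 8 5 9) (Split 4 9 (Fork 1 9 4 8) (Split 3 9 (Fork 1 9 3 8) (Cert [0,1,2]
[(0,3,6),(1,4,6),(2,3,5),(0,4,5),(2,4,9),(1,5,8),(2,7,8),(1,3,9)]
[(0,5),(0,7),(1,6),(1,8),(2,7),(2,8),(3,4),(5,9)]))))))) (Split 2 5 (Unsorted 2 5) (Split 2 4
(Split 3 4 (Split 3 7 (Split 3 8 (Split 3 9 (Split 4 7 (Split 4 8 (Split 4 9 (Split 5 6 (Split 5 7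
(Split 5 8 (Split 5 9 (Split 6 7 (Bare 0 7) (Unsorted 2 4)) (Unsorted 2 4)) (Unsorted 2 4))
(Unsorted 2 4)) (Unsorted 2 4)) (Unsorted 2 4)) (Unsorted 2 4)) (Unsorted 2 4)) (Unsorted 2 4))
(Unsorted 2 4)) (Unsorted 2 4)) (Unsorted 2 4)) (Full 2))))))) (Cert [0,1]
[(1,4,6),(1,8,9),(0,3,6),(1,3,5),(0,4,5)] [(0,7),(1,8),(1,9),(3,4),(5,6)]))))))))) (Split 1 6
(Unsorted 1 6) (Split 1 5 (Unsorted 1 5) (Split 1 4 (Split 2 4 (Split 2 5 (Split 2 6 (Split 2 7
(Split 2 8 (Split 2 9 (Bare 2 3) (Unsorted 1 4)) (Unsorted 1 4)) (Unsorted 1 4)) (Unsorted 1 4))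
(Unsorted 1 4)) (Unsorted 1 4)) (Full 1))))))))))) (Split 0 7 (Unsorted 0 7) (Split 0 6 (Unsorted
0 6) (Split 0 5 (Unsorted 0 5) (Split 0 4 (Unsorted 0 4) (Split 1 9 (Split 1 8 (Split 1 7 (Low 1
3) (Split 1 6 (Unsorted 1 6) (Split 1 5 (Unsorted 1 5) (Split 1 4 (Unsorted 1 4) (Split 3 5 (Split
5 7 (Fork 0 5 3 7) (Split 4 5 (Fork 0 5 3 4) (Split 3 7 (Fork 0 3 5 7) (Split 3 4 (Fork 0 3 4 5)
(Cert [0,1] [(1,3,7),(1,4,5),(0,3,4),(0,5,7)] [(0,6),(0,8),(1,6),(4,7)]))))) (Split 3 4 (Split 4 7
(Fork 0 4 3 7) (Split 4 5 (Fork 0 4 3 5) (Split 3 7 (Fork 0 3 4 7) (Cert [0,1]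
[(1,3,5),(0,4,5),(1,4,7),(0,3,7)] [(0,6),(0,8),(1,6),(5,7)])))) (Split 4 6 (Split 6 8 (Fork 0 6 4
8) (Split 6 7 (Fork 0 6 4 7) (Split 4 7 (Fork 0 4 6 7) (Cert [0,1]
[(0,3,5),(1,3,4),(1,6,7),(0,4,7),(0,6,8)] [(0,3),(0,5),(0,8),(1,3),(1,5)])))) (Split 5 6 (Split 4
5 (Fork 0 5 4 6) (Split 3 6 (Fork 0 6 3 5) (Cert [0,1] [(0,4,6),(0,3,5),(1,3,6),(1,4,5)]
[(0,7),(0,8),(1,7),(3,4)]))) (Split 7 8 (Split 5 7 (Fork 0 7 5 8) (Split 4 7 (Fork 0 7 4 8) (Split
3 8 (Fork 0 8 3 7) (Cert [0,1] [(1,4,6),(0,5,6),(0,4,7),(1,5,7),(0,3,8)]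
[(0,3),(0,8),(1,3),(4,5),(6,7)])))) (Cert [0,1] [(0,5,6),(1,3,5),(1,4,6),(0,7,8),(0,3,4)]
[(0,7),(0,8),(1,7),(3,6),(4,5)])))))))))) (Split 1 7 (Unsorted 1 7) (Split 1 6 (Unsorted 1 6)
(Split 1 5 (Unsorted 1 5) (Split 1 4 (Unsorted 1 4) (Split 2 9 (Split 2 8 (Split 2 7 (Low 2 3)
(Split 2 6 (Unsorted 2 6) (Split 2 5 (Unsorted 2 5) (Split 2 4 (Unsorted 2 4) (Split 3 8 (Split 4
6 (Split 7 8 (Fork 0 8 3 7) (Split 6 7 (Fork 0 6 4 7) (Split 5 6 (Fork 0 6 4 5) (Split 4 8 (Fork 0
4 6 8) (Split 4 5 (Fork 0 4 5 6) (Split 3 7 (Fork 0 3 7 8) (Split 3 6 (Fork 0 3 6 8) (Cert [0,1,2]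
[(2,5,6),(0,4,8),(2,3,7),(1,7,8),(1,3,6),(1,4,5),(0,6,7)]
[(0,3),(0,5),(1,5),(2,5),(3,4),(4,7),(6,8)])))))))) (Split 6 8 (Fork 0 8 3 6) (Split 5 8 (Fork 0 8
3 5) (Split 3 6 (Fork 0 3 6 8) (Split 3 5 (Fork 0 3 5 8) (Split 3 4 (Fork 0 3 4 8) (Cert [0,1,2]
[(2,4,6),(2,3,5),(1,3,4),(1,6,8),(0,3,6),(0,5,8)] [(0,7),(1,7),(2,7),(4,5),(4,8),(5,6)])))))))
(Split 4 5 (Split 5 8 (Fork 0 5 4 8) (Split 5 7 (Fork 0 5 4 7) (Split 5 6 (Fork 0 5 4 6) (Split 4
7 (Fork 0 4 5 7) (Split 4 6 (Fork 0 4 5 6) (Cert [0,1,2]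
[(0,3,8),(1,5,8),(1,4,7),(0,5,7),(2,5,6),(0,4,6)] [(0,3),(0,8),(1,3),(1,8),(2,3),(6,7)]))))))
(Split 4 7 (Split 5 7 (Fork 0 7 4 5) (Split 4 8 (Fork 0 4 7 8) (Split 3 7 (Fork 0 7 3 4) (Split 3
4 (Fork 0 4 3 7) (Cert [0,1,2] [(0,3,8),(0,4,5),(1,4,8),(2,5,7),(2,3,4),(1,3,7)]
[(0,6),(0,8),(1,6),(1,8),(2,6),(3,5)]))))) (Split 5 6 (Split 6 7 (Fork 0 6 5 7) (Split 3 6 (Fork 0
6 3 5) (Split 3 5 (Fork 0 5 3 6) (Cert [0,1,2] [(2,4,5),(0,4,7),(0,3,8),(1,6,7),(1,3,5),(2,3,6)]
[(0,8),(1,8),(3,4),(3,7),(4,6),(5,7)])))) (Split 6 7 (Split 3 7 (Fork 0 7 3 6) (Split 3 6 (Fork 0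
6 3 7) (Cert [0,1,2] [(0,3,8),(2,5,6),(1,4,7),(0,4,5),(2,3,7),(1,3,6)]
[(0,8),(1,8),(3,4),(3,5),(4,6),(5,7)]))) (Cert [1,2] [(2,5,6),(1,3,8),(1,6,7),(1,4,5),(2,4,7)]
[(1,3),(1,8),(2,3),(4,6),(5,7)])))))))))) (Split 2 7 (Unsorted 2 7) (Split 2 6 (Unsorted 2 6)
(Split 2 5 (Unsorted 2 5) (Split 2 4 (Unsorted 2 4) (Split 4 5 (Split 5 8 (Fork 0 5 4 8) (Split 5
7 (Fork 0 5 4 7) (Split 4 8 (Fork 0 4 5 8) (Split 4 7 (Fork 0 4 5 7) (Split 3 5 (Fork 0 5 3 4)
(Split 3 4 (Fork 0 4 3 5) (Cert [0,1,2] [(1,3,5),(2,3,4),(0,4,8),(0,5,7),(2,5,8),(1,4,7)]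
[(0,6),(1,6),(2,6),(3,7),(3,8),(7,8)]))))))) (Split 3 4 (Split 4 7 (Fork 0 4 3 7) (Split 4 6 (Fork
0 4 3 6) (Split 3 7 (Fork 0 3 4 7) (Split 3 6 (Fork 0 3 4 6) (Split 3 5 (Fork 0 3 4 5) (Cert
[0,1,2] [(2,4,5),(2,3,6),(0,4,6),(1,4,7),(0,3,7),(1,3,5)]
[(0,8),(1,8),(2,8),(5,6),(5,7),(6,7)])))))) (Split 3 5 (Split 5 8 (Fork 0 5 3 8) (Split 5 7 (Fork
0 5 3 7) (Split 3 8 (Fork 0 3 5 8) (Split 3 7 (Fork 0 3 5 7) (Cert [0,1,2]
[(1,4,5),(2,3,4),(0,3,7),(1,3,8),(2,5,7),(0,5,8)] [(0,6),(1,6),(2,6),(4,7),(4,8),(7,8)])))))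
(Split 3 7 (Split 7 8 (Fork 0 7 3 8) (Split 6 7 (Fork 0 7 3 6) (Split 4 7 (Fork 0 7 3 4) (Split 3
6 (Fork 0 3 6 7) (Cert [0,1,2] [(2,3,4),(0,3,5),(1,4,5),(1,3,6),(0,4,7),(1,7,8),(2,6,7)]
[(0,3),(0,8),(1,8),(2,8),(4,6),(5,6),(5,7)]))))) (Split 4 7 (Split 7 8 (Fork 0 7 4 8) (Split 6 7
(Fork 0 7 4 6) (Split 4 8 (Fork 0 4 7 8) (Split 4 6 (Fork 0 4 6 7) (Cert [0,1,2]
[(0,3,7),(2,4,5),(1,3,5),(1,4,6),(2,6,7),(0,4,8),(1,7,8)]
[(0,3),(0,5),(1,3),(1,5),(2,3),(2,5),(6,8)]))))) (Split 5 7 (Split 6 7 (Fork 0 7 5 6) (Cert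
[0,1,2] [(2,4,5),(2,3,7),(0,3,5),(1,3,4),(0,4,7),(1,6,7)] [(0,6),(0,8),(1,6),(1,8),(2,6),(2,8)]))
(Cert [0,1,2] [(1,5,7),(2,4,5),(2,3,7),(0,3,5),(0,4,7),(1,3,4)]
[(0,6),(0,8),(1,6),(1,8),(2,6),(2,8)])))))))))))) (Split 2 8 (Split 2 7 (Split 2 6 (Low 2 3)
(Split 2 5 (Unsorted 2 5) (Split 2 4 (Unsorted 2 4) (Split 3 4 (Split 4 7 (Fork 0 4 3 7) (Split 4
6 (Fork 0 4 3 6) (Split 4 5 (Fork 0 4 3 5) (Split 3 8 (Fork 0 3 4 8) (Split 3 6 (Fork 0 3 4 6)
(Split 3 5 (Fork 0 3 4 5) (Cert [0,1,2] [(2,4,5),(1,3,5),(1,4,6),(0,4,7),(0,3,8),(2,3,6)]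
[(0,7),(0,8),(1,7),(1,8),(2,9),(5,6)]))))))) (Split 3 5 (Split 5 7 (Fork 0 5 3 7) (Split 5 6 (Fork
0 5 3 6) (Split 4 5 (Fork 0 5 3 4) (Split 3 9 (Fork 2 3 5 9) (Split 3 6 (Fork 0 3 5 6) (Cert
[0,1,2] [(0,3,4),(1,4,5),(2,5,6),(1,3,6),(0,5,7),(2,3,9)]
[(0,7),(0,8),(1,7),(1,8),(2,9),(4,6)])))))) (Split 4 6 (Split 6 9 (Fork 2 6 4 9) (Split 6 7 (Fork
0 6 4 7) (Split 4 5 (Fork 0 4 5 6) (Split 3 6 (Fork 0 6 3 4) (Cert [0,1,2]
[(0,3,4),(2,3,5),(1,4,5),(0,6,7),(1,3,6),(2,6,9)] [(0,7),(0,8),(1,7),(1,8),(2,9),(5,6)])))))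
(Split 5 6 (Split 6 8 (Fork 0 6 5 8) (Split 6 7 (Fork 0 6 5 7) (Split 5 9 (Fork 2 5 6 9) (Split 5
7 (Fork 0 5 6 7) (Cert [0,1,2] [(0,3,4),(2,4,6),(1,3,5),(0,6,8),(0,5,7),(1,6,7),(2,5,9)]
[(0,7),(0,8),(1,7),(1,8),(2,9),(3,6),(4,5)]))))) (Split 7 8 (Split 6 7 (Fork 0 7 6 8) (Split 5 8
(Fork 0 8 5 7) (Split 4 8 (Fork 0 8 4 7) (Cert [0,1,2]
[(0,5,6),(1,3,4),(2,3,5),(2,4,6),(1,6,7),(0,4,8),(1,5,8)]
[(0,7),(0,8),(1,7),(1,8),(2,9),(3,6),(4,5)])))) (Cert [1,2]
[(2,4,6),(1,5,6),(1,3,4),(1,7,8),(2,3,5)] [(1,7),(1,8),(2,9),(3,6),(4,5)]))))))))) (Split 2 6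
(Unsorted 2 6) (Split 2 5 (Unsorted 2 5) (Split 2 4 (Unsorted 2 4) (Split 3 5 (Split 5 7 (Fork 0 5
3 7) (Split 5 6 (Fork 0 5 3 6) (Split 4 5 (Fork 0 5 3 4) (Split 3 7 (Fork 0 3 5 7) (Split 3 6
(Fork 0 3 5 6) (Split 3 4 (Fork 0 3 4 5) (Cert [0,1,2]
[(2,4,5),(0,3,4),(2,3,6),(1,5,6),(0,5,7),(1,3,7)] [(0,8),(1,8),(2,9),(4,6),(4,7),(6,7)])))))))
(Split 3 4 (Split 4 7 (Fork 0 4 3 7) (Split 4 6 (Fork 0 4 3 6) (Split 4 5 (Fork 0 4 3 5) (Split 3
7 (Fork 0 3 4 7) (Split 3 6 (Fork 0 3 4 6) (Cert [0,1,2]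
[(2,3,5),(2,4,7),(0,3,6),(1,4,6),(1,3,7),(0,4,5)] [(0,8),(1,8),(2,9),(5,6),(5,7),(6,7)]))))))
(Split 3 6 (Split 6 7 (Fork 0 6 3 7) (Split 5 6 (Fork 0 6 3 5) (Split 4 6 (Fork 0 6 3 4) (Split 3
7 (Fork 0 3 6 7) (Cert [0,1,2] [(2,3,5),(1,3,4),(0,5,6),(2,4,6),(0,3,7),(1,6,7)]
[(0,8),(1,8),(2,9),(4,5),(4,7),(5,7)]))))) (Split 4 5 (Split 5 7 (Fork 0 5 4 7) (Split 5 6 (Fork 0
5 4 6) (Split 4 7 (Fork 0 4 5 7) (Cert [0,1,2] [(1,3,4),(0,3,6),(2,3,5),(0,5,7),(2,4,7),(1,5,6)]
[(0,8),(1,8),(2,9),(3,7),(4,6),(6,7)])))) (Split 4 6 (Split 5 6 (Fork 0 6 4 5) (Split 4 7 (Fork 0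
4 6 7) (Cert [0,1,2] [(2,4,5),(2,3,6),(0,3,5),(1,3,4),(1,5,6),(0,4,7)]
[(0,7),(0,8),(1,7),(1,8),(2,7),(2,9)]))) (Split 5 6 (Split 6 7 (Fork 0 6 5 7) (Split 5 7 (Fork 0 5
6 7) (Cert [0,1,2] [(0,3,6),(1,4,6),(2,4,5),(1,3,5),(2,6,7),(0,5,7)]
[(0,8),(1,8),(2,9),(3,4),(3,7),(4,7)]))) (Cert [0,1,2]
[(0,4,6),(2,4,5),(2,3,6),(1,3,4),(1,5,6),(0,3,5)] [(0,7),(0,8),(1,7),(1,8),(2,7),(2,9)])))))))))))
(Split 2 7 (Unsorted 2 7) (Split 2 6 (Unsorted 2 6) (Split 2 5 (Unsorted 2 5) (Split 2 4 (Split 3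
4 (Split 3 5 (Split 3 6 (Split 3 7 (Split 3 8 (Bare 0 3) (Unsorted 2 4)) (Unsorted 2 4)) (Unsorted
2 4)) (Unsorted 2 4)) (Unsorted 2 4)) (Full 2)))))))))))) (Split 1 8 (Split 1 7 (Split 1 6 (Low 1
3) (Split 1 5 (Unsorted 1 5) (Split 1 4 (Unsorted 1 4) (Split 3 4 (Split 4 6 (Fork 0 4 3 6) (Split
4 5 (Fork 0 4 3 5) (Split 3 6 (Fork 0 3 4 6) (Split 3 5 (Fork 0 3 4 5) (Cert [0,1]
[(1,3,5),(0,3,6),(1,4,6),(0,4,5)] [(0,7),(0,8),(1,9),(5,6)]))))) (Split 3 5 (Split 5 6 (Fork 0 5 3
6) (Split 4 5 (Fork 0 5 3 4) (Split 3 6 (Fork 0 3 5 6) (Cert [0,1]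
[(0,3,4),(1,3,6),(1,4,5),(0,5,6)] [(0,7),(0,8),(1,9),(4,6)])))) (Split 4 6 (Split 6 7 (Fork 0 6 4
7) (Split 5 6 (Fork 0 6 4 5) (Split 4 8 (Fork 0 4 6 8) (Cert [0,1]
[(1,3,4),(0,3,5),(1,5,6),(0,4,8),(0,6,7)] [(0,7),(0,8),(1,9),(3,6),(4,5)])))) (Split 5 6 (Split 6
7 (Fork 0 6 5 7) (Split 5 8 (Fork 0 5 6 8) (Cert [0,1] [(0,3,4),(1,3,5),(1,4,6),(0,6,7),(0,5,8)]
[(0,7),(0,8),(1,9),(3,6),(4,5)]))) (Split 7 8 (Split 2 9 (Split 2 8 (Split 2 7 (Low 2 3) (Split 2
6 (Low 2 3) (Split 2 5 (Unsorted 2 5) (Split 2 4 (Unsorted 2 4) (Split 6 8 (Fork 0 8 6 7) (Split 3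
7 (Fork 0 7 3 8) (Cert [0,1,2] [(0,3,4),(1,4,6),(2,5,6),(1,3,5),(0,6,8),(2,3,7)]
[(0,7),(0,8),(1,9),(2,7),(3,6),(4,5)]))))))) (Split 2 7 (Unsorted 2 7) (Split 2 6 (Split 2 5 (Low
2 3) (Split 2 4 (Unsorted 2 4) (Split 6 7 (Fork 0 7 6 8) (Split 5 8 (Fork 0 8 5 7) (Split 4 7
(Fork 0 7 4 8) (Split 3 8 (Fork 0 8 3 7) (Cert [0,1,2]
[(0,3,4),(1,3,5),(1,4,6),(2,3,8),(0,6,7),(0,5,8),(2,4,7)]
[(0,6),(0,7),(1,6),(1,9),(2,7),(4,5),(4,8)]))))))) (Split 2 5 (Unsorted 2 5) (Split 2 4 (Unsorted
2 4) (Split 6 7 (Fork 0 7 6 8) (Split 5 7 (Fork 0 7 5 8) (Split 4 8 (Fork 0 8 4 7) (Cert [0,1,2]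
[(1,5,6),(1,3,4),(2,4,6),(0,3,5),(0,4,8),(2,5,7),(0,6,7)]
[(0,7),(0,8),(1,9),(2,7),(2,8),(3,6),(4,5)]))))))))) (Split 2 8 (Split 2 7 (Split 2 6 (Low 2 3)
(Split 2 5 (Unsorted 2 5) (Split 2 4 (Unsorted 2 4) (Split 6 7 (Fork 0 7 6 8) (Split 5 8 (Fork 0 8
5 7) (Cert [0,1,2] [(1,4,6),(0,3,4),(1,3,5),(2,5,6),(0,5,8),(0,6,7)]
[(0,7),(0,8),(1,9),(2,9),(3,6),(4,5)])))))) (Split 2 6 (Split 2 5 (Low 2 3) (Split 2 4 (Unsorted 2
4) (Split 5 7 (Fork 0 7 5 8) (Split 4 8 (Fork 0 8 4 7) (Split 3 7 (Fork 0 7 3 8) (Cert [0,1,2]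
[(0,5,6),(1,3,5),(1,4,6),(2,3,4),(0,4,8),(2,5,7),(0,3,7)]
[(0,6),(0,8),(1,3),(1,9),(2,9),(4,5),(4,7)])))))) (Split 2 5 (Unsorted 2 5) (Split 2 4 (Unsorted 2
4) (Split 6 7 (Fork 0 7 6 8) (Split 4 8 (Fork 0 8 4 7) (Split 3 7 (Fork 0 7 3 8) (Cert [0,1,2]
[(1,5,6),(2,4,6),(1,3,4),(0,3,5),(0,6,7),(2,3,7),(0,4,8)]
[(0,7),(0,8),(1,9),(2,7),(2,9),(3,6),(4,5)])))))))) (Split 2 7 (Unsorted 2 7) (Split 2 6 (Split 2
5 (Split 2 4 (Low 2 3) (Split 5 7 (Fork 0 7 5 8) (Split 4 8 (Fork 0 8 4 7) (Split 3 8 (Fork 0 8 3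
7) (Split 3 7 (Fork 0 7 3 8) (Cert [0,1,2]
[(1,5,6),(0,4,6),(1,3,4),(2,3,7),(0,3,8),(0,5,7),(2,4,8)]
[(0,5),(0,6),(1,3),(1,4),(1,9),(2,9),(4,7)])))))) (Split 2 4 (Unsorted 2 4) (Split 8 9 (Fork 2 8 7
9) (Split 5 7 (Fork 0 7 5 8) (Split 4 7 (Fork 0 7 4 8) (Split 3 8 (Fork 0 8 3 7) (Cert [0,1,2]
[(0,4,6),(1,5,6),(2,3,5),(1,3,4),(0,3,8),(2,4,7),(2,8,9),(0,5,7)]
[(0,6),(0,8),(1,3),(1,9),(2,8),(2,9),(3,7),(4,5)]))))))) (Split 2 5 (Unsorted 2 5) (Split 2 4
(Split 3 6 (Split 3 7 (Split 3 8 (Split 3 9 (Split 4 5 (Split 4 7 (Split 4 8 (Split 4 9 (Split 5 7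
(Split 5 8 (Split 5 9 (Split 6 7 (Bare 0 7) (Unsorted 2 4)) (Unsorted 2 4)) (Unsorted 2 4))
(Unsorted 2 4)) (Unsorted 2 4)) (Unsorted 2 4)) (Unsorted 2 4)) (Unsorted 2 4)) (Unsorted 2 4))
(Unsorted 2 4)) (Unsorted 2 4)) (Unsorted 2 4)) (Full 2))))))) (Cert [0,1]
[(0,3,5),(1,3,4),(0,7,8),(1,5,6),(0,4,6)] [(0,7),(0,8),(1,9),(3,6),(4,5)]))))))))) (Split 1 6
(Unsorted 1 6) (Split 1 5 (Unsorted 1 5) (Split 1 4 (Unsorted 1 4) (Split 3 5 (Split 7 9 (Split 6
9 (Fork 1 9 6 7) (Split 5 7 (Fork 0 5 3 7) (Split 4 5 (Fork 0 5 3 4) (Split 3 7 (Fork 0 3 5 7)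
(Split 3 4 (Fork 0 3 4 5) (Cert [0,1] [(0,5,7),(1,6,9),(1,4,5),(0,3,4),(1,3,7)]
[(0,6),(0,8),(1,6),(1,9),(4,7)])))))) (Split 5 6 (Fork 0 5 3 6) (Split 4 5 (Fork 0 5 3 4) (Split 3
6 (Fork 0 3 5 6) (Split 3 4 (Fork 0 3 4 5) (Cert [0,1] [(1,7,9),(0,4,5),(1,3,4),(1,5,6),(0,3,6)]
[(0,7),(0,8),(1,7),(1,9),(4,6)])))))) (Split 3 4 (Split 7 9 (Split 6 7 (Fork 1 7 6 9) (Split 5 9
(Fork 1 9 5 7) (Split 4 8 (Fork 0 4 3 8) (Split 4 7 (Fork 0 4 3 7) (Split 3 6 (Fork 0 3 4 6) (Cert
[0,1] [(0,3,5),(1,5,9),(1,4,7),(0,4,8),(1,3,6),(0,6,7)]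
[(0,5),(0,8),(1,5),(1,9),(3,7),(4,6)])))))) (Split 4 6 (Fork 0 4 3 6) (Split 4 5 (Fork 0 4 3 5)
(Split 3 6 (Fork 0 3 4 6) (Cert [0,1] [(1,7,9),(0,3,5),(0,4,6),(1,3,6),(1,4,5)]
[(0,7),(0,8),(1,7),(1,9),(5,6)]))))) (Split 4 7 (Split 6 8 (Split 7 9 (Fork 1 7 4 9) (Split 6 7
(Fork 0 6 7 8) (Split 5 8 (Fork 0 8 5 6) (Split 4 6 (Fork 0 4 6 7) (Cert [0,1]
[(0,3,4),(1,3,5),(0,5,8),(0,6,7),(1,4,6),(1,7,9)] [(0,3),(0,5),(0,8),(1,3),(1,5),(1,9)])))))
(Split 7 9 (Fork 1 7 4 9) (Split 5 7 (Fork 0 7 4 5) (Split 4 6 (Fork 0 4 6 7) (Cert [0,1]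
[(1,3,5),(0,3,4),(0,6,8),(1,7,9),(0,5,7),(1,4,6)] [(0,6),(0,8),(1,6),(1,9),(3,7),(4,5)])))))
(Split 5 7 (Split 6 9 (Split 6 7 (Fork 0 7 5 6) (Split 5 9 (Fork 1 5 7 9) (Split 5 8 (Fork 0 5 7
8) (Split 3 6 (Fork 1 6 3 9) (Cert [0,1] [(0,4,7),(1,3,4),(0,3,6),(1,5,9),(1,6,7),(0,5,8)]
[(0,5),(0,8),(1,5),(1,9),(3,7),(4,6)]))))) (Split 4 5 (Fork 0 5 4 7) (Split 3 7 (Fork 0 7 3 5)
(Cert [0,1] [(0,4,7),(1,6,9),(0,3,5),(1,3,7),(1,4,5)] [(0,6),(0,8),(1,6),(1,9),(3,4)])))) (Split 6
8 (Split 5 9 (Split 7 9 (Fork 1 9 5 7) (Split 7 8 (Fork 0 8 6 7) (Split 5 6 (Fork 0 6 5 8) (Split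
4 6 (Fork 0 6 4 8) (Cert [0,1] [(0,3,4),(1,3,5),(0,5,6),(1,4,6),(0,7,8),(1,7,9)]
[(0,7),(0,8),(1,7),(1,9),(3,6),(4,5)]))))) (Split 6 7 (Fork 0 6 7 8) (Split 5 8 (Fork 0 8 5 6)
(Split 3 6 (Fork 0 6 3 8) (Cert [0,1] [(0,4,7),(1,3,4),(1,5,9),(0,3,6),(0,5,8),(1,6,7)]
[(0,5),(0,8),(1,5),(1,9),(3,7),(4,6)]))))) (Split 6 9 (Split 3 8 (Split 6 7 (Fork 1 6 7 9) (Split
4 9 (Fork 1 9 4 6) (Split 4 8 (Fork 0 8 3 4) (Split 3 6 (Fork 0 3 6 8) (Cert [0,1]
[(1,3,5),(0,5,7),(0,3,6),(1,4,9),(1,6,7),(0,4,8)] [(0,4),(0,8),(1,4),(1,9),(3,7),(5,6)])))))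
(Split 5 6 (Fork 1 6 5 9) (Split 4 6 (Fork 1 6 4 9) (Split 3 9 (Fork 1 9 3 6) (Cert [0,1]
[(1,4,7),(0,5,7),(0,3,8),(1,3,9),(1,5,6),(0,4,6)] [(0,3),(0,8),(1,3),(1,9),(4,5),(6,7)]))))) (Cert
[0,1] [(1,6,9),(1,3,4),(0,3,5),(1,5,7),(0,4,7),(0,6,8)]
[(0,6),(0,8),(1,6),(1,9),(3,7),(4,5)]))))))))))) (Split 1 7 (Unsorted 1 7) (Split 1 6 (Unsorted 1
6) (Split 1 5 (Unsorted 1 5) (Split 1 4 (Split 2 4 (Split 2 5 (Split 2 6 (Split 2 7 (Split 2 8
(Split 2 9 (Bare 2 3) (Unsorted 1 4)) (Unsorted 1 4)) (Unsorted 1 4)) (Unsorted 1 4)) (Unsorted 1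
4)) (Unsorted 1 4)) (Full 1)))))))))))) (Split 0 8 (Unsorted 0 8) (Split 0 7 (Unsorted 0 7) (Split
0 6 (Unsorted 0 6) (Split 0 5 (Unsorted 0 5) (Split 0 4 (Split 1 4 (Split 1 5 (Split 1 6 (Split 1
7 (Split 1 8 (Split 1 9 (Bare 1 3) (Unsorted 0 4)) (Unsorted 0 4)) (Unsorted 0 4)) (Unsorted 0 4))
(Unsorted 0 4)) (Unsorted 0 4)) (Full 0))))))"

text \<open>Labels 0 to 2 are the pendants, label 3 is \<open>w\<close>, and labels 4 to 9 are the
  rest of the bag. Since label 3 is not closed, \<open>w\<close> may have further pendants.
  \<open>excl\<close> sets aside one configuration: if the pendants miss three disjoint pairs, then
  after sorting these are \<open>{8, 9}\<close>, \<open>{6, 7}\<close> and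
  \<open>{4, 5}\<close>.\<close>

lemma pendants3_refutes:
  "refutes (Frame 10 [0,1,2] [0,1,2] [0,1,2] 4 [(0,8),(0,9),(1,6),(1,7),(2,4),(2,5)] True)
     [(0,3),(1,3),(2,3)]
     [(0,1),(0,2),(1,2)] pendants3_refutation"
  by code_simp

definition pendant3_refutation :: refutation where
  "pendant3_refutation =
Split 3 4 (Split 4 8 (Fork 1 4 3 8) (Split 4 5 (Fork 0 4 3 5) (Split 3 6 (Fork 0 3 4 6) (Split 3 5
(Fork 0 3 4 5) (Cert [0,1] [(0,3,6),(1,4,8),(1,3,5),(0,4,5)] [(0,6),(0,7),(1,8),(1,9)]))))) (Split
3 5 (Split 5 7 (Fork 0 5 3 7) (Split 4 5 (Fork 0 5 3 4) (Split 3 9 (Fork 1 3 5 9) (Cert [0,1]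
[(0,3,4),(1,4,5),(0,5,7),(1,3,9)] [(0,6),(0,7),(1,8),(1,9)])))) (Split 3 6 (Split 6 9 (Fork 2 6 3
9) (Split 6 7 (Fork 0 6 3 7) (Split 3 7 (Fork 0 3 6 7) (Cert [0,2]
[(0,3,5),(2,6,9),(0,6,7),(2,3,7)] [(0,4),(0,5),(2,8),(2,9)])))) (Split 3 7 (Split 7 8 (Fork 2 7 3
8) (Split 6 7 (Fork 0 7 3 6) (Cert [0,2] [(2,3,6),(0,3,4),(2,7,8),(0,6,7)]
[(0,4),(0,5),(2,8),(2,9)]))) (Split 3 9 (Split 8 9 (Fork 1 9 3 8) (Split 4 9 (Fork 1 9 3 4) (Split
3 8 (Fork 1 3 8 9) (Cert [1,2] [(2,3,6),(1,3,8),(1,4,9),(2,8,9)] [(1,4),(1,5),(2,6),(2,7)]))))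
(Split 4 8 (Split 8 9 (Fork 1 8 4 9) (Split 5 8 (Fork 1 8 4 5) (Split 4 5 (Fork 1 4 5 8) (Split 3
8 (Fork 1 8 3 4) (Cert [1,2,3] [(0,3,7),(2,3,6),(1,3,9),(1,4,5),(2,8,9),(3,5,8)]
[(1,9),(2,6),(2,7),(3,4),(3,5),(3,6),(3,8),(3,9)]))))) (Split 4 9 (Split 8 9 (Fork 1 9 4 8) (Split
4 5 (Fork 1 4 5 9) (Cert [1,2,3] [(2,3,6),(0,3,7),(1,3,9),(1,4,8),(3,4,5),(2,8,9)]
[(1,5),(2,6),(2,7),(3,4),(3,5),(3,6),(3,8),(3,9)]))) (Split 8 9 (Split 6 8 (Fork 2 8 6 9) (Split 5
9 (Fork 1 9 5 8) (Split 5 8 (Fork 1 8 5 9) (Split 3 8 (Fork 1 8 3 9) (Cert [0,1,2,3]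
[(1,4,8),(3,4,9),(2,3,7),(0,3,6),(1,5,9),(2,6,8),(3,5,8)]
[(0,4),(0,5),(1,3),(2,8),(2,9),(3,6),(3,7),(4,5),(6,7)]))))) (Cert [1,2,3]
[(2,8,9),(0,3,6),(1,4,8),(3,4,9),(2,3,7),(1,3,5)]
[(1,5),(2,6),(2,7),(3,4),(3,5),(3,7),(3,8),(3,9)]))))))))"

text \<open>This is the configuration set aside before, now with \<open>w\<close> closed. All pairs
  between the pendants and the bag are fixed, so the tree splits only on pairs inside the bag, and
  \<open>keys\<close> is empty because the labels have their places already.\<close>

lemma pendant3_refutes:
  "refutes (Frame 10 [0,1,2,3] [0,1,2] [] 4 [] True)
     [(0,3),(1,3),(2,3),(0,4),(0,5),(0,6),(0,7),(1,4),(1,5),(1,8),(1,9),(2,6),(2,7),(2,8),(2,9)]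
     [(0,1),(0,2),(1,2),(0,8),(0,9),(1,6),(1,7),(2,4),(2,5)] pendant3_refutation"
  by code_simp

section \<open>Degrees, links and pendants in irreducible graphs\<close>

context irreducible_graph
begin

lemma degree_ge_5:
  assumes "nbrs E v \<noteq> {}"
  shows "5 \<le> card (nbrs E v)"
proof (rule ccontr)
  assume "\<not> 5 \<le> card (nbrs E v)"
  obtain xs where xs: "distinct xs" "set xs = nbrs E v"
    using finite_distinct_list[OF finite_nbrs] by blast
  have "length xs \<le> 4"
    using \<open>\<not> 5 \<le> card (nbrs E v)\<close> xs distinct_card by fastforce
  \<comment> \<open>As \<open>v\<close> is not isolated, label 1 names a vertex, as the tree
    presupposes.\<close>
  obtain y ys where y: "xs = y # ys" using xs assms by (cases xs) auto
  have "labelling (Frame 5 [0] [] [] 5 [] False) (v # xs)"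
    using xs \<open>length xs \<le> 4\<close> nbrs_irrefl by (auto simp: labelling_def)
  moreover have "adj (v # xs) 0 1"
    using xs(2) y by (auto simp: adj_def nbrs_def)
  ultimately show False using refutes_sound[OF _ degree_refutes, of "v # xs"] by simp
qed

lemma small_degree_link_matched:
  assumes "card (nbrs E v) \<le> 6"
  shows "link_matched E v"
proof (rule ccontr)
  assume "\<not> link_matched E v"
  then obtain a b c where abc: "a \<in> nbrs E v" "b \<in> nbrs E v" "c \<in> nbrs E v"
    "a \<noteq> b" "a \<noteq> c" "b \<noteq> c" "{a, b} \<notin> E" "{a, c} \<notin> E"
    unfolding link_matched_def by blast
  obtain xs where xs: "distinct xs" "set xs = nbrs E v - {a, b, c}"
    using finite_distinct_list[of "nbrs E v - {a, b, c}"] finite_nbrs by blast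
  have "card (nbrs E v - {a, b, c}) = card (nbrs E v) - card {a, b, c}"
    using abc by (intro card_Diff_subset) auto
  then have "length xs \<le> 3" using xs abc assms distinct_card[OF xs(1)] by simp
  let ?vs = "v # a # b # c # xs"
  have "labelling (Frame 7 [0] [] [] 7 [] False) ?vs"
    using xs abc \<open>length xs \<le> 3\<close> nbrs_irrefl by (auto simp: labelling_def)
  moreover have "adj ?vs 0 1" "adj ?vs 0 2" "adj ?vs 0 3" "\<not> adj ?vs 1 2" "\<not> adj ?vs 1 3"
    using abc by (auto simp: adj_def nbrs_def)
  ultimately show False using refutes_sound[OF _ fork_refutes, of ?vs] by simp
qed

text \<open>This provides the sorting clause of \<open>labelling\<close> when the key vertices
  belong to a fixed prefix \<open>ps\<close> and only the vertices of \<open>R\<close> may be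
  permuted.\<close>

lemma sorted_labels:
  assumes "finite R" and ks: "\<forall>k\<in>set ks. k < length ps"
  obtains xs where "distinct xs" "set xs = R"
    "\<And>i k. length ps \<le> i \<Longrightarrow> k < length ks \<Longrightarrow>
      (\<forall>q<k. adj (ps @ xs) (ks ! q) i \<longleftrightarrow> adj (ps @ xs) (ks ! q) (Suc i)) \<Longrightarrow>
      adj (ps @ xs) (ks ! k) (Suc i) \<Longrightarrow> adj (ps @ xs) (ks ! k) i"
proof -
  obtain ys where ys: "distinct ys" "set ys = R"
    using finite_distinct_list[OF assms(1)] by blast
  \<comment> \<open>The key records non-adjacency: as \<open>False < True\<close>, the ascending
    lexicographic order puts adjacent vertices first.\<close>
  define key where "key x = map (\<lambda>k. {ps ! k, x} \<notin> E) ks" for x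
  define xs where "xs = sort_key key ys"
  have srt: "sorted (map key xs)" by (simp add: xs_def)
  have adj_xs: "adj (ps @ xs) (ks ! q) (length ps + m) \<longleftrightarrow> \<not> key (xs ! m) ! q"
    if "q < length ks" "m < length xs" for q m
  proof -
    have "ks ! q < length ps" using ks that by simp
    then show ?thesis using that by (simp add: adj_def key_def nth_append)
  qed
  have mono: "adj (ps @ xs) (ks ! k) i"
    if i: "length ps \<le> i" and k: "k < length ks"
      and same: "\<forall>q<k. adj (ps @ xs) (ks ! q) i \<longleftrightarrow> adj (ps @ xs) (ks ! q) (Suc i)"
      and nxt: "adj (ps @ xs) (ks ! k) (Suc i)" for i k
  proof (rule ccontr)
    assume not: "\<not> adj (ps @ xs) (ks ! k) i"
    obtain m where m: "i = length ps + m" using i le_Suc_ex by blast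
    have ml: "Suc m < length xs" using nxt m by (auto simp: adj_def)
    let ?a = "key (xs ! m)" and ?b = "key (xs ! Suc m)"
    have len: "length ?a = length ks" "length ?b = length ks" by (simp_all add: key_def)
    have "?a ! q = ?b ! q" if "q < k" for q
      using same that adj_xs[of q m] adj_xs[of q "Suc m"] k ml m by auto
    then have "take k ?a = take k ?b" using len k by (simp add: nth_take_lemma)
    moreover have "?a ! k" "\<not> ?b ! k"
      using not nxt adj_xs[of k m] adj_xs[of k "Suc m"] k ml m by auto
    \<comment> \<open>The keys agree before position \<open>k\<close>, and there the later one has
      \<open>False\<close> against \<open>True\<close>; this contradicts the ascending
      order.\<close>
    ultimately have "?b < ?a"
      unfolding list_less_def lexord_take_index_conv using len k by auto
    moreover have "?a \<le> ?b" using sorted_nth_mono[OF srt, of m "Suc m"] ml by simp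
    ultimately show False by simp
  qed
  have "distinct xs" "set xs = R" using ys by (simp_all add: xs_def)
  then show thesis using that mono by blast
qed

text \<open>\<open>degree_ge_5\<close> and \<open>small_degree_link_matched\<close> hold at every
  vertex, so the \<open>linked\<close> clause is settled here once for all later frames.\<close>

lemma linked_labelling:
  assumes "distinct (ps @ xs)" "length ps = b" "length (ps @ xs) \<le> n"
    and "\<And>i. i \<in> set cs \<Longrightarrow> i < length (ps @ xs) \<Longrightarrow> nbrs E ((ps @ xs) ! i) \<subseteq> set (ps @ xs)"
    and "\<And>i. i \<in> set ss \<Longrightarrow> i < length (ps @ xs) \<Longrightarrow> card (nbrs E ((ps @ xs) ! i)) \<le> 6"
    and "\<And>i k. length ps \<le> i \<Longrightarrow> k < length ks \<Longrightarrow>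
      (\<forall>q<k. adj (ps @ xs) (ks ! q) i \<longleftrightarrow> adj (ps @ xs) (ks ! q) (Suc i)) \<Longrightarrow>
      adj (ps @ xs) (ks ! k) (Suc i) \<Longrightarrow> adj (ps @ xs) (ks ! k) i"
    and "ex \<noteq> [] \<Longrightarrow> \<exists>(i, j)\<in>set ex. adj (ps @ xs) i j"
  shows "labelling (Frame n cs ss ks b ex True) (ps @ xs)"
  unfolding labelling_def frame.sel
  using assms degree_ge_5 small_degree_link_matched by blast

text \<open>\<open>d\<close> need not lie outside the bag: besides a pendant at \<open>w\<close>,
  the lemma will be applied to two adjacent private vertices of one bag, with \<open>R\<close> the
  rest of that bag.\<close>

lemma no_single_pendant:
  assumes R: "finite R" "card R \<le> 6" "w \<notin> R" "d \<notin> R"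
    and wd: "d \<in> nbrs E w" and d: "card (nbrs E d) \<le> 6"
    and w_nbrs: "nbrs E w \<subseteq> insert d R" and d_nbrs: "nbrs E d \<subseteq> insert w R"
  shows False
proof -
  let ?ps = "[w, d]"
  obtain xs where xs: "distinct xs" "set xs = R" and
    srt: "\<And>i k. length ?ps \<le> i \<Longrightarrow> k < length [1, 0] \<Longrightarrow>
      (\<forall>q<k. adj (?ps @ xs) ([1, 0] ! q) i \<longleftrightarrow> adj (?ps @ xs) ([1, 0] ! q) (Suc i)) \<Longrightarrow>
      adj (?ps @ xs) ([1, 0] ! k) (Suc i) \<Longrightarrow> adj (?ps @ xs) ([1, 0] ! k) i"
    by (rule sorted_labels[OF R(1), of "[1, 0]" ?ps]) auto
  have "w \<noteq> d" using wd nbrs_irrefl by auto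
  then have dist: "distinct (?ps @ xs)" using xs R by auto
  have "length xs \<le> 6" using xs R distinct_card by fastforce
  have "labelling (Frame 8 [0, 1] [1] [1, 0] 2 [] True) (?ps @ xs)"
  proof (rule linked_labelling[OF dist _ _ _ _ srt])
    show "length (?ps @ xs) \<le> 8" using \<open>length xs \<le> 6\<close> by simp
    show "nbrs E ((?ps @ xs) ! i) \<subseteq> set (?ps @ xs)" if "i \<in> set [0, 1]" for i
      using that w_nbrs d_nbrs xs by auto
    show "card (nbrs E ((?ps @ xs) ! i)) \<le> 6" if "i \<in> set [1]" for i
      using that d by simp
  qed auto
  moreover have "adj (?ps @ xs) 0 1" using wd by (simp add: adj_def nbrs_def)
  ultimately show False
    using refutes_sound[OF _ pendant1_refutes, of "?ps @ xs"] by simp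
qed

lemma no_two_pendants:
  assumes R: "finite R" "card R \<le> 6" "w \<notin> R" "d1 \<notin> R" "d2 \<notin> R" and ne: "d1 \<noteq> d2"
    and wd: "d1 \<in> nbrs E w" "d2 \<in> nbrs E w"
    and d: "card (nbrs E d1) \<le> 6" "card (nbrs E d2) \<le> 6"
    and w_nbrs: "nbrs E w \<subseteq> {d1, d2} \<union> R"
    and d_nbrs: "nbrs E d1 \<subseteq> insert w R" "nbrs E d2 \<subseteq> insert w R"
  shows False
proof -
  let ?ps = "[d1, d2, w]"
  obtain xs where xs: "distinct xs" "set xs = R" and
    srt: "\<And>i k. length ?ps \<le> i \<Longrightarrow> k < length [0, 1] \<Longrightarrow>
      (\<forall>q<k. adj (?ps @ xs) ([0, 1] ! q) i \<longleftrightarrow> adj (?ps @ xs) ([0, 1] ! q) (Suc i)) \<Longrightarrow>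
      adj (?ps @ xs) ([0, 1] ! k) (Suc i) \<Longrightarrow> adj (?ps @ xs) ([0, 1] ! k) i"
    by (rule sorted_labels[OF R(1), of "[0, 1]" ?ps]) auto
  have dw: "d1 \<noteq> w" "d2 \<noteq> w" using wd nbrs_irrefl by auto
  then have dist: "distinct (?ps @ xs)" using xs R ne by auto
  have "length xs \<le> 6" using xs R distinct_card by fastforce
  have "labelling (Frame 9 [0, 1, 2] [0, 1] [0, 1] 3 [] True) (?ps @ xs)"
  proof (rule linked_labelling[OF dist _ _ _ _ srt])
    show "length (?ps @ xs) \<le> 9" using \<open>length xs \<le> 6\<close> by simp
    show "nbrs E ((?ps @ xs) ! i) \<subseteq> set (?ps @ xs)" if "i \<in> set [0, 1, 2]" for i
      using that w_nbrs d_nbrs xs by auto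
    show "card (nbrs E ((?ps @ xs) ! i)) \<le> 6" if "i \<in> set [0, 1]" for i
      using that d by auto
  qed auto
  moreover have "adj (?ps @ xs) 0 2" "adj (?ps @ xs) 1 2"
    using wd by (simp_all add: adj_def nbrs_def insert_commute)
  \<comment> \<open>All neighbours of a pendant lie in the bag, so two pendants are never
    adjacent.\<close>
  moreover have "\<not> adj (?ps @ xs) 0 1"
    using d_nbrs dw R by (auto simp: adj_def nbrs_def)
  ultimately show False
    using refutes_sound[OF _ pendant2_refutes, of "?ps @ xs"] by simp
qed

text \<open>Nothing is assumed about the other neighbours of \<open>w\<close>, so this applies to
  any three of a larger number of pendants. It describes the only configuration that the tree does
  not refute.\<close>

lemma three_pendants:
  assumes R: "finite R" "card R \<le> 6" "w \<notin> R" "d1 \<notin> R" "d2 \<notin> R" "d3 \<notin> R"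
    and ne: "d1 \<noteq> d2" "d1 \<noteq> d3" "d2 \<noteq> d3"
    and wd: "d1 \<in> nbrs E w" "d2 \<in> nbrs E w" "d3 \<in> nbrs E w"
    and d: "card (nbrs E d1) \<le> 6" "card (nbrs E d2) \<le> 6" "card (nbrs E d3) \<le> 6"
    and d_nbrs: "nbrs E d1 \<subseteq> insert w R" "nbrs E d2 \<subseteq> insert w R" "nbrs E d3 \<subseteq> insert w R"
  obtains xs where "distinct ([d1, d2, d3, w] @ xs)" "set xs = R"
    "\<forall>(i, j)\<in>set [(0, 3), (1, 3), (2, 3), (0, 4), (0, 5), (0, 6), (0, 7), (1, 4), (1, 5), (1, 8),
       (1, 9), (2, 6), (2, 7), (2, 8), (2, 9)]. adj ([d1, d2, d3, w] @ xs) i j"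
    "\<forall>(i, j)\<in>set [(0, 1), (0, 2), (1, 2), (0, 8), (0, 9), (1, 6), (1, 7), (2, 4), (2, 5)].
       \<not> adj ([d1, d2, d3, w] @ xs) i j"
proof -
  let ?ps = "[d1, d2, d3, w]"
  obtain xs where xs: "distinct xs" "set xs = R" and
    srt: "\<And>i k. length ?ps \<le> i \<Longrightarrow> k < length [0, 1, 2] \<Longrightarrow>
      (\<forall>q<k. adj (?ps @ xs) ([0, 1, 2] ! q) i \<longleftrightarrow> adj (?ps @ xs) ([0, 1, 2] ! q) (Suc i)) \<Longrightarrow>
      adj (?ps @ xs) ([0, 1, 2] ! k) (Suc i) \<Longrightarrow> adj (?ps @ xs) ([0, 1, 2] ! k) i"
    by (rule sorted_labels[OF R(1), of "[0, 1, 2]" ?ps]) auto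
  let ?vs = "?ps @ xs"
  have dw: "d1 \<noteq> w" "d2 \<noteq> w" "d3 \<noteq> w" using wd nbrs_irrefl by auto
  then have dist: "distinct ?vs" using xs R ne by auto
  have len: "length ?vs \<le> 10" using xs R distinct_card by fastforce
  let ?A = "[(0, 8), (0, 9), (1, 6), (1, 7), (2, 4), (2, 5)]"
  \<comment> \<open>The same list serves two frames: a nonempty \<open>excl\<close> yields the six
    absent pairs, an empty one the pairs that must be present.\<close>
  have lab: "labelling (Frame 10 [0, 1, 2] [0, 1, 2] [0, 1, 2] 4 ex True) ?vs"
    if "ex \<noteq> [] \<Longrightarrow> \<exists>(i, j)\<in>set ex. adj ?vs i j" for ex
  proof (rule linked_labelling[OF dist _ len _ _ srt that])
    show "nbrs E (?vs ! i) \<subseteq> set ?vs" if "i \<in> set [0, 1, 2]" for i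
      using that d_nbrs xs by auto
    show "card (nbrs E (?vs ! i)) \<le> 6" if "i \<in> set [0, 1, 2]" for i
      using that d by auto
  qed auto
  have w: "adj ?vs 0 3" "adj ?vs 1 3" "adj ?vs 2 3"
    using wd by (simp_all add: adj_def nbrs_def insert_commute)
  have dd: "\<not> adj ?vs 0 1" "\<not> adj ?vs 0 2" "\<not> adj ?vs 1 2"
    using d_nbrs dw R by (auto simp: adj_def nbrs_def)
  have A: "\<forall>(i, j)\<in>set ?A. \<not> adj ?vs i j"
  proof (rule ccontr)
    assume "\<not> (\<forall>(i, j)\<in>set ?A. \<not> adj ?vs i j)"
    then have "\<exists>(i, j)\<in>set ?A. adj ?vs i j" by blast
    then show False using refutes_sound[OF lab pendants3_refutes] w dd by simp
  qed
  let ?B = "[(0, 4), (0, 5), (0, 6), (0, 7), (1, 4), (1, 5), (1, 8), (1, 9), (2, 6), (2, 7), (2, 8), (2, 9)]"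
  have B: "adj ?vs i j" if "(i, j) \<in> set ?B" for i j
  proof (rule ccontr)
    assume not: "\<not> adj ?vs i j"
    let ?F = "Frame 10 [0, 1, 2] [0, 1, 2] [0, 1, 2] 4 [] True"
    \<comment> \<open>If one more pair were missing, pendant \<open>i\<close> would miss five of the
      nine other labels: two pendants, two labels from \<open>?A\<close>, and \<open>j\<close>. This
      leaves degree at most 4, so \<open>Low\<close> applies.\<close>
    have "list_all (\<lambda>(i, j). refutes ?F [(0, 3), (1, 3), (2, 3)]
      ((i, j) # (0, 1) # (0, 2) # (1, 2) # ?A) (Low i 3)) ?B"
      by code_simp
    then have ref: "refutes ?F [(0, 3), (1, 3), (2, 3)]
      ((i, j) # (0, 1) # (0, 2) # (1, 2) # ?A) (Low i 3)"
      using that unfolding list_all_iff by blast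
    have "labelling ?F ?vs" by (rule lab) simp
    moreover have "\<forall>(i, j)\<in>set [(0, 3), (1, 3), (2, 3)]. adj ?vs i j" using w by simp
    moreover have "\<forall>(i, j)\<in>set ((i, j) # (0, 1) # (0, 2) # (1, 2) # ?A). \<not> adj ?vs i j"
      using not dd A by simp
    ultimately show False using refutes_sound ref by blast
  qed
  show thesis
  proof (rule that[OF dist xs(2)])
    show "\<forall>(i, j)\<in>set [(0, 3), (1, 3), (2, 3), (0, 4), (0, 5), (0, 6), (0, 7), (1, 4), (1, 5), (1, 8),
       (1, 9), (2, 6), (2, 7), (2, 8), (2, 9)]. adj ?vs i j"
      using w B by simp
    show "\<forall>(i, j)\<in>set [(0, 1), (0, 2), (1, 2), (0, 8), (0, 9), (1, 6), (1, 7), (2, 4), (2, 5)].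
       \<not> adj ?vs i j"
      using dd A by simp
  qed
qed

text \<open>This frees the configuration from its labels, which depend on the three pendants chosen,
  so that different triples can be compared.\<close>

lemma three_pendants_non_nbrs:
  assumes "finite R" "card R \<le> 6" "w \<notin> R" "d1 \<notin> R" "d2 \<notin> R" "d3 \<notin> R"
    and "d1 \<noteq> d2" "d1 \<noteq> d3" "d2 \<noteq> d3"
    and "d1 \<in> nbrs E w" "d2 \<in> nbrs E w" "d3 \<in> nbrs E w"
    and "card (nbrs E d1) \<le> 6" "card (nbrs E d2) \<le> 6" "card (nbrs E d3) \<le> 6"
    and "nbrs E d1 \<subseteq> insert w R" "nbrs E d2 \<subseteq> insert w R" "nbrs E d3 \<subseteq> insert w R"
  shows "card (R - nbrs E d1) = 2" "(R - nbrs E d1) \<inter> (R - nbrs E d2) = {}"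
proof -
  obtain xs where dist: "distinct ([d1, d2, d3, w] @ xs)" and xs: "set xs = R"
    and pres: "\<forall>(i, j)\<in>set [(0, 3), (1, 3), (2, 3), (0, 4), (0, 5), (0, 6), (0, 7), (1, 4), (1, 5), (1, 8),
       (1, 9), (2, 6), (2, 7), (2, 8), (2, 9)]. adj ([d1, d2, d3, w] @ xs) i j"
    and abs: "\<forall>(i, j)\<in>set [(0, 1), (0, 2), (1, 2), (0, 8), (0, 9), (1, 6), (1, 7), (2, 4), (2, 5)].
       \<not> adj ([d1, d2, d3, w] @ xs) i j"
    using three_pendants[OF assms] by metis
  have "length xs \<le> 6" using xs dist assms(2) distinct_card[of xs] by auto
  \<comment> \<open>Label 9 occurs in a present pair, so all ten labels name vertices and
    \<open>R\<close> has exactly six elements.\<close>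
  moreover have "9 < length ([d1, d2, d3, w] @ xs)" using pres by (simp add: adj_def)
  ultimately have "length xs = 6" by simp
  then obtain x4 x5 x6 x7 x8 x9 where x: "xs = [x4, x5, x6, x7, x8, x9]"
    by (auto simp: numeral_eq_Suc length_Suc_conv)
  have R: "R = {x4, x5, x6, x7, x8, x9}" using xs x by simp
  have p: "{x4, x5, x6, x7} \<subseteq> nbrs E d1" "{x4, x5, x8, x9} \<subseteq> nbrs E d2"
    using pres by (simp_all add: x adj_def nbrs_def)
  have a: "x8 \<notin> nbrs E d1" "x9 \<notin> nbrs E d1"
    using abs by (simp_all add: x adj_def nbrs_def)
  have C1: "R - nbrs E d1 = {x8, x9}" using R p(1) a by blast
  show "card (R - nbrs E d1) = 2" using dist by (simp add: C1 x)
  show "(R - nbrs E d1) \<inter> (R - nbrs E d2) = {}" using C1 p(2) by blast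
qed

text \<open>Three pendants leave only the configuration of \<open>three_pendants\<close>; knowing
  all neighbours of \<open>w\<close> makes that one reducible too.\<close>

lemma no_three_pendants:
  assumes R: "finite R" "card R \<le> 6" "w \<notin> R" "d1 \<notin> R" "d2 \<notin> R" "d3 \<notin> R"
    and ne: "d1 \<noteq> d2" "d1 \<noteq> d3" "d2 \<noteq> d3"
    and wd: "d1 \<in> nbrs E w" "d2 \<in> nbrs E w" "d3 \<in> nbrs E w"
    and d: "card (nbrs E d1) \<le> 6" "card (nbrs E d2) \<le> 6" "card (nbrs E d3) \<le> 6"
    and d_nbrs: "nbrs E d1 \<subseteq> insert w R" "nbrs E d2 \<subseteq> insert w R" "nbrs E d3 \<subseteq> insert w R"
    and w_nbrs: "nbrs E w \<subseteq> {d1, d2, d3} \<union> R"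
  shows False
proof -
  let ?ps = "[d1, d2, d3, w]"
  obtain xs where dist: "distinct (?ps @ xs)" and xs: "set xs = R"
    and pres: "\<forall>(i, j)\<in>set [(0, 3), (1, 3), (2, 3), (0, 4), (0, 5), (0, 6), (0, 7), (1, 4), (1, 5), (1, 8),
       (1, 9), (2, 6), (2, 7), (2, 8), (2, 9)]. adj (?ps @ xs) i j"
    and abs: "\<forall>(i, j)\<in>set [(0, 1), (0, 2), (1, 2), (0, 8), (0, 9), (1, 6), (1, 7), (2, 4), (2, 5)].
       \<not> adj (?ps @ xs) i j"
    using three_pendants[OF R ne wd d d_nbrs] by metis
  have len: "length (?ps @ xs) \<le> 10" using xs dist R(2) distinct_card[of xs] by auto
  have "labelling (Frame 10 [0, 1, 2, 3] [0, 1, 2] [] 4 [] True) (?ps @ xs)"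
  proof (rule linked_labelling[OF dist _ len])
    show "nbrs E ((?ps @ xs) ! i) \<subseteq> set (?ps @ xs)" if "i \<in> set [0, 1, 2, 3]" for i
      using that w_nbrs d_nbrs xs by auto
    show "card (nbrs E ((?ps @ xs) ! i)) \<le> 6" if "i \<in> set [0, 1, 2]" for i
      using that d by auto
  qed auto
  then show False by (rule refutes_sound[OF _ pendant3_refutes pres abs])
qed

text \<open>One, two or three pendants adjacent to \<open>w\<close> are refuted by the trees. Among
  four, any three miss disjoint pairs, so together they would miss eight of the at most six bag
  vertices other than \<open>w\<close>.\<close>

lemma no_pendant_in_bag:
  assumes B: "finite B" "card B \<le> 7" and w: "w \<in> B" "nbrs E w \<subseteq> B \<union> D"
    and D: "\<And>d. d \<in> D \<Longrightarrow> d \<notin> B \<and> nbrs E d \<subseteq> B \<and> card (nbrs E d) \<le> 6"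
  shows "D \<inter> nbrs E w = {}"
proof (rule ccontr)
  assume ne: "D \<inter> nbrs E w \<noteq> {}"
  let ?D = "D \<inter> nbrs E w" and ?R = "B - {w}"
  have fin: "finite ?D" using finite_nbrs by blast
  have R: "finite ?R" "card ?R \<le> 6" "w \<notin> ?R" using B w by auto
  have ins: "insert w ?R = B" using w by blast
  have d: "d \<notin> ?R" "d \<in> nbrs E w" "card (nbrs E d) \<le> 6" "nbrs E d \<subseteq> insert w ?R" if "d \<in> ?D" for d
    using that D[of d] unfolding ins by auto
  have w': "nbrs E w \<subseteq> ?D \<union> ?R" using w nbrs_irrefl by auto
  consider "card ?D = 1" | "card ?D = 2" | "card ?D = 3" | "4 \<le> card ?D"
    using ne fin card_0_eq[of ?D] by linarith
  then show False
  proof cases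
    case 1
    then obtain d1 where D1: "?D = {d1}" by (rule card_1_singletonE)
    then have m: "d1 \<in> ?D" by blast
    show False
      using no_single_pendant[OF R d(1)[OF m] d(2)[OF m] d(3)[OF m] _ d(4)[OF m]] w'
      unfolding D1 by simp
  next
    case 2
    then obtain d1 d2 where D2: "?D = {d1, d2}" "d1 \<noteq> d2" by (meson card_2_iff)
    then have m: "d1 \<in> ?D" "d2 \<in> ?D" by blast+
    show False
      using no_two_pendants[OF R d(1)[OF m(1)] d(1)[OF m(2)] D2(2) d(2)[OF m(1)] d(2)[OF m(2)]
          d(3)[OF m(1)] d(3)[OF m(2)] _ d(4)[OF m(1)] d(4)[OF m(2)]] w'
      unfolding D2 by simp
  next
    case 3
    then obtain d1 d2 d3 where D3: "?D = {d1, d2, d3}" "d1 \<noteq> d2" "d1 \<noteq> d3" "d2 \<noteq> d3"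
      by (metis card_3_iff)
    then have m: "d1 \<in> ?D" "d2 \<in> ?D" "d3 \<in> ?D" by blast+
    show False
      using no_three_pendants[OF R d(1)[OF m(1)] d(1)[OF m(2)] d(1)[OF m(3)] D3(2-4)
          d(2)[OF m(1)] d(2)[OF m(2)] d(2)[OF m(3)] d(3)[OF m(1)] d(3)[OF m(2)] d(3)[OF m(3)]
          d(4)[OF m(1)] d(4)[OF m(2)] d(4)[OF m(3)]] w'
      unfolding D3 by simp
  next
    case 4
    then obtain D' where D': "D' \<subseteq> ?D" "card D' = 4" "finite D'"
      by (metis fin obtain_subset_with_card_n)
    have two: "card (?R - nbrs E x) = 2" and disj: "(?R - nbrs E x) \<inter> (?R - nbrs E y) = {}"
      if xy: "x \<in> D'" "y \<in> D'" "x \<noteq> y" for x y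
    proof -
      \<comment> \<open>The configuration concerns three pendants, so a third one is chosen next to
        \<open>x\<close> and \<open>y\<close>.\<close>
      have "card (D' - {x, y}) = 2" using D' xy by (simp add: card_Diff_subset)
      then have "D' - {x, y} \<noteq> {}" by (metis card.empty zero_neq_numeral)
      then obtain z where "z \<in> D' - {x, y}" by blast
      then have z: "z \<in> ?D" "x \<noteq> z" "y \<noteq> z" using D' by auto
      have m: "x \<in> ?D" "y \<in> ?D" using xy D' by auto
      note * = three_pendants_non_nbrs[OF R d(1)[OF m(1)] d(1)[OF m(2)] d(1)[OF z(1)] xy(3) z(2,3)
          d(2)[OF m(1)] d(2)[OF m(2)] d(2)[OF z(1)] d(3)[OF m(1)] d(3)[OF m(2)] d(3)[OF z(1)]
          d(4)[OF m(1)] d(4)[OF m(2)] d(4)[OF z(1)]]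
      show "card (?R - nbrs E x) = 2" "(?R - nbrs E x) \<inter> (?R - nbrs E y) = {}"
        using * by blast+
    qed
    have two': "card (?R - nbrs E x) = 2" if "x \<in> D'" for x
    proof -
      have "card (D' - {x}) = 3" using D' that by simp
      then have "D' - {x} \<noteq> {}" by (metis card.empty zero_neq_numeral)
      then obtain y where "y \<in> D' - {x}" by blast
      then show ?thesis using two[of x y] that by blast
    qed
    have "card (\<Union>x\<in>D'. ?R - nbrs E x) = (\<Sum>x\<in>D'. card (?R - nbrs E x))"
      using D'(3) R(1) disj by (intro card_UN_disjoint) auto
    also have "\<dots> = 8" using two' D'(2) by simp
    finally have "8 \<le> card ?R"
      using card_mono[OF R(1), of "\<Union>x\<in>D'. ?R - nbrs E x"] by auto
    then show False using R(2) by simp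
  qed
qed

text \<open>\<open>R\<close> stands for vertices private to the bag. Once their neighbours are
  confined to \<open>B\<close>, each has degree at most 6, so of two adjacent ones the first acts as
  a single pendant for the second.\<close>

lemma no_new_edges:
  assumes B: "finite B" "card B \<le> 7" and R: "R \<subseteq> B" "\<And>w. w \<in> R \<Longrightarrow> nbrs E w \<subseteq> B \<union> D"
    and D: "\<And>d. d \<in> D \<Longrightarrow> d \<notin> B \<and> nbrs E d \<subseteq> B \<and> card (nbrs E d) \<le> 6"
    and w: "w \<in> R"
  shows "nbrs E w \<subseteq> B - R"
proof -
  have sub: "nbrs E x \<subseteq> B" if "x \<in> R" for x
    using no_pendant_in_bag[OF B _ R(2)[OF that] D] that R by blast
  have False if x: "x \<in> R" "x \<in> nbrs E w" for x
  proof (rule no_single_pendant[of "B - {w, x}" w x])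
    have "w \<in> B" using w R by blast
    have "card (B - {w, x}) \<le> card (B - {w})" using B by (intro card_mono) auto
    then show "card (B - {w, x}) \<le> 6" using B \<open>w \<in> B\<close> by simp
    show "nbrs E x \<subseteq> insert w (B - {w, x})" using sub[OF x(1)] nbrs_irrefl by auto
    have "card (nbrs E x) \<le> card (B - {x})"
      using sub[OF x(1)] nbrs_irrefl B by (intro card_mono) auto
    then show "card (nbrs E x) \<le> 6" using B x R by auto
    show "nbrs E w \<subseteq> insert x (B - {w, x})" using sub[OF w] nbrs_irrefl by auto
  qed (use B x in auto)
  then show ?thesis using sub[OF w] by blast
qed

end

section \<open>Pruning a tree decomposition\<close>

lemma tree_leaf:
  assumes "is_tree I TE" "2 \<le> card I"
  obtains t p where "t \<in> I" "p \<in> I" "t \<noteq> p" "{t, p} \<in> TE" "\<And>e. e \<in> TE \<Longrightarrow> t \<in> e \<Longrightarrow> e = {t, p}"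
proof -
  have sg: "simple_graph I TE" and con: "connected_in TE I" and cd: "card TE + 1 = card I"
    using assms(1) by (auto simp: is_tree_def)
  have finI: "finite I" and finT: "finite TE"
    using sg simple_graph_finite by (auto simp: simple_graph_def)
  have edge: "e \<subseteq> I" "card e = 2" if "e \<in> TE" for e using sg that by (auto simp: simple_graph_def)
  \<comment> \<open>By the handshake count the degrees sum to \<open>2 * (card I - 1)\<close>, so
    some vertex has degree at most 1; connectedness then gives it an edge.\<close>
  have "(\<Sum>v\<in>I. card {e \<in> TE. v \<in> e}) = 2 * card TE"
  proof (rule sum_multicount[OF finI finT], rule ballI)
    fix e assume "e \<in> TE"
    then have "{v \<in> I. v \<in> e} = e" using edge by blast
    then show "card {v \<in> I. v \<in> e} = 2" using edge \<open>e \<in> TE\<close> by simp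
  qed
  then have "(\<Sum>v\<in>I. card {e \<in> TE. v \<in> e}) < (\<Sum>v\<in>I. 2)" using cd by simp
  then obtain t where t: "t \<in> I" "card {e \<in> TE. t \<in> e} < 2" by (meson not_le sum_mono)
  obtain x where x: "x \<in> I" "x \<noteq> t"
  proof -
    have "\<not> I \<subseteq> {t}" using assms(2) card_mono[of "{t}" I] by auto
    then show thesis using that by blast
  qed
  have "(t, x) \<in> {(u, v). u \<in> I \<and> v \<in> I \<and> {u, v} \<in> TE}\<^sup>*"
    using con t x by (simp add: connected_in_def)
  then obtain p where p: "p \<in> I" "{t, p} \<in> TE"
    using x by (auto elim: converse_rtranclE)
  have "t \<noteq> p" using edge(2)[OF p(2)] by auto
  moreover have "e = {t, p}" if "e \<in> TE" "t \<in> e" for e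
  proof (rule ccontr)
    assume "e \<noteq> {t, p}"
    then have "card {e, {t, p}} = 2" by simp
    moreover have "{e, {t, p}} \<subseteq> {e \<in> TE. t \<in> e}" using that p by blast
    ultimately have "2 \<le> card {e \<in> TE. t \<in> e}"
      using card_mono[of "{e \<in> TE. t \<in> e}" "{e, {t, p}}"] finT by simp
    then show False using t by simp
  qed
  ultimately show thesis using that t p by blast
qed

text \<open>A walk enters and leaves the leaf only through \<open>p\<close>, so visits to
  \<open>t\<close> can be cut out. The vertex \<open>x\<close> keeps \<open>S - {t}\<close>
  nonempty, and a walk from it to \<open>t\<close> has to pass through \<open>p\<close>.\<close>

lemma connected_in_remove_leaf:
  assumes con: "connected_in TE S" and x: "x \<in> S" "x \<noteq> t"
    and leaf: "\<And>e. e \<in> TE \<Longrightarrow> t \<in> e \<Longrightarrow> e = {t, p}" and tp: "t \<noteq> p"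
  shows "connected_in (TE - {{t, p}}) (S - {t})" "t \<in> S \<Longrightarrow> p \<in> S"
proof -
  let ?r = "{(u, v). u \<in> S \<and> v \<in> S \<and> {u, v} \<in> TE}"
  \<comment> \<open>While the walk stands at \<open>t\<close>, its shortened version waits at
    \<open>p\<close>; this is the second half of the invariant proved next.\<close>
  let ?r' = "{(u, v). u \<in> S - {t} \<and> v \<in> S - {t} \<and> {u, v} \<in> TE - {{t, p}}}"
  have path: "(z \<noteq> t \<longrightarrow> (y, z) \<in> ?r'\<^sup>*) \<and> (z = t \<longrightarrow> p \<in> S \<and> (y, p) \<in> ?r'\<^sup>*)"
    if "(y, z) \<in> ?r\<^sup>*" "y \<noteq> t" for y z
    using that(1)
  proof (induction rule: rtrancl_induct)
    case base
    then show ?case using that(2) by simp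
  next
    case (step a b)
    have ab: "a \<in> S" "b \<in> S" "{a, b} \<in> TE" using step.hyps by auto
    consider "a = t" "b = p" | "b = t" "a = p" | "a \<noteq> t" "b \<noteq> t"
    proof (cases "a = t \<or> b = t")
      case True
      then have "{a, b} = {t, p}" using leaf[OF ab(3)] by blast
      then show thesis using that tp by (auto simp: doubleton_eq_iff)
    next
      case False
      then show thesis using that by blast
    qed
    then show ?case
    proof cases
      case 1
      then show ?thesis using step.IH tp by simp
    next
      case 2
      then show ?thesis using step.IH tp ab by simp
    next
      case 3
      then have "{a, b} \<noteq> {t, p}" by (auto simp: doubleton_eq_iff)
      then have "(a, b) \<in> ?r'" using 3 ab by simp
      moreover have "(y, a) \<in> ?r'\<^sup>*" using step.IH 3 by simp
      ultimately show ?thesis using 3 by (meson rtrancl.rtrancl_into_rtrancl)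
    qed
  qed
  have r: "(y, z) \<in> ?r\<^sup>*" if "y \<in> S" "z \<in> S" for y z
    using con that by (simp add: connected_in_def)
  show "connected_in (TE - {{t, p}}) (S - {t})"
    unfolding connected_in_def
  proof (intro conjI ballI)
    show "S - {t} \<noteq> {}" using x by blast
    fix y z assume "y \<in> S - {t}" "z \<in> S - {t}"
    then show "(y, z) \<in> ?r'\<^sup>*" using path[of y z] r[of y z] by simp
  qed
  show "p \<in> S" if "t \<in> S" using path[of x t] r[of x t] x that by simp
qed

lemma is_tree_remove_leaf:
  assumes tree: "is_tree I TE" and t: "t \<in> I" "p \<in> I" "t \<noteq> p" "{t, p} \<in> TE"
    and leaf: "\<And>e. e \<in> TE \<Longrightarrow> t \<in> e \<Longrightarrow> e = {t, p}"
  shows "is_tree (I - {t}) (TE - {{t, p}})"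
proof -
  have sg: "simple_graph I TE" and con: "connected_in TE I" and cd: "card TE + 1 = card I"
    using tree by (auto simp: is_tree_def)
  have fin: "finite I" "finite TE" using sg simple_graph_finite by (auto simp: simple_graph_def)
  have "simple_graph (I - {t}) (TE - {{t, p}})"
    unfolding simple_graph_def
  proof (intro conjI ballI)
    show "finite (I - {t})" using fin by simp
    fix e assume e: "e \<in> TE - {{t, p}}"
    then have "t \<notin> e" using leaf by blast
    then show "e \<subseteq> I - {t}" "card e = 2" using sg e by (auto simp: simple_graph_def)
  qed
  moreover have "connected_in (TE - {{t, p}}) (I - {t})"
    using connected_in_remove_leaf(1)[OF con t(2) t(3)[symmetric] leaf t(3)] .
  moreover have "card (TE - {{t, p}}) + 1 = card (I - {t})"
    using cd fin t card_gt_0_iff[of TE] by auto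
  ultimately show ?thesis by (simp add: is_tree_def)
qed

section \<open>Pruning down to a single bag\<close>

context irreducible_graph
begin

text \<open>The last hypothesis is the pendant invariant for forgotten vertices. The others are
  those of a tree decomposition of width 6, required only for vertices that still occur in a bag,
  and so all of them survive the removal of a leaf.\<close>

lemma tree_decomposed_edgeless:
  assumes "is_tree I TE"
    and "\<And>i. i \<in> I \<Longrightarrow> finite (B i) \<and> card (B i) \<le> 7"
    and "\<And>v. {i \<in> I. v \<in> B i} \<noteq> {} \<Longrightarrow> connected_in TE {i \<in> I. v \<in> B i}"
    and "\<And>u v. u \<in> nbrs E v \<Longrightarrow> u \<in> (\<Union>i\<in>I. B i) \<Longrightarrow> v \<in> (\<Union>i\<in>I. B i) \<Longrightarrow> \<exists>i\<in>I. u \<in> B i \<and> v \<in> B i"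
    and "\<And>d. d \<notin> (\<Union>i\<in>I. B i) \<Longrightarrow> card (nbrs E d) \<le> 6 \<and> (\<exists>i\<in>I. nbrs E d \<subseteq> B i)"
  shows "nbrs E v = {}"
  using assms
proof (induction "card I" arbitrary: I TE v rule: less_induct)
  case less
  note tree = less.prems(1) and bag = less.prems(2) and conn = less.prems(3)
    and edge = less.prems(4) and pend = less.prems(5)
  have finI: "finite I" and neI: "I \<noteq> {}"
    using tree by (auto simp: is_tree_def simple_graph_def connected_in_def)
  \<comment> \<open>The pendants at \<open>B t\<close> serve as \<open>D\<close>. A forgotten
    neighbour of a private vertex \<open>x\<close> has its neighbourhood in some bag; that bag
    contains \<open>x\<close>, hence is \<open>B t\<close>.\<close>
  have new: "nbrs E w \<subseteq> B t - R" if t: "t \<in> I" and R: "R \<subseteq> B t" and w: "w \<in> R"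
    and priv: "\<And>x i. x \<in> R \<Longrightarrow> i \<in> I \<Longrightarrow> x \<in> B i \<Longrightarrow> i = t" for t R w
  proof (rule no_new_edges[where D = "{d. d \<notin> (\<Union>i\<in>I. B i) \<and> nbrs E d \<subseteq> B t}"])
    show "finite (B t)" "card (B t) \<le> 7" using bag t by auto
    show "nbrs E x \<subseteq> B t \<union> {d. d \<notin> (\<Union>i\<in>I. B i) \<and> nbrs E d \<subseteq> B t}" if x: "x \<in> R" for x
    proof
      fix y assume y: "y \<in> nbrs E x"
      have xy: "x \<in> nbrs E y" using y nbrs_sym by blast
      show "y \<in> B t \<union> {d. d \<notin> (\<Union>i\<in>I. B i) \<and> nbrs E d \<subseteq> B t}"
      proof (cases "y \<in> (\<Union>i\<in>I. B i)")
        case True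
        have "x \<in> (\<Union>i\<in>I. B i)" using x R t by blast
        then obtain i where "i \<in> I" "y \<in> B i" "x \<in> B i" using edge[OF y True] by blast
        then show ?thesis using priv[OF x] by blast
      next
        case False
        then obtain i where "i \<in> I" "nbrs E y \<subseteq> B i" using pend by blast
        then show ?thesis using priv[OF x, of i] xy False by blast
      qed
    qed
    show "d \<notin> B t \<and> nbrs E d \<subseteq> B t \<and> card (nbrs E d) \<le> 6"
      if "d \<in> {d. d \<notin> (\<Union>i\<in>I. B i) \<and> nbrs E d \<subseteq> B t}" for d
      using that pend[of d] t by blast
  qed (use R w in auto)
  show ?case
  proof (cases "card I = 1")
    case True
    then obtain t where I: "I = {t}" by (rule card_1_singletonE)
    \<comment> \<open>In a single bag every vertex is private, so \<open>R\<close> is the whole bag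
      and no neighbour is left.\<close>
    have inner: "nbrs E w = {}" if "w \<in> B t" for w
      using new[of t "B t" w] that I by auto
    have "nbrs E w = {}" if "w \<notin> B t" for w
    proof -
      have "nbrs E w \<subseteq> B t" using pend[of w] that I by auto
      then show ?thesis using inner nbrs_sym by blast
    qed
    then show ?thesis using inner by blast
  next
    case False
    then have "2 \<le> card I" using finI neI card_0_eq[OF finI] by linarith
    then obtain t p where t: "t \<in> I" "p \<in> I" "t \<noteq> p" "{t, p} \<in> TE"
      and leaf: "\<And>e. e \<in> TE \<Longrightarrow> t \<in> e \<Longrightarrow> e = {t, p}"
      using tree_leaf[OF tree] by blast
    let ?I = "I - {t}" and ?R = "B t - B p"
    \<comment> \<open>The nodes whose bags contain \<open>x\<close> are connected. If
      \<open>t\<close> and another node are among them, so is \<open>p\<close>, the only neighbour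
      of \<open>t\<close>, contrary to \<open>x \<notin> B p\<close>.\<close>
    have priv: "i = t" if "x \<in> ?R" "i \<in> I" "x \<in> B i" for x i
    proof (rule ccontr)
      assume "i \<noteq> t"
      then have "p \<in> {i \<in> I. x \<in> B i}"
        using connected_in_remove_leaf(2)[OF conn, of x i t p] that t leaf by blast
      then show False using that by blast
    qed
    have R: "nbrs E w \<subseteq> B t - ?R" if "w \<in> ?R" for w
      by (rule new[OF t(1) Diff_subset that]) (rule priv)
    have cover: "(\<Union>i\<in>?I. B i) = (\<Union>i\<in>I. B i) - ?R"
    proof (intro equalityI subsetI)
      fix x assume "x \<in> (\<Union>i\<in>?I. B i)"
      then obtain i where "i \<in> I" "i \<noteq> t" "x \<in> B i" by blast
      then show "x \<in> (\<Union>i\<in>I. B i) - ?R" using priv[of x i] by blast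
    next
      fix x assume "x \<in> (\<Union>i\<in>I. B i) - ?R"
      then show "x \<in> (\<Union>i\<in>?I. B i)" using t by blast
    qed
    show ?thesis
    proof (rule less.hyps[of ?I "TE - {{t, p}}"])
      show "card ?I < card I" using card_Diff1_less[OF finI t(1)] .
      show "is_tree ?I (TE - {{t, p}})" by (rule is_tree_remove_leaf[OF tree t leaf])
      show "finite (B i) \<and> card (B i) \<le> 7" if "i \<in> ?I" for i using bag that by blast
      show "connected_in (TE - {{t, p}}) {i \<in> ?I. v \<in> B i}" if ne: "{i \<in> ?I. v \<in> B i} \<noteq> {}" for v
      proof -
        obtain i where i: "i \<in> {i \<in> I. v \<in> B i}" "i \<noteq> t" using ne by blast
        have "{i \<in> ?I. v \<in> B i} = {i \<in> I. v \<in> B i} - {t}" by blast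
        then show ?thesis
          using connected_in_remove_leaf(1)[OF conn i leaf t(3)] i by auto
      qed
      show "\<exists>i\<in>?I. u \<in> B i \<and> v \<in> B i"
        if uv: "u \<in> nbrs E v" "u \<in> (\<Union>i\<in>?I. B i)" "v \<in> (\<Union>i\<in>?I. B i)" for u v
      proof -
        obtain i where "i \<in> I" "u \<in> B i" "v \<in> B i" using edge[OF uv(1)] uv(2,3) by blast
        \<comment> \<open>If the common bag is \<open>B t\<close>, then both vertices lie in
          \<open>B p\<close> as well, because those in \<open>?R\<close> have left all bags.\<close>
        then show ?thesis using uv(2,3) t unfolding cover by blast
      qed
      show "card (nbrs E d) \<le> 6 \<and> (\<exists>i\<in>?I. nbrs E d \<subseteq> B i)" if d: "d \<notin> (\<Union>i\<in>?I. B i)" for d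
      proof (cases "d \<in> ?R")
        case True
        \<comment> \<open>The newly forgotten \<open>d\<close> has its neighbours in
          \<open>B t \<inter> B p\<close>. Since \<open>d\<close> itself occupies one of the seven
          places in \<open>B t\<close>, its degree is at most 6, and it becomes a pendant at
          \<open>p\<close>.\<close>
        have "nbrs E d \<subseteq> B t - {d}" using R[OF True] True by blast
        then have "card (nbrs E d) \<le> card (B t - {d})" using bag t by (intro card_mono) auto
        also have "\<dots> \<le> 6" using bag[OF t(1)] True by auto
        finally show ?thesis using R[OF True] t by blast
      next
        case False
        then have d': "d \<notin> (\<Union>i\<in>I. B i)" using d cover by blast
        then obtain i where i: "i \<in> I" "nbrs E d \<subseteq> B i" and le: "card (nbrs E d) \<le> 6"
          using pend by blast
        \<comment> \<open>An old pendant moves from \<open>t\<close> to \<open>p\<close>: a vertex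
          of \<open>?R\<close> has neighbours only in \<open>B t\<close>, so it is not adjacent to
          \<open>d\<close>.\<close>
        have "nbrs E d \<subseteq> B p" if "i = t"
        proof
          fix x assume x: "x \<in> nbrs E d"
          then have "d \<in> nbrs E x" using nbrs_sym by blast
          then have "x \<notin> ?R" using R[of x] d' t by blast
          then show "x \<in> B p" using x i that by blast
        qed
        then show ?thesis using i le t by blast
      qed
    qed
  qed
qed

end

section \<open>Existence of reductions and the induction on the number of edges\<close>

lemma treewidth_le_6_reduction:
  assumes simple: "simple_graph V E" and tw: "treewidth_le V E 6" and ne: "E \<noteq> {}"
  shows "\<exists>S X Y. reduction E S X Y"
proof (rule ccontr)
  assume "\<nexists>S X Y. reduction E S X Y"
  then interpret irreducible_graph V E by unfold_locales (use simple in auto)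
  obtain I TE B where td: "tree_decomposition V E I TE B" and w: "\<forall>i\<in>I. card (B i) \<le> 6 + 1"
    using tw unfolding treewidth_le_def by blast
  have finV: "finite V" using simple by (simp add: simple_graph_def)
  have sub: "B i \<subseteq> V" if "i \<in> I" for i using td that by (simp add: tree_decomposition_def)
  have "nbrs E v = {}" for v
  proof (rule tree_decomposed_edgeless[of I TE B])
    show "is_tree I TE" using td by (simp add: tree_decomposition_def)
    show "finite (B i) \<and> card (B i) \<le> 7" if "i \<in> I" for i
      using sub[OF that] w that finV finite_subset by fastforce
    show "connected_in TE {i \<in> I. v \<in> B i}" if "{i \<in> I. v \<in> B i} \<noteq> {}" for v
    proof -
      have "v \<in> V" using that sub by blast
      then show ?thesis using td by (simp add: tree_decomposition_def)
    qed
    show "\<exists>i\<in>I. u \<in> B i \<and> v \<in> B i" if "u \<in> nbrs E v" for u v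
    proof -
      have "{v, u} \<in> E" using that by (simp add: nbrs_def)
      then obtain i where "i \<in> I" "{v, u} \<subseteq> B i"
        using td unfolding tree_decomposition_def by meson
      then show ?thesis by blast
    qed
    show "card (nbrs E d) \<le> 6 \<and> (\<exists>i\<in>I. nbrs E d \<subseteq> B i)" if "d \<notin> (\<Union>i\<in>I. B i)" for d
    proof -
      \<comment> \<open>Nothing has been forgotten at the start: only points outside
        \<open>V\<close> lie in no bag, and they have no neighbours.\<close>
      have "d \<notin> V" using that td unfolding tree_decomposition_def by blast
      then have "nbrs E d = {}" using nbrs_sym nbrs_subset by blast
      moreover have "I \<noteq> {}" using td by (auto simp: tree_decomposition_def is_tree_def connected_in_def)
      ultimately show ?thesis by auto
    qed
  qed
  moreover obtain e where e: "e \<in> E" using ne by blast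
  moreover obtain u v where "e = {u, v}" using edge_card[OF e] by (meson card_2_iff)
  ultimately show False by (auto simp: nbrs_def)
qed

theorem theorem3p5:
  fixes V :: "'a set" and E :: "'a set set"
  assumes "simple_graph V E"
    and "treewidth_le V E 6"
  shows "tau V E \<le> 2 * nu V E"
  using assms
proof (induction "card E" arbitrary: E rule: less_induct)
  case less
  show ?case
  proof (cases "E = {}")
    case True
    \<comment> \<open>Without edges the empty transversal shows that \<open>tau V E\<close> is
      0.\<close>
    have "triangle_transversal V E {}" using True by (auto simp: triangle_transversal_def triangles_def)
    then show ?thesis using tau_le[OF less.prems(1)] by fastforce
  next
    case False
    then obtain S X Y where red: "reduction E S X Y"
      using treewidth_le_6_reduction less.prems by blast
    let ?E = "E - (S \<union> X)"
    have "?E \<subset> E" using red by (auto simp: reduction_def)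
    then have "card ?E < card E" using simple_graph_finite less.prems(1) psubset_card_mono by blast
    moreover have "treewidth_le V ?E 6"
    proof -
      obtain I TE B where "tree_decomposition V E I TE B" and w: "\<forall>i\<in>I. card (B i) \<le> 6 + 1"
        using less.prems(2) unfolding treewidth_le_def by blast
      \<comment> \<open>Deleting edges keeps the vertex set and only weakens the condition on edges,
        so the same bags serve.\<close>
      then have "tree_decomposition V ?E I TE B" by (simp add: tree_decomposition_def)
      then show ?thesis using w unfolding treewidth_le_def by blast
    qed
    moreover have "simple_graph V ?E" using simple_graph_subset[OF less.prems(1)] by blast
    ultimately have "tau V ?E \<le> 2 * nu V ?E" using less.hyps by blast
    then show ?thesis by (rule reduction_tau_nu[OF less.prems(1) red])
  qed
qed

end
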